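(* Let $(X,\|\cdot\|,\tau)$ be a sequentially complete d-consistent Mazur--Saks space with mixed topology $\gamma$ and $(T(t))_{t\geq 0}$ a bi-continuous semigroup on $X$ with generator $(A,D(A))$. Let $\Lambda$ be the set of all $\lambda\in\rho(A)$ such that $R(\lambda,A)^{\bullet}X^{\bullet}\subset D(A^{\bullet})$, and let $B_{(X,\|\cdot\|^{\bullet})}=\{x\in X : \|x\|^{\bullet}\le 1\}$. Then the following assertions are equivalent, where in (ii) and (iii) "for some (all)" means that the version with "some" and the version with "all" are each equivalent to the other assertions: (i) $Fav(T)=D(A)$. (ii) $R(\lambda,A)B_{(X,\|\cdot\|^{\bullet})}$ is $\gamma$-closed for some (all) $\lambda\in\Lambda$. (iii) $R(\lambda,A)B_{(X,\|\cdot\|^{\bullet})}$ is sequentially $\gamma$-closed for some (all) $\lambda\in\Lambda$.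
   Context: Vector spaces are over $\mathbb{K}=\mathbb{R}$ or $\mathbb{C}$. For a Banach space $(X,\|\cdot\|)$, $X'$ is the norm dual with dual norm $\|\cdot\|_{X'}$ and $\mathcal{L}(X)$ the bounded operators on $X$. Let $(X,\|\cdot\|)$ be a Banach space and $\tau$ a Hausdorff locally convex topology on $X$ coarser than the norm topology $\tau_{\|\cdot\|}$. The mixed topology $\gamma=\gamma(\|\cdot\|,\tau)$ is the finest linear topology on $X$ that coincides with $\tau$ on $\|\cdot\|$-bounded sets and satisfies $\tau\le\gamma\le\tau_{\|\cdot\|}$ (it is Hausdorff locally convex). $(X,\|\cdot\|,\tau)$ is a Saks space if there is a directed system of seminorms $\mathcal{P}_\tau$ generating $\tau$ with $\|x\|=\sup_{p\in\mathcal{P}_\tau}p(x)$ for all $x\in X$; it is sequentially complete if $(X,\gamma)$ is sequentially complete; it is Mazur (a Mazur--Saks space) if every linear $\gamma$-sequentially continuous functional on $X$ is $\gamma$-continuous. $X^{\circ}=\{x'\in X' : x' \text{ is } \tau\text{-sequentially continuous on } \|\cdot\|\text{-bounded sets}\}$, a closed subspace of $X'$. $(X,\|\cdot\|,\tau)$ is d-consistent if (i) $X^{\circ}\cap\{x'\in X':\|x'\|_{X'}\le1\}$ is sequentially complete w.r.t. $\sigma(X^{\circ},X)$, and (ii) every $\|\cdot\|_{X'}$-bounded $\sigma(X^{\circ},X)$-null sequence in $X^{\circ}$ is $\tau$-equicontinuous on $\|\cdot\|$-bounded sets (i.e. its restriction to every $\|\cdot\|$-bounded set $B$ is equicontinuous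 for the topology induced by $\tau$ on $B$). A bi-continuous semigroup on $X$ is a family $(T(t))_{t\ge0}$ in $\mathcal{L}(X)$ with $T(0)=\mathrm{id}$, $T(t+s)=T(t)T(s)$; $t\mapsto T(t)x\in(X,\gamma)$ continuous on $[0,\infty)$ for every $x\in X$; and, whenever $x_n\to x$ in $(X,\gamma)$, $T(t)(x_n-x)\to0$ in $(X,\gamma)$ locally uniformly in $t\in[0,\infty)$. Its generator is $Ax=\gamma\text{-}\lim_{t\to0+}\frac{T(t)x-x}{t}$ with $D(A)$ the set of $x\in X$ for which this limit exists in $X$. $\rho(A)$ is the set of scalars $\lambda$ such that $\lambda-A\colon D(A)\to X$ is bijective with $R(\lambda,A)=(\lambda-A)^{-1}\in\mathcal{L}(X)$. The dual operators $T(t)'$ leave $X^\circ$ invariant; $T^{\circ}(t)=T(t)'|_{X^{\circ}}$. The bi-sun dual is $X^{\bullet}=\{x^{\circ}\in X^{\circ} : \lim_{t\to0+}\|T^{\circ}(t)x^{\circ}-x^{\circ}\|_{X'}=0\}$, a norm-closed $T^\circ$-invariant subspace; $T^{\bullet}(t)=T^{\circ}(t)|_{X^{\bullet}}$ is a norm-strongly continuous semigroup on $X^\bullet$ with generator $(A^{\bullet},D(A^{\bullet}))$. For $\lambda\in\rho(A)$, $R(\lambda,A)^{\bullet}=R(\lambda,A)'|_{X^{\bullet}}$ (restriction of the Banach space adjoint). $\|x\|^{\bullet}=\sup\{|\langle x^{\bullet},x\rangle| : x^{\bullet}\in X^{\bullet},\ \|x^{\bullet}\|_{X'}\le1\}$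 for $x\in X$. The Favard space is $Fav(T)=\{x\in X : \limsup_{t\to0+}\frac1t\|T(t)x-x\|<\infty\}$. *)

theory Defs
  imports "HOL-Analysis.Analysis"
begin

text \<open>Scalar fields. Up to isometric isomorphism, the only types of this class are the real and
  the complex numbers with their usual absolute values (a multiplicative norm that extends the
  one on the reals is unique).\<close>

class real_or_complex = real_normed_field + euclidean_space +
  assumes real_or_complex:
    "(\<forall>z. \<exists>a. z = a *\<^sub>R 1) \<or>
     (\<exists>i. i * i = - 1 \<and> (\<forall>z. \<exists>a b. z = a *\<^sub>R 1 + b *\<^sub>R i))"

instance real :: real_or_complex
  by standard auto

instance complex :: real_or_complex
proof
  have "z = Re z *\<^sub>R 1 + Im z *\<^sub>R \<i>" for z
    by (simp add: complex_eq_iff)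
  moreover have "\<i> * \<i> = - 1"
    by simp
  ultimately show "(\<forall>z::complex. \<exists>a. z = a *\<^sub>R 1) \<or>
     (\<exists>i::complex. i * i = - 1 \<and> (\<forall>z. \<exists>a b. z = a *\<^sub>R 1 + b *\<^sub>R i))"
    by blast
qed

text \<open>The library has normed spaces over the reals only. A Banach space over \<open>'k\<close> is here a real
  Banach space together with a compatible scalar multiplication \<open>smul\<close> by \<open>'k\<close>.\<close>

locale banach_space_over = vector_space smul
  for smul :: "'k::real_or_complex \<Rightarrow> 'x::banach \<Rightarrow> 'x" +
  assumes scale_of_real: "smul (of_real r) x = r *\<^sub>R x"
    and norm_scale: "norm (smul c x) = norm c * norm x"


section \<open>Linear topologies\<close>

definition coarser :: "'a topology \<Rightarrow> 'a topology \<Rightarrow> bool" where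
  "coarser S T \<longleftrightarrow> topspace S = topspace T \<and> (\<forall>U. openin S U \<longrightarrow> openin T U)"

definition linear_topology ::
  "('k::real_or_complex \<Rightarrow> 'x::banach \<Rightarrow> 'x) \<Rightarrow> 'x topology \<Rightarrow> bool" where
  "linear_topology smul \<sigma> \<longleftrightarrow>
     topspace \<sigma> = UNIV \<and>
     continuous_map (prod_topology \<sigma> \<sigma>) \<sigma> (\<lambda>(x, y). x + y) \<and>
     continuous_map (prod_topology euclidean \<sigma>) \<sigma> (\<lambda>(c, x). smul c x)"

definition locally_convex_topology ::
  "('k::real_or_complex \<Rightarrow> 'x::banach \<Rightarrow> 'x) \<Rightarrow> 'x topology \<Rightarrow> bool" where
  "locally_convex_topology smul \<sigma> \<longleftrightarrow>
     linear_topology smul \<sigma> \<and>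
     (\<forall>U. openin \<sigma> U \<and> 0 \<in> U \<longrightarrow>
        (\<exists>V W. openin \<sigma> W \<and> 0 \<in> W \<and> W \<subseteq> V \<and> convex V \<and> V \<subseteq> U))"

definition seminorm_over ::
  "('k::real_or_complex \<Rightarrow> 'x::banach \<Rightarrow> 'x) \<Rightarrow> ('x \<Rightarrow> real) \<Rightarrow> bool" where
  "seminorm_over smul p \<longleftrightarrow>
     (\<forall>x y. p (x + y) \<le> p x + p y) \<and> (\<forall>c x. p (smul c x) = norm c * p x)"

definition seminorm_topology :: "('x::banach \<Rightarrow> real) set \<Rightarrow> 'x topology" where
  "seminorm_topology P =
     topology_generated_by {{y. p (y - x) < e} | p x e. p \<in> P \<and> e > 0}"

definition Cauchy_in :: "'v::ab_group_add topology \<Rightarrow> (nat \<Rightarrow> 'v) \<Rightarrow> bool" where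
  "Cauchy_in \<sigma> f \<longleftrightarrow>
     (\<forall>U. openin \<sigma> U \<and> 0 \<in> U \<longrightarrow> (\<exists>N. \<forall>m\<ge>N. \<forall>n\<ge>N. f m - f n \<in> U))"

definition sequentially_complete_in :: "'v::ab_group_add topology \<Rightarrow> 'v set \<Rightarrow> bool" where
  "sequentially_complete_in \<sigma> S \<longleftrightarrow>
     (\<forall>f. range f \<subseteq> S \<and> Cauchy_in \<sigma> f \<longrightarrow> (\<exists>l\<in>S. limitin \<sigma> f l sequentially))"

definition sequentially_closedin :: "'a topology \<Rightarrow> 'a set \<Rightarrow> bool" where
  "sequentially_closedin \<sigma> S \<longleftrightarrow>
     S \<subseteq> topspace \<sigma> \<and> (\<forall>f l. range f \<subseteq> S \<and> limitin \<sigma> f l sequentially \<longrightarrow> l \<in> S)"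

definition sequentially_continuous_on ::
  "'a topology \<Rightarrow> 'a set \<Rightarrow> ('a \<Rightarrow> 'b::topological_space) \<Rightarrow> bool" where
  "sequentially_continuous_on \<sigma> B g \<longleftrightarrow>
     (\<forall>f l. range f \<subseteq> B \<and> l \<in> B \<and> limitin \<sigma> f l sequentially \<longrightarrow> (\<lambda>n. g (f n)) \<longlonglongrightarrow> g l)"

definition equicontinuous_on ::
  "'a topology \<Rightarrow> 'a set \<Rightarrow> (nat \<Rightarrow> 'a \<Rightarrow> 'b::metric_space) \<Rightarrow> bool" where
  "equicontinuous_on \<sigma> B g \<longleftrightarrow>
     (\<forall>x\<in>B. \<forall>e>0. \<exists>U. openin (subtopology \<sigma> B) U \<and> x \<in> U \<and>
        (\<forall>y\<in>U. \<forall>n. dist (g n y) (g n x) < e))"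


section \<open>The mixed topology and Saks spaces\<close>

definition mixed_candidate ::
  "('k::real_or_complex \<Rightarrow> 'x::banach \<Rightarrow> 'x) \<Rightarrow> 'x topology \<Rightarrow> 'x topology \<Rightarrow> bool" where
  "mixed_candidate smul \<tau> \<sigma> \<longleftrightarrow>
     linear_topology smul \<sigma> \<and>
     (\<forall>B. bounded B \<longrightarrow> subtopology \<sigma> B = subtopology \<tau> B) \<and>
     coarser \<tau> \<sigma> \<and> coarser \<sigma> euclidean"

definition mixed_topology ::
  "('k::real_or_complex \<Rightarrow> 'x::banach \<Rightarrow> 'x) \<Rightarrow> 'x topology \<Rightarrow> 'x topology" where
  "mixed_topology smul \<tau> =
     (THE \<gamma>. mixed_candidate smul \<tau> \<gamma> \<and> (\<forall>\<sigma>. mixed_candidate smul \<tau> \<sigma> \<longrightarrow> coarser \<sigma> \<gamma>))"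

lemma coarser_continuous_map_id:
  assumes "coarser S T"
  shows "continuous_map T S (\<lambda>x. x)"
proof -
  have "{x \<in> topspace T. x \<in> U} = U" if "openin S U" for U
    using that assms openin_subset unfolding coarser_def by fastforce
  then show ?thesis
    using assms by (simp add: coarser_def continuous_map_def)
qed

lemma mixed_topology_finest:
  assumes lin: "linear_topology smul \<tau>" and coa: "coarser \<tau> euclidean"
  shows "mixed_candidate smul \<tau> (mixed_topology smul \<tau>)"
    and "mixed_candidate smul \<tau> \<sigma> \<Longrightarrow> coarser \<sigma> (mixed_topology smul \<tau>)"
proof -
  let ?S = "{U. \<exists>\<sigma>. mixed_candidate smul \<tau> \<sigma> \<and> openin \<sigma> U}"
  let ?P = "\<lambda>\<gamma>. mixed_candidate smul \<tau> \<gamma> \<and>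
    (\<forall>\<sigma>. mixed_candidate smul \<tau> \<sigma> \<longrightarrow> coarser \<sigma> \<gamma>)"
  define G where "G = topology_generated_by ?S"
  have top: "topspace \<sigma> = UNIV" if "mixed_candidate smul \<tau> \<sigma>" for \<sigma>
    using that by (auto simp: mixed_candidate_def linear_topology_def)
  have c\<tau>: "mixed_candidate smul \<tau> \<tau>"
    using assms by (auto simp: mixed_candidate_def coarser_def)
  have UN: "\<Union> ?S = UNIV"
  proof -
    have "openin \<tau> UNIV"
      using openin_topspace[of \<tau>] by (simp add: top[OF c\<tau>])
    then have "UNIV \<in> ?S" using c\<tau> by blast
    then show ?thesis by blast
  qed
  have topG: "topspace G = UNIV"
    unfolding G_def topology_generated_by_topspace by (rule UN)
  have le: "coarser \<sigma> G" if "mixed_candidate smul \<tau> \<sigma>" for \<sigma>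
    unfolding coarser_def
  proof (intro conjI allI impI)
    fix U assume "openin \<sigma> U"
    then have "U \<in> ?S" using that by blast
    then show "openin G U" unfolding G_def by (rule topology_generated_by_Basis)
  qed (simp add: topG top[OF that])
  have into: "continuous_map Y G f"
    if "\<And>\<sigma>. mixed_candidate smul \<tau> \<sigma> \<Longrightarrow> continuous_map Y \<sigma> f" for Y and f :: "'c \<Rightarrow> 'b"
    unfolding G_def
  proof (rule continuous_on_generated_topo)
    fix U assume "U \<in> ?S"
    then obtain \<sigma> where "mixed_candidate smul \<tau> \<sigma>" "openin \<sigma> U" by blast
    then show "openin Y (f -` U \<inter> topspace Y)"
      using that[of \<sigma>] by (simp add: continuous_map_alt)
  next
    show "f ` topspace Y \<subseteq> \<Union> ?S"
      unfolding UN by (rule subset_UNIV)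
  qed
  have cmp: "coarser S T" if "continuous_map T S (\<lambda>x. x)" "topspace S = UNIV" "topspace T = UNIV"
    for S T :: "'b topology"
    using that by (simp add: coarser_def continuous_map_def)
  have idG: "continuous_map G \<sigma> (\<lambda>x. x)" if "mixed_candidate smul \<tau> \<sigma>" for \<sigma>
    using coarser_continuous_map_id le that by blast
  have linG: "linear_topology smul G"
    unfolding linear_topology_def
  proof (intro conjI topG into)
    fix \<sigma> assume s: "mixed_candidate smul \<tau> \<sigma>"
    then have a: "continuous_map (prod_topology \<sigma> \<sigma>) \<sigma> (\<lambda>(x, y). x + y)"
      and b: "continuous_map (prod_topology euclidean \<sigma>) \<sigma> (\<lambda>(c, x). smul c x)"
      by (auto simp: mixed_candidate_def linear_topology_def)
    have "continuous_map (prod_topology G G) (prod_topology \<sigma> \<sigma>) (\<lambda>(x, y). (x, y))"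
      by (rule continuous_map_prod_top[THEN iffD2]) (use idG[OF s] in auto)
    from continuous_map_compose[OF this a]
    show "continuous_map (prod_topology G G) \<sigma> (\<lambda>(x, y). x + y)"
      by (simp add: o_def case_prod_unfold)
    have "continuous_map (prod_topology (euclidean :: 'a topology) G) (prod_topology euclidean \<sigma>)
        (\<lambda>(x, y). (x, y))"
      by (rule continuous_map_prod_top[THEN iffD2]) (use idG[OF s] in auto)
    from continuous_map_compose[OF this b]
    show "continuous_map (prod_topology euclidean G) \<sigma> (\<lambda>(c, x). smul c x)"
      by (simp add: o_def case_prod_unfold)
  qed
  have sub: "subtopology G B = subtopology \<tau> B" if B: "bounded B" for B
  proof -
    have "continuous_map (subtopology \<tau> B) G (\<lambda>x. x)"
    proof (rule into)
      fix \<sigma> assume s: "mixed_candidate smul \<tau> \<sigma>"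
      have "subtopology \<tau> B = subtopology \<sigma> B"
        using s B unfolding mixed_candidate_def by simp
      then show "continuous_map (subtopology \<tau> B) \<sigma> (\<lambda>x. x)"
        by (simp add: continuous_map_from_subtopology)
    qed
    then have 1: "openin (subtopology \<tau> B) (U \<inter> B)" if "openin G U" for U
      using that top[OF c\<tau>] by (simp add: continuous_map_alt)
    show ?thesis
      unfolding topology_eq
    proof (intro allI iffI)
      fix W assume "openin (subtopology G B) W"
      then show "openin (subtopology \<tau> B) W"
        using 1 by (auto simp: openin_subtopology[of G])
    next
      fix W assume "openin (subtopology \<tau> B) W"
      then show "openin (subtopology G B) W"
        using le[OF c\<tau>] by (auto simp: openin_subtopology coarser_def)
    qed
  qed
  have "continuous_map euclidean G (\<lambda>x. x)"
    by (rule into) (auto simp: mixed_candidate_def intro: coarser_continuous_map_id)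
  then have "mixed_candidate smul \<tau> G"
    unfolding mixed_candidate_def using linG sub le[OF c\<tau>] cmp[of euclidean G] topG by simp
  then have PG: "?P G" using le by blast
  have uniq: "\<gamma> = G" if "?P \<gamma>" for \<gamma>
  proof -
    have "coarser \<gamma> G" "coarser G \<gamma>" using that PG by blast+
    then show ?thesis by (auto simp: coarser_def topology_eq)
  qed
  have "mixed_topology smul \<tau> = G"
    unfolding mixed_topology_def by (rule the_equality[of ?P, OF PG uniq])
  then show "mixed_candidate smul \<tau> (mixed_topology smul \<tau>)"
    and "mixed_candidate smul \<tau> \<sigma> \<Longrightarrow> coarser \<sigma> (mixed_topology smul \<tau>)"
    using PG by blast+
qed

definition saks_space ::
  "('k::real_or_complex \<Rightarrow> 'x::banach \<Rightarrow> 'x) \<Rightarrow> 'x topology \<Rightarrow> bool" where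
  "saks_space smul \<tau> \<longleftrightarrow>
     banach_space_over smul \<and>
     locally_convex_topology smul \<tau> \<and> Hausdorff_space \<tau> \<and> coarser \<tau> euclidean \<and>
     (\<exists>P. P \<noteq> {} \<and> (\<forall>p\<in>P. seminorm_over smul p) \<and>
        (\<forall>p\<in>P. \<forall>q\<in>P. \<exists>r\<in>P. \<forall>x. p x \<le> r x \<and> q x \<le> r x) \<and>
        \<tau> = seminorm_topology P \<and>
        (\<forall>x. bdd_above ((\<lambda>p. p x) ` P) \<and> norm x = (SUP p\<in>P. p x)))"

definition sequentially_complete_saks_space ::
  "('k::real_or_complex \<Rightarrow> 'x::banach \<Rightarrow> 'x) \<Rightarrow> 'x topology \<Rightarrow> bool" where
  "sequentially_complete_saks_space smul \<tau> \<longleftrightarrow>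
     saks_space smul \<tau> \<and> sequentially_complete_in (mixed_topology smul \<tau>) UNIV"

definition mazur_saks_space ::
  "('k::real_or_complex \<Rightarrow> 'x::banach \<Rightarrow> 'x) \<Rightarrow> 'x topology \<Rightarrow> bool" where
  "mazur_saks_space smul \<tau> \<longleftrightarrow>
     saks_space smul \<tau> \<and>
     (\<forall>\<phi> :: 'x \<Rightarrow> 'k. Vector_Spaces.linear smul (*) \<phi> \<and>
        sequentially_continuous_on (mixed_topology smul \<tau>) UNIV \<phi> \<longrightarrow>
        continuous_map (mixed_topology smul \<tau>) euclidean \<phi>)"


section \<open>Dual spaces and d-consistency\<close>

text \<open>Bounded functionals and operators are real-linear bounded maps, with the operator norm of the
  library, that commute with the scalar multiplication.\<close>

definition norm_dual ::
  "('k::real_or_complex \<Rightarrow> 'x::banach \<Rightarrow> 'x) \<Rightarrow> ('x \<Rightarrow>\<^sub>L 'k) set" where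
  "norm_dual smul = {\<phi>. \<forall>c x. blinfun_apply \<phi> (smul c x) = c * blinfun_apply \<phi> x}"

definition bounded_operators ::
  "('k::real_or_complex \<Rightarrow> 'x::banach \<Rightarrow> 'x) \<Rightarrow> ('x \<Rightarrow>\<^sub>L 'x) set" where
  "bounded_operators smul =
     {S. \<forall>c x. blinfun_apply S (smul c x) = smul c (blinfun_apply S x)}"

definition circ_dual ::
  "('k::real_or_complex \<Rightarrow> 'x::banach \<Rightarrow> 'x) \<Rightarrow> 'x topology \<Rightarrow> ('x \<Rightarrow>\<^sub>L 'k) set" where
  "circ_dual smul \<tau> =
     {\<phi> \<in> norm_dual smul.
        \<forall>B. bounded B \<longrightarrow> sequentially_continuous_on \<tau> B (blinfun_apply \<phi>)}"

text \<open>\<open>strong_operator_topology\<close> is the topology of pointwise convergence on bounded linear maps;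
  on a space of functionals it is the weak topology induced by evaluation at points.\<close>

definition circ_weak_topology ::
  "('k::real_or_complex \<Rightarrow> 'x::banach \<Rightarrow> 'x) \<Rightarrow> 'x topology \<Rightarrow> ('x \<Rightarrow>\<^sub>L 'k) topology" where
  "circ_weak_topology smul \<tau> = subtopology strong_operator_topology (circ_dual smul \<tau>)"

definition d_consistent ::
  "('k::real_or_complex \<Rightarrow> 'x::banach \<Rightarrow> 'x) \<Rightarrow> 'x topology \<Rightarrow> bool" where
  "d_consistent smul \<tau> \<longleftrightarrow>
     sequentially_complete_in (circ_weak_topology smul \<tau>)
       {\<phi> \<in> circ_dual smul \<tau>. norm \<phi> \<le> 1} \<and>
     (\<forall>\<phi> :: nat \<Rightarrow> 'x \<Rightarrow>\<^sub>L 'k.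
        range \<phi> \<subseteq> circ_dual smul \<tau> \<and> bounded (range \<phi>) \<and>
        limitin (circ_weak_topology smul \<tau>) \<phi> 0 sequentially \<longrightarrow>
        (\<forall>B. bounded B \<longrightarrow> equicontinuous_on \<tau> B (\<lambda>n. blinfun_apply (\<phi> n))))"


section \<open>Bi-continuous semigroups\<close>

text \<open>A semigroup is a function on all of the reals of which only the values at \<open>t \<ge> 0\<close> matter.\<close>

definition bicontinuous_semigroup ::
  "('k::real_or_complex \<Rightarrow> 'x::banach \<Rightarrow> 'x) \<Rightarrow> 'x topology \<Rightarrow> (real \<Rightarrow> 'x \<Rightarrow>\<^sub>L 'x) \<Rightarrow> bool" where
  "bicontinuous_semigroup smul \<tau> T \<longleftrightarrow>
     (\<forall>t\<ge>0. T t \<in> bounded_operators smul) \<and>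
     T 0 = id_blinfun \<and>
     (\<forall>t\<ge>0. \<forall>s\<ge>0. T (t + s) = T t o\<^sub>L T s) \<and>
     (\<forall>x. continuous_map (top_of_set {0..}) (mixed_topology smul \<tau>)
        (\<lambda>t. blinfun_apply (T t) x)) \<and>
     (\<forall>f x. limitin (mixed_topology smul \<tau>) f x sequentially \<longrightarrow>
        (\<forall>s\<ge>0. \<forall>U. openin (mixed_topology smul \<tau>) U \<and> 0 \<in> U \<longrightarrow>
           (\<exists>N. \<forall>n\<ge>N. \<forall>t\<in>{0..s}. blinfun_apply (T t) (f n - x) \<in> U)))"

definition generator_dom :: "'x::banach topology \<Rightarrow> (real \<Rightarrow> 'x \<Rightarrow>\<^sub>L 'x) \<Rightarrow> 'x set" where
  "generator_dom \<gamma> T =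
     {x. \<exists>y. limitin \<gamma> (\<lambda>t. (1 / t) *\<^sub>R (blinfun_apply (T t) x - x)) y (at_right 0)}"

definition generator :: "'x::banach topology \<Rightarrow> (real \<Rightarrow> 'x \<Rightarrow>\<^sub>L 'x) \<Rightarrow> 'x \<Rightarrow> 'x" where
  "generator \<gamma> T x =
     (THE y. limitin \<gamma> (\<lambda>t. (1 / t) *\<^sub>R (blinfun_apply (T t) x - x)) y (at_right 0))"

text \<open>Below, a possibly unbounded operator is given by its domain \<open>D\<close> and a map \<open>A\<close> of which only
  the values on \<open>D\<close> matter.\<close>

definition resolvent_set ::
  "('k::real_or_complex \<Rightarrow> 'x::banach \<Rightarrow> 'x) \<Rightarrow> 'x set \<Rightarrow> ('x \<Rightarrow> 'x) \<Rightarrow> 'k set" where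
  "resolvent_set smul D A =
     {\<mu>. bij_betw (\<lambda>x. smul \<mu> x - A x) D UNIV \<and>
         inv_into D (\<lambda>x. smul \<mu> x - A x) \<in> blinfun_apply ` bounded_operators smul}"

definition resolvent ::
  "('k::real_or_complex \<Rightarrow> 'x::banach \<Rightarrow> 'x) \<Rightarrow> 'x set \<Rightarrow> ('x \<Rightarrow> 'x) \<Rightarrow> 'k \<Rightarrow> 'x \<Rightarrow>\<^sub>L 'x" where
  "resolvent smul D A \<mu> = Blinfun (inv_into D (\<lambda>x. smul \<mu> x - A x))"

text \<open>The adjoint of \<open>S\<close> is \<open>\<lambda>\<phi>. \<phi> o\<^sub>L S\<close>.\<close>

definition bisun_dual ::
  "('k::real_or_complex \<Rightarrow> 'x::banach \<Rightarrow> 'x) \<Rightarrow> 'x topology \<Rightarrow> (real \<Rightarrow> 'x \<Rightarrow>\<^sub>L 'x) \<Rightarrow>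
     ('x \<Rightarrow>\<^sub>L 'k) set" where
  "bisun_dual smul \<tau> T =
     {\<phi> \<in> circ_dual smul \<tau>. ((\<lambda>t. norm ((\<phi> o\<^sub>L T t) - \<phi>)) \<longlongrightarrow> 0) (at_right 0)}"

definition bisun_generator_dom ::
  "('k::real_or_complex \<Rightarrow> 'x::banach \<Rightarrow> 'x) \<Rightarrow> 'x topology \<Rightarrow> (real \<Rightarrow> 'x \<Rightarrow>\<^sub>L 'x) \<Rightarrow>
     ('x \<Rightarrow>\<^sub>L 'k) set" where
  "bisun_generator_dom smul \<tau> T =
     {\<phi> \<in> bisun_dual smul \<tau> T. \<exists>\<psi>\<in>bisun_dual smul \<tau> T.
        ((\<lambda>t. (1 / t) *\<^sub>R ((\<phi> o\<^sub>L T t) - \<phi>)) \<longlongrightarrow> \<psi>) (at_right 0)}"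

definition bisun_norm ::
  "('k::real_or_complex \<Rightarrow> 'x::banach \<Rightarrow> 'x) \<Rightarrow> 'x topology \<Rightarrow> (real \<Rightarrow> 'x \<Rightarrow>\<^sub>L 'x) \<Rightarrow> 'x \<Rightarrow> real" where
  "bisun_norm smul \<tau> T x =
     (SUP \<phi>\<in>{\<phi> \<in> bisun_dual smul \<tau> T. norm \<phi> \<le> 1}. norm (blinfun_apply \<phi> x))"

definition bisun_resolvent_set ::
  "('k::real_or_complex \<Rightarrow> 'x::banach \<Rightarrow> 'x) \<Rightarrow> 'x topology \<Rightarrow> (real \<Rightarrow> 'x \<Rightarrow>\<^sub>L 'x) \<Rightarrow>
     'x set \<Rightarrow> ('x \<Rightarrow> 'x) \<Rightarrow> 'k set" where
  "bisun_resolvent_set smul \<tau> T D A =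
     {\<mu> \<in> resolvent_set smul D A.
        (\<lambda>\<phi>. \<phi> o\<^sub>L resolvent smul D A \<mu>) ` bisun_dual smul \<tau> T \<subseteq> bisun_generator_dom smul \<tau> T}"

definition favard_space :: "(real \<Rightarrow> 'x::banach \<Rightarrow>\<^sub>L 'x) \<Rightarrow> 'x set" where
  "favard_space T =
     {x. Limsup (at_right 0) (\<lambda>t. ereal ((1 / t) * norm (blinfun_apply (T t) x - x))) < \<infinity>}"

end

theory Submission
  imports Defs
begin

text \<open>Write \<open>\<gamma>\<close> for the mixed topology, \<open>R = R(\<mu>,A)\<close> for a resolvent, \<open>B\<close> for the unit ball of the bi-sun norm and
\<open>X\<degree>\<close>, \<open>X\<bullet>\<close> for the two dual spaces.

The idea is that elements of the Favard space are exactly the limits of points of the domain on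
which the generator stays bounded. If \<open>z \<in> D(A)\<close>, then \<open>T(t)z - z\<close> is the integral of \<open>T(s)Az\<close> over
\<open>[0,t]\<close>, so its norm is at most \<open>t M \<parallel>Az\<parallel>\<close> (\<open>orbit_norm_increment\<close>), and this bound survives any limit
that can be tested with functionals. Conversely the means \<open>z\<^sub>t = (1/t) \<integral>\<^sub>0\<^sup>t T(s)x ds\<close> converge to \<open>x\<close> for \<open>\<gamma>\<close>
and satisfy \<open>A z\<^sub>t = (T(t)x - x)/t\<close>, which is bounded as \<open>t \<rightarrow> 0\<close> precisely when \<open>x\<close> is in the Favard
space. In particular the domain is always contained in the Favard space.

If \<open>R B\<close> is sequentially \<open>\<gamma>\<close>-closed and \<open>x\<close> is in the Favard space, then a multiple of the sequence
\<open>z\<^sub>1\<^sub>/\<^sub>n = R(\<mu> z\<^sub>1\<^sub>/\<^sub>n - A z\<^sub>1\<^sub>/\<^sub>n)\<close> stays in \<open>R B\<close>, since the bi-sun norm is below the norm. Hence its limit, a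
multiple of \<open>x\<close>, lies in \<open>R B \<subseteq> D(A)\<close> (\<open>favard_subset_of_sequentially_closed\<close>).

Suppose now that the Favard space is the domain and let \<open>x\<close> be in the \<open>\<gamma>\<close>-closure of \<open>R B\<close>. The bi-sun
norm is equivalent to the norm (\<open>norm_le_bisun_norm\<close>), so \<open>A\<close> is bounded on \<open>R B\<close>; the functionals in
\<open>X\<degree>\<close> are \<open>\<gamma>\<close>-continuous by the Mazur property and determine the norm, so \<open>x\<close> satisfies the Favard
estimate and lies in \<open>D(A)\<close>. It remains to see that \<open>y = (\<mu> - A)x\<close> is in \<open>B\<close>. For \<open>\<phi> \<in> X\<bullet>\<close> the difference
between \<open>\<phi>(Az)\<close> and \<open>\<phi>((T(t)z - z)/t)\<close> is small uniformly for \<open>\<parallel>Az\<parallel>\<close> bounded (\<open>bisun_increment\<close>); the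
second expression is \<open>\<gamma>\<close>-continuous in \<open>z\<close>, so \<open>\<phi>(y)\<close> is a limit of values \<open>\<phi>(w)\<close> with \<open>w \<in> B\<close>
(\<open>closed_of_favard_subset\<close>).

For the equivalence of the versions with "some" and "all" the set \<open>\<Lambda>\<close> must not be empty. For large
real \<open>l\<close> the operator \<open>S = e\<^sup>-\<^sup>l T(1)\<close> has norm at most \<open>1/2\<close>, and \<open>\<integral>\<^sub>0\<^sup>1 e\<^sup>-\<^sup>l\<^sup>s T(s) ds (1 - S)\<^sup>-\<^sup>1\<close> is the
resolvent at \<open>l\<close>; it has the required property (\<open>bisun_resolvent_set_nonempty\<close>).

All integrals are weak integrals: they are determined by the scalar integrals obtained from
functionals in \<open>X\<degree>\<close>, which norm \<open>X\<close> by the Hahn-Banach theorem, and they exist because Riemann sums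
are Cauchy sequences for \<open>\<gamma>\<close>. Sequences are handled through the fact that they converge for \<open>\<gamma>\<close> if and
only if they are norm bounded and converge for \<open>\<tau>\<close> (\<open>limitin_\<gamma>_seq_iff\<close>).\<close>

section \<open>The Hahn-Banach theorem for seminorms\<close>

definition sublinear :: "('a::real_vector \<Rightarrow> real) \<Rightarrow> bool" where
  "sublinear q \<longleftrightarrow> (\<forall>x y. q (x + y) \<le> q x + q y) \<and> (\<forall>r x. 0 \<le> r \<longrightarrow> q (r *\<^sub>R x) = r * q x)"

lemma sublinear_add: "sublinear q \<Longrightarrow> q (x + y) \<le> q x + q y"
  and sublinear_scale: "sublinear q \<Longrightarrow> 0 \<le> r \<Longrightarrow> q (r *\<^sub>R x) = r * q x"
  by (auto simp: sublinear_def)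

lemma sublinear_zero: "sublinear q \<Longrightarrow> q 0 = 0"
  using sublinear_scale[of q 0 0] by simp

lemma sublinear_lower: "sublinear q \<Longrightarrow> - q (- x) \<le> q x"
  using sublinear_add[of q x "- x"] sublinear_zero[of q] by simp

text \<open>The two inequalities are required up to a change of the index only. This covers both directed
families (chains of sublinear functionals) and the family used in the next lemma.\<close>

lemma sublinear_Inf:
  assumes "I \<noteq> {}" and bdd: "\<And>x. bdd_below ((\<lambda>i. f i x) ` I)"
    and add: "\<And>i j x y. i \<in> I \<Longrightarrow> j \<in> I \<Longrightarrow> \<exists>k\<in>I. f k (x + y) \<le> f i x + f j y"
    and scale: "\<And>i r x. i \<in> I \<Longrightarrow> 0 < r \<Longrightarrow> \<exists>k\<in>I. f k (r *\<^sub>R x) \<le> r * f i x"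
    and zero: "\<And>i. i \<in> I \<Longrightarrow> f i 0 = 0"
  shows "sublinear (\<lambda>x. INF i\<in>I. f i x)"
  unfolding sublinear_def
proof (intro conjI allI impI)
  fix x y
  have "(INF i\<in>I. f i (x + y)) - (INF i\<in>I. f i x) \<le> f j y" if "j \<in> I" for j
  proof -
    have "(INF i\<in>I. f i (x + y)) - f j y \<le> f i x" if "i \<in> I" for i
      using add[OF that \<open>j \<in> I\<close>, of x y] cINF_lower[OF bdd[of "x + y"]] by fastforce
    then have "(INF i\<in>I. f i (x + y)) - f j y \<le> (INF i\<in>I. f i x)"
      by (rule cINF_greatest[OF \<open>I \<noteq> {}\<close>])
    then show ?thesis by simp
  qed
  then have "(INF i\<in>I. f i (x + y)) - (INF i\<in>I. f i x) \<le> (INF i\<in>I. f i y)"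
    by (rule cINF_greatest[OF \<open>I \<noteq> {}\<close>])
  then show "(INF i\<in>I. f i (x + y)) \<le> (INF i\<in>I. f i x) + (INF i\<in>I. f i y)" by simp
next
  fix r :: real and x assume "0 \<le> r"
  have le: "(INF i\<in>I. f i (s *\<^sub>R y)) \<le> s * (INF i\<in>I. f i y)" if "0 < s" for s y
  proof -
    have "(INF i\<in>I. f i (s *\<^sub>R y)) / s \<le> f i y" if "i \<in> I" for i
    proof -
      obtain k where "k \<in> I" "f k (s *\<^sub>R y) \<le> s * f i y" using scale \<open>i \<in> I\<close> \<open>0 < s\<close> by blast
      then have "(INF i\<in>I. f i (s *\<^sub>R y)) \<le> s * f i y"
        using cINF_lower[OF bdd[of "s *\<^sub>R y"]] by fastforce
      then show ?thesis using \<open>0 < s\<close> by (simp add: field_simps)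
    qed
    then have "(INF i\<in>I. f i (s *\<^sub>R y)) / s \<le> (INF i\<in>I. f i y)"
      by (rule cINF_greatest[OF \<open>I \<noteq> {}\<close>])
    then show ?thesis using \<open>0 < s\<close> by (simp add: field_simps)
  qed
  show "(INF i\<in>I. f i (r *\<^sub>R x)) = r * (INF i\<in>I. f i x)"
  proof (cases "r = 0")
    case True
    have "(INF i\<in>I. f i 0) = (INF i\<in>I. 0::real)" using zero by (intro INF_cong) auto
    then show ?thesis using True \<open>I \<noteq> {}\<close> by simp
  next
    case False
    then have "0 < r" using \<open>0 \<le> r\<close> by simp
    have "r * (INF i\<in>I. f i x) \<le> (INF i\<in>I. f i (r *\<^sub>R x))"
      using le[of "inverse r" "r *\<^sub>R x"] \<open>0 < r\<close> by (simp add: field_simps)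
    then show ?thesis using le[OF \<open>0 < r\<close>, of x] by linarith
  qed
qed

text \<open>The functional \<open>x \<mapsto> inf {q(x + t y) - t q(y) | t \<ge> 0}\<close> does it: \<open>t = 0\<close> shows that it lies below \<open>q\<close>, and
\<open>t = 1\<close> gives the value at \<open>- y\<close>. This is the step that replaces the extension by one dimension in the
usual proof of the Hahn-Banach theorem: a functional that cannot be lowered in this way is odd,
hence linear.\<close>

lemma sublinear_descend:
  assumes q: "sublinear q"
  shows "\<exists>q'. sublinear q' \<and> (\<forall>x. q' x \<le> q x) \<and> q' (- y) \<le> - q y"
proof -
  define f where "f t x = q (x + t *\<^sub>R y) - t * q y" for t :: real and x
  have low: "- q (- x) \<le> f t x" if "t \<in> {0..}" for t x
    using sublinear_add[OF q, of "x + t *\<^sub>R y" "- x"] sublinear_scale[OF q, of t y] that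
    by (simp add: f_def)
  have bdd: "bdd_below ((\<lambda>t. f t x) ` {0..})" for x
    by (rule bdd_belowI2[of _ "- q (- x)"]) (rule low)
  have "sublinear (\<lambda>x. INF t\<in>{0..}. f t x)"
  proof (rule sublinear_Inf)
    fix s t :: real and x z assume st: "s \<in> {0..}" "t \<in> {0..}"
    have "f (s + t) (x + z) \<le> f s x + f t z"
      using sublinear_add[OF q, of "x + s *\<^sub>R y" "z + t *\<^sub>R y"]
      by (simp add: f_def algebra_simps)
    then show "\<exists>k\<in>{0..}. f k (x + z) \<le> f s x + f t z" using st
      by (intro bexI[of _ "s + t"]) auto
  next
    fix t r :: real and x assume tr: "t \<in> {0..}" "0 < r"
    have "f (r * t) (r *\<^sub>R x) = r * f t x"
      using sublinear_scale[OF q, of r "x + t *\<^sub>R y"] tr by (simp add: f_def algebra_simps)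
    then show "\<exists>k\<in>{0..}. f k (r *\<^sub>R x) \<le> r * f t x" using tr
      by (intro bexI[of _ "r * t"]) auto
  next
    fix t :: real assume "t \<in> {0..}"
    then show "f t 0 = 0" using sublinear_scale[OF q, of t y] by (simp add: f_def)
  qed (use bdd in auto)
  moreover have "(INF t\<in>{0..}. f t x) \<le> q x" for x
    using cINF_lower[OF bdd[of x], of 0] by (simp add: f_def)
  moreover have "(INF t\<in>{0..}. f t (- y)) \<le> - q y"
    using cINF_lower[OF bdd[of "- y"], of 1] sublinear_zero[OF q] by (simp add: f_def)
  ultimately show ?thesis by blast
qed

text \<open>Zorn's lemma applies because sublinear functionals below \<open>p\<close> are bounded from below at each point \<open>x\<close>
by \<open>- p(- x)\<close>, so that the pointwise infimum of a chain is again one of them.\<close>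

lemma minimal_sublinear_exists:
  assumes p: "sublinear p"
  shows "\<exists>f. sublinear f \<and> (\<forall>x. f x \<le> p x) \<and>
    (\<forall>q. sublinear q \<and> (\<forall>x. q x \<le> f x) \<longrightarrow> q = f)"
proof -
  define Q where "Q = {q. sublinear q \<and> (\<forall>x. q x \<le> p x)}"
  define R where "R = (\<lambda>a u :: 'a \<Rightarrow> real. \<forall>x. u x \<le> a x)"
  have "partial_order_on Q (relation_of R Q)"
    
    by (rule partial_order_on_relation_ofI) (auto simp: R_def intro: order_trans intro!: ext antisym)
  moreover have "\<exists>u\<in>Q. \<forall>a\<in>C. R a u" if C: "C \<in> Chains (relation_of R Q)" for C
  proof (cases "C = {}")
    case True
    then show ?thesis using p by (auto simp: Q_def)
  next
    case False
    have sub: "a \<in> Q" if "a \<in> C" for a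
      using C that by (auto simp: Chains_def relation_of_def)
    have tot: "R a b \<or> R b a" if "a \<in> C" "b \<in> C" for a b
      using C that by (auto simp: Chains_def relation_of_def)
    have low: "- p (- x) \<le> a x" if "a \<in> C" for a x
    proof -
      have "a (- x) \<le> p (- x)" "- a (- x) \<le> a x"
        using sub[OF that] sublinear_lower[of a x] by (auto simp: Q_def)
      then show ?thesis by linarith
    qed
    have bdd: "bdd_below ((\<lambda>a. a x) ` C)" for x
      by (rule bdd_belowI2[of _ "- p (- x)"]) (rule low)
    define u where "u x = (INF a\<in>C. a x)" for x
    have lower: "u x \<le> a x" if "a \<in> C" for a x
      unfolding u_def by (rule cINF_lower[OF bdd that])
    have "sublinear u" unfolding u_def
    proof (rule sublinear_Inf)
      fix a b x y assume ab: "a \<in> C" "b \<in> C"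
      then have s: "sublinear a" "sublinear b" using sub by (auto simp: Q_def)
      from tot[OF ab] show "\<exists>k\<in>C. k (x + y) \<le> a x + b y"
      proof
        assume "R a b"
        then show ?thesis using ab sublinear_add[OF s(2), of x y]
          by (intro bexI[of _ b]) (auto simp: R_def intro: order_trans)
      next
        assume "R b a"
        then show ?thesis using ab sublinear_add[OF s(1), of x y]
          by (intro bexI[of _ a]) (auto simp: R_def intro: order_trans)
      qed
    next
      fix a r x assume "a \<in> C" "0 < (r::real)"
      then show "\<exists>k\<in>C. k (r *\<^sub>R x) \<le> r * a x"
        using sub[of a] by (intro bexI[of _ a]) (auto simp: Q_def sublinear_scale)
    qed (use False bdd sub sublinear_zero in \<open>auto simp: Q_def\<close>)
    moreover have "u x \<le> p x" for x
    proof -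
      obtain a where "a \<in> C" using False by blast
      then show ?thesis using lower[of a x] sub[of a] by (auto simp: Q_def intro: order_trans)
    qed
    ultimately show ?thesis using lower by (intro bexI[of _ u]) (auto simp: Q_def R_def)
  qed
  ultimately obtain m where m: "m \<in> Q" "\<forall>a\<in>Q. R m a \<longrightarrow> a = m"
    using predicate_Zorn[of Q R] by blast
  have "q = m" if "sublinear q" "\<forall>x. q x \<le> m x" for q
  proof -
    have "q \<in> Q" using that m(1) by (auto simp: Q_def intro: order_trans)
    then show ?thesis using that m(2) by (auto simp: R_def)
  qed
  then show ?thesis using m(1) by (auto simp: Q_def)
qed

theorem real_Hahn_Banach:
  assumes p: "sublinear p"
  shows "\<exists>f. linear f \<and> (\<forall>x. f x \<le> p x) \<and> f y = p y"
proof -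
  obtain q where q: "sublinear q" "\<And>x. q x \<le> p x" "q (- y) \<le> - p y"
    using sublinear_descend[OF p] by blast
  obtain f where f: "sublinear f" "\<And>x. f x \<le> q x"
    and min: "\<And>g. sublinear g \<Longrightarrow> \<forall>x. g x \<le> f x \<Longrightarrow> g = f"
    using minimal_sublinear_exists[OF q(1)] by blast
  have odd: "f (- x) = - f x" for x
  proof -
    obtain g where g: "sublinear g" "\<forall>x. g x \<le> f x" "g (- x) \<le> - f x"
      using sublinear_descend[OF f(1)] by blast
    then have "f (- x) \<le> - f x" using min by blast
    then show ?thesis using sublinear_lower[OF f(1), of x] by linarith
  qed
  have "linear f"
  proof (rule linearI)
    fix a b
    have "f (- a + - b) \<le> f (- a) + f (- b)" by (rule sublinear_add[OF f(1)])
    then have "f a + f b \<le> f (a + b)" using odd[of "a + b"] odd[of a] odd[of b] by simp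
    then show "f (a + b) = f a + f b" using sublinear_add[OF f(1), of a b] by linarith
  next
    fix r a
    show "f (r *\<^sub>R a) = r *\<^sub>R f a"
    proof (cases "0 \<le> r")
      case True
      then show ?thesis using sublinear_scale[OF f(1)] by simp
    next
      case False
      then have "f (- ((- r) *\<^sub>R a)) = - ((- r) * f a)"
        using odd sublinear_scale[OF f(1), of "- r" a] by simp
      then show ?thesis by simp
    qed
  qed
  moreover have "f x \<le> p x" for x using f(2) q(2) order_trans by blast
  moreover have "p y \<le> f y" using f(2)[of "- y"] q(3) odd[of y] by linarith
  ultimately show ?thesis by (metis antisym)
qed

lemma imaginary_unit_independent:
  fixes i :: "'k::real_or_complex"
  assumes i: "i * i = - 1" and eq: "a *\<^sub>R 1 + b *\<^sub>R i = 0"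
  shows "a = 0 \<and> b = 0"
proof -
  have ii: "i * (i * z) = - z" for z
    using i by (simp add: mult.assoc[symmetric])
  have "(a *\<^sub>R 1 + b *\<^sub>R i) * (a *\<^sub>R 1 - b *\<^sub>R i) = (a\<^sup>2 + b\<^sup>2) *\<^sub>R (1::'k)"
    by (simp add: algebra_simps i ii power2_eq_square scaleR_conv_of_real)
  then have "a\<^sup>2 + b\<^sup>2 = 0" using eq by simp
  then show ?thesis by (simp add: sum_power2_eq_zero_iff)
qed

text \<open>The norm is only known to be multiplicative. The Euclidean norm of the coordinates is multiplicative
too, and it is at most a constant times the norm because the space is finite-dimensional. Taking
\<open>n\<close>-th powers and \<open>n\<close>-th roots, the constant disappears as \<open>n\<close> grows.\<close>

lemma real_part_le_norm:
  fixes i :: "'k::real_or_complex"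
  assumes i: "i * i = - 1"
  shows "\<bar>a\<bar> \<le> norm (a *\<^sub>R 1 + b *\<^sub>R i)"
proof -
  have ii: "i * (i * z) = - z" for z
    using i by (simp add: mult.assoc[symmetric])
  define L where "L v = fst v *\<^sub>R 1 + snd v *\<^sub>R i" for v :: "real \<times> real"
  have lin: "linear L"
    by (rule linearI) (auto simp: L_def algebra_simps)
  have "inj L"
    unfolding linear_injective_0[OF lin]
    using imaginary_unit_independent[OF i] by (auto simp: L_def prod_eq_iff)
  then obtain B where B: "B > 0" "\<And>v. B * norm v \<le> norm (L v)"
    using linear_inj_bounded_below_pos[OF lin] by blast
  define N where "N = norm (a, b)"
  define w where "w = a *\<^sub>R 1 + b *\<^sub>R i"
  have pow: "\<exists>v. w ^ n = L v \<and> norm v = N ^ n" for n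
  proof (induction n)
    case 0
    then show ?case by (intro exI[of _ "(1, 0)"]) (simp add: L_def norm_Pair)
  next
    case (Suc n)
    then obtain c d where cd: "w ^ n = L (c, d)" "norm (c, d) = N ^ n" by fastforce
    have "w ^ Suc n = L (a * c - b * d, a * d + b * c)"
      unfolding power_Suc cd(1) by (simp add: w_def L_def algebra_simps i ii scaleR_conv_of_real)
    moreover have "norm (a * c - b * d, a * d + b * c) = N * norm (c, d)"
      unfolding norm_Pair N_def real_sqrt_mult[symmetric]
      by (rule arg_cong[of _ _ sqrt]) (simp add: power2_eq_square algebra_simps)
    ultimately show ?case using cd by (metis power_Suc)
  qed
  have le: "B * N ^ n \<le> norm w ^ n" for n
    using pow[of n] B(2) by (metis norm_power)
  have "N \<le> norm w"
  proof (rule ccontr)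
    assume "\<not> N \<le> norm w"
    then have N: "norm w < N" by simp
    then have "N > 0" using norm_ge_zero[of w] by linarith
    have "(\<lambda>n. (norm w / N) ^ n) \<longlonglongrightarrow> 0"
      using N \<open>N > 0\<close> by (intro LIMSEQ_realpow_zero) auto
    then have "eventually (\<lambda>n. (norm w / N) ^ n < B) sequentially"
      using B(1) by (rule order_tendstoD)
    then obtain n where "(norm w / N) ^ n < B"
      by (auto simp: eventually_sequentially)
    then show False using le[of n] \<open>N > 0\<close> by (simp add: power_divide field_simps)
  qed
  moreover have "\<bar>a\<bar> \<le> N"
    using norm_fst_le[of a b] by (simp add: N_def)
  ultimately show ?thesis by (simp add: w_def)
qed

lemma (in banach_space_over) seminorm_over_sublinear:
  assumes "seminorm_over smul p"
  shows "sublinear p"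
  unfolding sublinear_def
proof (intro conjI allI impI)
  fix r :: real and x assume "0 \<le> r"
  then show "p (r *\<^sub>R x) = r * p x"
    using assms scale_of_real[of r x, symmetric] by (simp add: seminorm_over_def)
qed (use assms in \<open>auto simp: seminorm_over_def\<close>)

text \<open>Over the complex numbers the functional is \<open>\<phi>(x) = f(x) - i f(ix)\<close> for a real-linear \<open>f\<close> with \<open>f(y) = p(y)\<close>.
The bound for \<open>\<phi>(x)\<close> follows from that for \<open>f\<close> after rotating \<open>x\<close> so that \<open>\<phi>(x)\<close> becomes real, and
\<open>\<bar>\<phi>(y)\<bar> \<ge> p(y)\<close> holds because \<open>f(y)\<close> is the real part of \<open>\<phi>(y)\<close>.\<close>

theorem (in banach_space_over) Hahn_Banach_seminorm:
  assumes p: "seminorm_over smul p"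
  obtains \<phi> :: "'x \<Rightarrow> 'k"
  where "\<And>x z. \<phi> (x + z) = \<phi> x + \<phi> z" "\<And>c x. \<phi> (smul c x) = c * \<phi> x"
    "\<And>x. norm (\<phi> x) \<le> p x" "norm (\<phi> y) = p y"
proof -
  have hom: "p (smul c x) = norm c * p x" for c x
    using p by (simp add: seminorm_over_def)
  obtain f where f: "linear f" "\<And>x. f x \<le> p x" "f y = p y"
    using real_Hahn_Banach[OF seminorm_over_sublinear[OF p]] by blast
  have fadd: "f (x + z) = f x + f z" and fscale: "f (r *\<^sub>R x) = r * f x" for x z r
    using f(1) by (auto simp: linear_iff)
  have norm_le: "norm (\<phi> x) \<le> p x"
    if hom': "\<And>c x. \<phi> (smul c x) = c * \<phi> x" and re: "\<And>x r. \<phi> x = of_real r \<Longrightarrow> f x = r"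
    for \<phi> :: "'x \<Rightarrow> 'k" and x
  proof (cases "\<phi> x = 0")
    case True
    have "f x = 0" using re[of x 0] True by simp
    moreover have "f x \<le> p x" by (rule f(2))
    ultimately show ?thesis using True by simp
  next
    case False
    define c where "c = of_real (norm (\<phi> x)) / \<phi> x"
    have c: "norm c = 1" using False by (simp add: c_def norm_divide)
    have "\<phi> (smul c x) = of_real (norm (\<phi> x))" using False by (simp add: hom' c_def)
    then have "norm (\<phi> x) = f (smul c x)" using re by metis
    also have "\<dots> \<le> p (smul c x)" by (rule f(2))
    finally show ?thesis by (simp add: hom c)
  qed
  show thesis
  proof (cases "\<forall>z::'k. \<exists>a. z = a *\<^sub>R 1")
    case True
    define \<phi> where "\<phi> x = (of_real (f x) :: 'k)" for x
    have add: "\<phi> (x + z) = \<phi> x + \<phi> z" for x z by (simp add: \<phi>_def fadd)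
    have hom': "\<phi> (smul c x) = c * \<phi> x" for c x
    proof -
      obtain a where "c = of_real a" using True by (metis of_real_def)
      then show ?thesis by (simp add: \<phi>_def scale_of_real fscale)
    qed
    have le: "norm (\<phi> x) \<le> p x" for x
      by (rule norm_le[OF hom']) (simp add: \<phi>_def)
    have "norm (\<phi> y) = p y"
      using le[of y] f(3) by (simp add: \<phi>_def)
    then show thesis using that[of \<phi>] add hom' le by blast
  next
    case False
    then obtain i :: 'k where i: "i * i = - 1" and rep: "\<And>z. \<exists>a b. z = a *\<^sub>R 1 + b *\<^sub>R i"
      using real_or_complex by blast
    have ii: "i * (i * z) = - z" for z
      using i by (simp add: mult.assoc[symmetric])
    define \<phi> where "\<phi> x = f x *\<^sub>R 1 + (- f (smul i x)) *\<^sub>R i" for x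
    have add: "\<phi> (x + z) = \<phi> x + \<phi> z" for x z
      by (simp add: \<phi>_def fadd scale_right_distrib algebra_simps)
    have real: "\<phi> (r *\<^sub>R x) = r *\<^sub>R \<phi> x" for r x
    proof -
      have "smul i (r *\<^sub>R x) = r *\<^sub>R smul i x"
        by (simp add: scale_of_real[symmetric] mult.commute)
      then show ?thesis by (simp add: \<phi>_def fscale algebra_simps)
    qed
    have unit: "\<phi> (smul i x) = i * \<phi> x" for x
    proof -
      have "smul i (smul i x) = - x" by (simp add: i)
      moreover have "f (- x) = - f x" using fscale[of "-1" x] by simp
      ultimately show ?thesis by (simp add: \<phi>_def algebra_simps i ii scaleR_conv_of_real)
    qed
    have hom': "\<phi> (smul c x) = c * \<phi> x" for c x
    proof -
      obtain a b where c: "c = a *\<^sub>R 1 + b *\<^sub>R i" using rep by blast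
      have "smul c x = a *\<^sub>R x + b *\<^sub>R smul i x"
        unfolding c by (simp add: scale_left_distrib scaleR_conv_of_real scale_of_real[symmetric])
      then show ?thesis by (simp add: add real unit c algebra_simps)
    qed
    have le: "norm (\<phi> x) \<le> p x" for x
    proof (rule norm_le[OF hom'])
      fix x r assume "\<phi> x = of_real r"
      then have "(f x - r) *\<^sub>R 1 + (- f (smul i x)) *\<^sub>R i = 0"
        by (simp add: \<phi>_def scaleR_conv_of_real algebra_simps)
      then show "f x = r" using imaginary_unit_independent[OF i] by (metis eq_iff_diff_eq_0)
    qed
    have "p y \<le> norm (\<phi> y)"
      using real_part_le_norm[OF i, of "f y" "- f (smul i y)"] f(3) by (simp add: \<phi>_def)
    then have "norm (\<phi> y) = p y" using le[of y] by linarith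
    then show thesis using that[of \<phi>] add hom' le by blast
  qed
qed

section \<open>Seminorm topologies\<close>

context banach_space_over
begin

context
  fixes p :: "'x \<Rightarrow> real"
  assumes p: "seminorm_over smul p"
begin

lemma seminorm_triangle: "p (x + y) \<le> p x + p y"
  using p by (simp add: seminorm_over_def)

lemma seminorm_smul: "p (smul c x) = norm c * p x"
  using p by (simp add: seminorm_over_def)

lemma seminorm_scaleR: "p (r *\<^sub>R x) = \<bar>r\<bar> * p x"
  using seminorm_smul[of "of_real r" x] scale_of_real[of r x] by simp

lemma seminorm_zero: "p 0 = 0"
  using seminorm_scaleR[of 0 0] by simp

lemma seminorm_minus: "p (- x) = p x"
  using seminorm_scaleR[of "-1" x] by simp

lemma seminorm_diff_commute: "p (x - y) = p (y - x)"
  using seminorm_minus[of "x - y"] by simp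

lemma seminorm_nonneg: "0 \<le> p x"
  using seminorm_triangle[of x "- x"] by (simp add: seminorm_zero seminorm_minus)

lemma seminorm_triangle_diff: "p (x - z) \<le> p (x - y) + p (y - z)"
  using seminorm_triangle[of "x - y" "y - z"] by simp

end

lemma openin_seminorm_ball:
  assumes "p \<in> P" "e > 0"
  shows "openin (seminorm_topology P) {y. p (y - x) < e}"
  unfolding seminorm_topology_def by (rule topology_generated_by_Basis) (use assms in blast)

lemma topspace_seminorm_topology:
  assumes "P \<noteq> {}" "\<forall>p\<in>P. seminorm_over smul p"
  shows "topspace (seminorm_topology P) = UNIV"
proof -
  obtain p where p: "p \<in> P" using assms by blast
  have "y \<in> \<Union> {{y. p (y - x) < e} | p x e. p \<in> P \<and> e > 0}" for y
  proof
    show "{z. p (z - y) < 1} \<in> {{y. p (y - x) < e} | p x e. p \<in> P \<and> e > 0}"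
      using p zero_less_one by blast
    show "y \<in> {z. p (z - y) < 1}" using p assms by (auto simp: seminorm_zero[of p])
  qed
  then show ?thesis
    unfolding seminorm_topology_def topology_generated_by_topspace by blast
qed

text \<open>A subbasis suffices for testing convergence. The balls of the subbasis may be centred away from \<open>l\<close>,
but each contains a ball centred at \<open>l\<close>.\<close>

lemma limitin_seminorm_topology:
  assumes P: "P \<noteq> {}" "\<forall>p\<in>P. seminorm_over smul p"
  shows "limitin (seminorm_topology P) f l F \<longleftrightarrow> (\<forall>p\<in>P. ((\<lambda>i. p (f i - l)) \<longlongrightarrow> 0) F)"
proof (intro iffI ballI)
  fix p assume lim: "limitin (seminorm_topology P) f l F" and p: "p \<in> P"
  then have sn: "seminorm_over smul p" using P by blast
  show "((\<lambda>i. p (f i - l)) \<longlongrightarrow> 0) F"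
  proof (rule tendstoI)
    fix e :: real assume "e > 0"
    have "l \<in> {y. p (y - l) < e}" using \<open>e > 0\<close> seminorm_zero[OF sn] by simp
    then have "eventually (\<lambda>i. f i \<in> {y. p (y - l) < e}) F"
      using lim openin_seminorm_ball[OF p \<open>e > 0\<close>, of l]
      unfolding limitin_def by blast
    then show "eventually (\<lambda>i. dist (p (f i - l)) 0 < e) F"
      by eventually_elim (use seminorm_nonneg[OF sn] in auto)
  qed
next
  assume lim: "\<forall>p\<in>P. ((\<lambda>i. p (f i - l)) \<longlongrightarrow> 0) F"
  have "eventually (\<lambda>i. f i \<in> U) F"
    if "generate_topology_on {{y. p (y - x) < e} | p x e. p \<in> P \<and> e > 0} U" "l \<in> U" for U
    using that
  proof (induction rule: generate_topology_on.induct)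
    case (Int a b)
    then show ?case by (simp add: eventually_conj_iff)
  next
    case (UN K)
    then obtain k where "k \<in> K" "l \<in> k" by blast
    with UN have "eventually (\<lambda>i. f i \<in> k) F" by blast
    then show ?case by eventually_elim (use \<open>k \<in> K\<close> in blast)
  next
    case (Basis U)
    then obtain p x e where U: "U = {y. p (y - x) < e}" and p: "p \<in> P" by blast
    have sn: "seminorm_over smul p" using P p by blast
    have "e - p (l - x) > 0" using Basis U by simp
    then have "eventually (\<lambda>i. p (f i - l) < e - p (l - x)) F"
      by (rule order_tendstoD(2)[OF lim[rule_format, OF p]])
    then show ?case
    proof eventually_elim
      case (elim i)
      then show ?case using seminorm_triangle_diff[OF sn, of "f i" x l] by (simp add: U)
    qed
  qed simp
  then show "limitin (seminorm_topology P) f l F"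
    unfolding limitin_def topspace_seminorm_topology[OF P]
    by (auto simp: seminorm_topology_def openin_topology_generated_by_iff)
qed

lemma continuous_map_seminorm_topology:
  assumes P: "P \<noteq> {}" "\<forall>p\<in>P. seminorm_over smul p"
    and op: "\<And>p z e. p \<in> P \<Longrightarrow> z \<in> topspace Y \<Longrightarrow> e > 0 \<Longrightarrow>
      \<exists>V. openin Y V \<and> z \<in> V \<and> (\<forall>v\<in>V. p (f v - f z) < e)"
  shows "continuous_map Y (seminorm_topology P) f"
  unfolding seminorm_topology_def
proof (rule continuous_on_generated_topo)
  fix U assume "U \<in> {{y. p (y - x) < e} | p x e. p \<in> P \<and> e > 0}"
  then obtain p x e where U: "U = {y. p (y - x) < e}" and p: "p \<in> P" by blast
  have sn: "seminorm_over smul p" using P p by blast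
  show "openin Y (f -` U \<inter> topspace Y)"
  proof (subst openin_subopen, intro ballI)
    fix z assume z: "z \<in> f -` U \<inter> topspace Y"
    then have zY: "z \<in> topspace Y" and pos: "e - p (f z - x) > 0" by (simp_all add: U)
    obtain V where V: "openin Y V" "z \<in> V" "\<forall>v\<in>V. p (f v - f z) < e - p (f z - x)"
      using op[OF p zY pos] by (elim exE conjE)
    have "f v \<in> U" if "v \<in> V" for v
      using V(3)[rule_format, OF that] seminorm_triangle_diff[OF sn, of "f v" x "f z"] by (simp add: U)
    then show "\<exists>T. openin Y T \<and> z \<in> T \<and> T \<subseteq> f -` U \<inter> topspace Y"
      using V openin_subset[OF V(1)] by (intro exI[of _ V]) auto
  qed
next
  show "f ` topspace Y \<subseteq> \<Union> {{y. p (y - x) < e} | p x e. p \<in> P \<and> e > 0}"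
    using topspace_seminorm_topology[OF P]
    unfolding seminorm_topology_def topology_generated_by_topspace by blast
qed

lemma linear_topology_seminorm_topology:
  assumes P: "P \<noteq> {}" "\<forall>p\<in>P. seminorm_over smul p"
  shows "linear_topology smul (seminorm_topology P)"
  unfolding linear_topology_def
proof (intro conjI)
  show "topspace (seminorm_topology P) = UNIV" by (rule topspace_seminorm_topology[OF P])
  show "continuous_map (prod_topology (seminorm_topology P) (seminorm_topology P))
     (seminorm_topology P) (\<lambda>(x, y). x + y)"
  proof (rule continuous_map_seminorm_topology[OF P])
    fix p and z :: "'x \<times> 'x" and e :: real assume p: "p \<in> P" and e: "e > 0"
    obtain a b where z: "z = (a, b)" by fastforce
    have sn: "seminorm_over smul p" using P p by blast
    let ?U = "{y. p (y - a) < e / 2}" and ?V = "{y. p (y - b) < e / 2}"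
    have "openin (prod_topology (seminorm_topology P) (seminorm_topology P)) (?U \<times> ?V)"
      using openin_seminorm_ball[OF p, of "e / 2"] e by (simp add: openin_prod_Times_iff)
    moreover have "p (u + v - (a + b)) < e" if "u \<in> ?U" "v \<in> ?V" for u v
      using seminorm_triangle[OF sn, of "u - a" "v - b"] that by (simp add: algebra_simps)
    ultimately show "\<exists>V. openin (prod_topology (seminorm_topology P) (seminorm_topology P)) V \<and>
        z \<in> V \<and> (\<forall>v\<in>V. p ((case v of (x, y) \<Rightarrow> x + y) - (case z of (x, y) \<Rightarrow> x + y)) < e)"
      using e seminorm_zero[OF sn] by (intro exI[of _ "?U \<times> ?V"]) (auto simp: z)
  qed
  show "continuous_map (prod_topology euclidean (seminorm_topology P))
     (seminorm_topology P) (\<lambda>(c, x). smul c x)"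
  proof (rule continuous_map_seminorm_topology[OF P])
    fix p and z :: "'k \<times> 'x" and e :: real assume p: "p \<in> P" and e: "e > 0"
    obtain c x where z: "z = (c, x)" by fastforce
    have sn: "seminorm_over smul p" using P p by blast
    define d where "d = min 1 (e / (2 * (p x + 1)))"
    define r where "r = e / (2 * (norm c + 1))"
    have pos: "p x + 1 > 0" "norm c + 1 > 0" using seminorm_nonneg[OF sn, of x] by (auto intro: add_nonneg_pos)
    then have dr: "d > 0" "r > 0" using e by (auto simp: d_def r_def)
    let ?U = "ball c d" and ?V = "{y. p (y - x) < r}"
    have "openin (prod_topology euclidean (seminorm_topology P)) (?U \<times> ?V)"
      using openin_seminorm_ball[OF p dr(2)] by (simp add: openin_prod_Times_iff)
    moreover have "p (smul u v - smul c x) < e" if u: "u \<in> ?U" and v: "v \<in> ?V" for u v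
    proof -
      have "smul u v - smul c x = smul u (v - x) + smul (u - c) x"
        by (simp add: scale_right_diff_distrib scale_left_diff_distrib)
      then have "p (smul u v - smul c x) \<le> norm u * p (v - x) + norm (u - c) * p x"
        using seminorm_triangle[OF sn] seminorm_smul[OF sn] by metis
      moreover have "norm u * p (v - x) < e / 2"
      proof -
        have "norm u \<le> norm c + 1"
          using u norm_triangle_ineq2[of u c] by (simp add: d_def dist_norm norm_minus_commute)
        then have "norm u * p (v - x) \<le> (norm c + 1) * p (v - x)"
          using seminorm_nonneg[OF sn] by (intro mult_right_mono) auto
        also have "\<dots> < (norm c + 1) * r" using v pos by simp
        also have "\<dots> = e / 2"
        proof -
          have "a * (e / (2 * a)) = e / 2" if "a > 0" for a using that by simp
          then show ?thesis unfolding r_def using pos(2) .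
        qed
        finally show ?thesis .
      qed
      moreover have "norm (u - c) * p x \<le> e / 2"
      proof -
        have "norm (u - c) \<le> e / (2 * (p x + 1))"
          using u by (simp add: d_def dist_norm norm_minus_commute)
        then have "norm (u - c) * p x \<le> e / (2 * (p x + 1)) * (p x + 1)"
          using seminorm_nonneg[OF sn, of x] e by (intro mult_mono) auto
        also have "\<dots> = e / 2"
        proof -
          have "e / (2 * a) * a = e / 2" if "a > 0" for a using that by simp
          then show ?thesis using pos(1) .
        qed
        finally show ?thesis .
      qed
      ultimately show ?thesis by linarith
    qed
    ultimately show "\<exists>V. openin (prod_topology euclidean (seminorm_topology P)) V \<and> z \<in> V \<and>
       (\<forall>v\<in>V. p ((case v of (c, x) \<Rightarrow> smul c x) - (case z of (c, x) \<Rightarrow> smul c x)) < e)"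
      using dr seminorm_zero[OF sn] by (intro exI[of _ "?U \<times> ?V"]) (auto simp: z)
  qed
qed

lemma coarser_seminorm_topology_euclidean:
  assumes P: "P \<noteq> {}" "\<forall>p\<in>P. seminorm_over smul p" and le: "\<And>p x. p \<in> P \<Longrightarrow> p x \<le> norm x"
  shows "coarser (seminorm_topology P) euclidean"
proof -
  have "continuous_map euclidean (seminorm_topology P) (\<lambda>x. x)"
  proof (rule continuous_map_seminorm_topology[OF P])
    fix p and z :: 'x and e :: real assume p: "p \<in> P" and e: "e > 0"
    have "p (v - z) < e" if "v \<in> ball z e" for v
      using le[OF p, of "v - z"] that by (simp add: dist_norm norm_minus_commute)
    then show "\<exists>V. openin euclidean V \<and> z \<in> V \<and> (\<forall>v\<in>V. p (v - z) < e)"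
      using e by (intro exI[of _ "ball z e"]) auto
  qed
  then show ?thesis
    using topspace_seminorm_topology[OF P] by (auto simp: coarser_def continuous_map_def)
qed

end

section \<open>The mixed topology of a Saks space\<close>

text \<open>A Saks space together with a family of seminorms that generates its coarse topology and whose
supremum is the norm.\<close>

locale saks_seminorms = banach_space_over smul
  for smul :: "'k::real_or_complex \<Rightarrow> 'x::banach \<Rightarrow> 'x" +
  fixes P :: "('x \<Rightarrow> real) set"
  assumes P_nonempty: "P \<noteq> {}"
    and P_seminorms: "\<forall>p\<in>P. seminorm_over smul p"
    and P_bounded: "\<And>x. bdd_above ((\<lambda>p. p x) ` P)"
    and norm_eq_SUP: "\<And>x. norm x = (SUP p\<in>P. p x)"
begin

abbreviation \<tau> :: "'x topology" where "\<tau> \<equiv> seminorm_topology P"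
abbreviation \<gamma> :: "'x topology" where "\<gamma> \<equiv> mixed_topology smul \<tau>"
abbreviation X\<^sub>c :: "('x \<Rightarrow>\<^sub>L 'k) set" where "X\<^sub>c \<equiv> circ_dual smul \<tau>"

lemma P_seminorm: "p \<in> P \<Longrightarrow> seminorm_over smul p"
  using P_seminorms by blast

lemma P_le_norm: "p \<in> P \<Longrightarrow> p x \<le> norm x"
  unfolding norm_eq_SUP by (rule cSUP_upper[OF _ P_bounded])

lemma norm_le_iff_P: "norm x \<le> c \<longleftrightarrow> (\<forall>p\<in>P. p x \<le> c)"
  unfolding norm_eq_SUP by (rule cSUP_le_iff[OF P_nonempty P_bounded])

lemma norm_less_P: "c < norm x \<Longrightarrow> \<exists>p\<in>P. c < p x"
  using norm_le_iff_P[of x c] by (metis not_le)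

lemma \<tau>_candidate: "linear_topology smul \<tau>" "coarser \<tau> euclidean"
  using linear_topology_seminorm_topology[OF P_nonempty P_seminorms]
    coarser_seminorm_topology_euclidean[OF P_nonempty P_seminorms] P_le_norm by auto

lemmas mixed = mixed_topology_finest[OF \<tau>_candidate]

lemma topspace_\<gamma>: "topspace \<gamma> = UNIV"
  using mixed(1) by (simp add: mixed_candidate_def linear_topology_def)

lemma limitin_\<gamma>_coarser:
  assumes "mixed_candidate smul \<tau> \<sigma>" "limitin \<gamma> f l F"
  shows "limitin \<sigma> f l F"
  using mixed(2)[OF assms(1)] assms(2) by (auto simp: limitin_def coarser_def)

lemma limitin_\<gamma>_P:
  assumes "limitin \<gamma> f l F" "p \<in> P"
  shows "((\<lambda>i. p (f i - l)) \<longlongrightarrow> 0) F"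
proof -
  have "mixed_candidate smul \<tau> \<tau>"
    using \<tau>_candidate by (auto simp: mixed_candidate_def coarser_def)
  from limitin_\<gamma>_coarser[OF this assms(1)] show ?thesis
    using assms(2) by (simp add: limitin_seminorm_topology[OF P_nonempty P_seminorms])
qed

text \<open>The limit and eventually the values of \<open>f\<close> lie in a bounded set, on which \<open>\<gamma>\<close> and \<open>\<tau>\<close> coincide. For sequences
the boundedness turns out to be automatic (\<open>limitin_\<gamma>_bounded\<close>).\<close>

lemma limitin_\<gamma>I:
  assumes bdd: "eventually (\<lambda>i. norm (f i) \<le> M) F"
    and lim: "\<And>p. p \<in> P \<Longrightarrow> ((\<lambda>i. p (f i - l)) \<longlongrightarrow> 0) F"
  shows "limitin \<gamma> f l F"
  unfolding limitin_def
proof (intro conjI allI impI)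
  fix U assume U: "openin \<gamma> U \<and> l \<in> U"
  \<comment> \<open>The two topologies agree on a ball that contains the limit and, eventually, the values of \<open>f\<close>.\<close>
  define S :: "'x set" where "S = cball 0 (max M (norm l))"
  have "subtopology \<gamma> S = subtopology \<tau> S"
    using mixed(1) by (simp add: mixed_candidate_def S_def)
  moreover have "openin (subtopology \<gamma> S) (U \<inter> S)"
    using U by (auto simp: openin_subtopology)
  ultimately have "openin (subtopology \<tau> S) (U \<inter> S)" by simp
  then obtain V where V: "openin \<tau> V" "U \<inter> S = V \<inter> S"
    by (auto simp: openin_subtopology)
  have "limitin \<tau> f l F"
    using lim by (simp add: limitin_seminorm_topology[OF P_nonempty P_seminorms])
  moreover have "l \<in> S" by (simp add: S_def)
  then have "l \<in> V" using U V(2) by blast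
  ultimately have "eventually (\<lambda>i. f i \<in> V) F" using V(1) unfolding limitin_def by blast
  with bdd show "eventually (\<lambda>i. f i \<in> U) F"
  proof eventually_elim
    case (elim i)
    then have "f i \<in> V \<inter> S" by (simp add: S_def)
    then show ?case using V by blast
  qed
qed (simp add: topspace_\<gamma>)

text \<open>On a bounded set all but finitely many of the functions \<open>q\<^sub>k / (k + 1)\<close> are uniformly small, so adding
their supremum \<open>w\<close> to the generating seminorms does not change the topology on bounded sets. As \<open>\<gamma>\<close> is
the finest such topology, \<open>w\<close> is \<open>\<gamma>\<close>-continuous.\<close>

lemma weighted_sup_candidate:
  fixes q :: "nat \<Rightarrow> 'x \<Rightarrow> real" and w :: "'x \<Rightarrow> real"
  assumes q: "\<And>k. q k \<in> P"
  defines "w \<equiv> \<lambda>x :: 'x. SUP k. q k x / Suc k"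
  shows "seminorm_over smul w" "mixed_candidate smul \<tau> (seminorm_topology (insert w P))"
    "\<And>k. q k x \<le> Suc k * w x"
proof -
  have le: "q k x / Suc k \<le> norm x / Suc k" for k x
    by (rule divide_right_mono[OF P_le_norm[OF q]]) simp
  have le': "q k x / Suc k \<le> norm x" for k x
  proof -
    have "norm x / Suc k \<le> norm x / 1" by (intro divide_left_mono) auto
    then show ?thesis using le[of k x] by simp
  qed
  have bdd: "bdd_above (range (\<lambda>k. q k x / Suc k))" for x
    by (rule bdd_aboveI2[of _ _ "norm x"]) (rule le')
  have up: "q k x / Suc k \<le> w x" for k x
    unfolding w_def by (rule cSUP_upper[OF UNIV_I bdd])
  have least: "(\<And>k. q k x / Suc k \<le> c) \<Longrightarrow> w x \<le> c" for x c
    unfolding w_def by (rule cSUP_least[OF UNIV_not_empty])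
  show "q k x \<le> Suc k * w x" for k using up[of k x] by (simp add: field_simps)
  note sn = P_seminorm[OF q]
  have scale: "w (smul c x) \<le> norm c * w x" for c x
  proof (rule least)
    fix k
    have "q k (smul c x) / Suc k = norm c * (q k x / Suc k)" by (simp add: seminorm_smul[OF sn])
    also have "\<dots> \<le> norm c * w x" by (intro mult_left_mono up) auto
    finally show "q k (smul c x) / Suc k \<le> norm c * w x" .
  qed
  have zero: "w 0 = 0" by (simp add: w_def seminorm_zero[OF sn])
  show wsn: "seminorm_over smul w"
    unfolding seminorm_over_def
  proof (intro conjI allI)
    fix x y show "w (x + y) \<le> w x + w y"
    proof (rule least)
      fix k
      have "q k (x + y) / Suc k \<le> (q k x + q k y) / Suc k"
        by (rule divide_right_mono[OF seminorm_triangle[OF sn]]) simp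
      then have "q k (x + y) / Suc k \<le> q k x / Suc k + q k y / Suc k"
        by (simp only: add_divide_distrib)
      then show "q k (x + y) / Suc k \<le> w x + w y" using up[of k x] up[of k y] by linarith
    qed
  next
    fix c x show "w (smul c x) = norm c * w x"
    proof (cases "c = 0")
      case True
      then show ?thesis by (simp add: zero)
    next
      case False
      have "w x \<le> norm (inverse c) * w (smul c x)"
        using scale[of "inverse c" "smul c x"] False by simp
      from mult_left_mono[OF this norm_ge_zero[of c]]
      have "norm c * w x \<le> norm c * (norm (inverse c) * w (smul c x))" .
      also have "\<dots> = w (smul c x)" using False by (simp add: norm_inverse)
      finally have "norm c * w x \<le> w (smul c x)" .
      then show ?thesis using scale[of c x] by linarith
    qed
  qed
  let ?W = "insert w P"
  have W: "?W \<noteq> {}" "\<forall>p\<in>?W. seminorm_over smul p" using wsn P_seminorms by auto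
  have Wle: "p x \<le> norm x" if "p \<in> ?W" for p x
    using that P_le_norm least[of x "norm x", OF le'] by blast
  have coarse: "coarser \<tau> (seminorm_topology ?W)"
  proof -
    have "continuous_map (seminorm_topology ?W) \<tau> (\<lambda>x. x)"
    proof (rule continuous_map_seminorm_topology[OF P_nonempty P_seminorms])
      fix p z and e :: real assume p: "p \<in> P" "e > 0"
      then show "\<exists>V. openin (seminorm_topology ?W) V \<and> z \<in> V \<and> (\<forall>v\<in>V. p (v - z) < e)"
        using openin_seminorm_ball[of p ?W e z] seminorm_zero[OF P_seminorm[OF p(1)]]
        by (intro exI[of _ "{y. p (y - z) < e}"]) auto
    qed
    then show ?thesis
      using topspace_seminorm_topology[OF W] topspace_seminorm_topology[OF P_nonempty P_seminorms]
      by (auto simp: coarser_def continuous_map_def)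
  qed
  have sub: "subtopology (seminorm_topology ?W) B = subtopology \<tau> B" if B: "bounded B" for B
  proof -
    obtain M where M: "M > 0" "\<And>x. x \<in> B \<Longrightarrow> norm x \<le> M"
      using B by (auto simp: bounded_pos)
    have tT: "topspace \<tau> = UNIV" by (rule topspace_seminorm_topology[OF P_nonempty P_seminorms])
    have "continuous_map (subtopology \<tau> B) (seminorm_topology ?W) (\<lambda>x. x)"
    proof (rule continuous_map_seminorm_topology[OF W])
      fix p z and e :: real assume p: "p \<in> ?W" and z: "z \<in> topspace (subtopology \<tau> B)" and e: "e > 0"
      have zB: "z \<in> B" using z by simp
      show "\<exists>V. openin (subtopology \<tau> B) V \<and> z \<in> V \<and> (\<forall>v\<in>V. p (v - z) < e)"
      proof (cases "p \<in> P")
        case True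
        then show ?thesis
          using openin_seminorm_ball[OF True e, of z] zB e seminorm_zero[OF P_seminorm[OF True]]
          by (intro exI[of _ "{y. p (y - z) < e} \<inter> B"]) (auto simp: openin_subtopology)
      next
        case False
        then have pw: "p = w" using p by simp
        \<comment> \<open>On a ball of radius \<open>M\<close> the terms beyond \<open>K\<close> are at most \<open>e / 2\<close>.\<close>
        obtain K where K: "4 * M / e < real K" using reals_Archimedean2 by blast
        define V where "V = (\<Inter>k\<le>K. {y. q k (y - z) < e / 2})"
        have "openin \<tau> V"
          unfolding V_def using e
          by (intro openin_INT2 openin_seminorm_ball[OF q]) auto
        moreover have "z \<in> V" using e by (simp add: V_def seminorm_zero[OF sn])
        moreover have "p (v - z) < e" if v: "v \<in> V \<inter> B" for v
        proof -
          have "w (v - z) \<le> e / 2"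
          proof (rule least)
            fix k
            show "q k (v - z) / Suc k \<le> e / 2"
            proof (cases "k \<le> K")
              case True
              then have "q k (v - z) < e / 2" using v by (auto simp: V_def)
              moreover have "q k (v - z) / Suc k \<le> q k (v - z) / 1"
                using seminorm_nonneg[OF sn] by (intro divide_left_mono) auto
              ultimately show ?thesis by linarith
            next
              case False
              have "norm (v - z) \<le> 2 * M"
                using norm_triangle_ineq4[of v z] M(2)[of v] M(2)[OF zB] v by simp
              then have "norm (v - z) / Suc k \<le> 2 * M / Suc k" by (intro divide_right_mono) auto
              also have "\<dots> \<le> e / 2"
              proof -
                have "4 * M / e < Suc k" using K False by linarith
                then show ?thesis using e by (simp add: field_simps)
              qed
              finally show ?thesis using le[of k "v - z"] by linarith
            qed
          qed
          then show ?thesis using e pw by simp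
        qed
        ultimately show ?thesis using zB
          by (intro exI[of _ "V \<inter> B"]) (auto simp: openin_subtopology)
      qed
    qed
    then have 1: "openin (subtopology \<tau> B) (U \<inter> B)" if "openin (seminorm_topology ?W) U" for U
      using that tT by (simp add: continuous_map_alt)
    show ?thesis
      unfolding topology_eq
    proof (intro allI iffI)
      fix V assume "openin (subtopology (seminorm_topology ?W) B) V"
      then show "openin (subtopology \<tau> B) V"
        using 1 by (auto simp: openin_subtopology[of "seminorm_topology ?W"])
    next
      fix V assume "openin (subtopology \<tau> B) V"
      then show "openin (subtopology (seminorm_topology ?W) B) V"
        using coarse by (auto simp: openin_subtopology coarser_def)
    qed
  qed
  show "mixed_candidate smul \<tau> (seminorm_topology (insert w P))"
    unfolding mixed_candidate_def
    using linear_topology_seminorm_topology[OF W] sub coarse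
      coarser_seminorm_topology_euclidean[OF W] Wle by auto
qed

text \<open>If \<open>f\<close> were unbounded, there would be seminorms \<open>q\<^sub>k\<close> in the family and indices \<open>n(k)\<close> with
\<open>q\<^sub>k(f(n(k))) > (k + 1)\<^sup>2\<close>. Then the weighted supremum of the \<open>q\<^sub>k\<close> would be unbounded along \<open>f\<close>, although it
is \<open>\<gamma>\<close>-continuous.\<close>

lemma limitin_\<gamma>_bounded:
  assumes lim: "limitin \<gamma> f l sequentially"
  shows "bounded (range f)"
proof (rule ccontr)
  assume unb: "\<not> bounded (range f)"
  have "\<exists>p n. p \<in> P \<and> (real (Suc k))\<^sup>2 < p (f n)" for k
  proof -
    obtain n where "(real (Suc k))\<^sup>2 < norm (f n)"
      using unb by (auto simp: bounded_iff not_le)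
    then show ?thesis using norm_less_P by blast
  qed
  then obtain q n where q: "\<And>k. q k \<in> P" and n: "\<And>k. (real (Suc k))\<^sup>2 < q k (f (n k))"
    by metis
  define w where "w x = (SUP k. q k x / Suc k)" for x
  note cand = weighted_sup_candidate[of q, OF q, folded w_def]
  have wlim: "(\<lambda>i. w (f i - l)) \<longlonglongrightarrow> 0"
  proof -
    have "limitin (seminorm_topology (insert w P)) f l sequentially"
      using limitin_\<gamma>_coarser[OF cand(2) lim] by simp
    moreover have "insert w P \<noteq> {}" "\<forall>p\<in>insert w P. seminorm_over smul p"
      using cand(1) P_seminorms by auto
    ultimately show ?thesis by (simp add: limitin_seminorm_topology)
  qed
  obtain C where C: "\<And>i. \<bar>w (f i - l)\<bar> \<le> C"
    using convergent_imp_Bseq[OF convergentI[OF wlim]] by (auto simp: Bseq_def)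
  obtain k :: nat where "C + w l < real k" using reals_Archimedean2 by blast
  then have k: "C + w l < real (Suc k)" by simp
  have "q k (f (n k)) \<le> Suc k * w (f (n k))" by (rule cand(3))
  also have "\<dots> \<le> Suc k * (C + w l)"
    using seminorm_triangle[OF cand(1), of "f (n k) - l" l] C[of "n k"] by (intro mult_left_mono) auto
  also have "\<dots> \<le> real (Suc k) * real (Suc k)" using k by (intro mult_left_mono) auto
  finally show False using n[of k] by (simp add: power2_eq_square)
qed

lemma limitin_\<gamma>_seq_iff:
  "limitin \<gamma> f l sequentially \<longleftrightarrow> bounded (range f) \<and> (\<forall>p\<in>P. (\<lambda>n. p (f n - l)) \<longlonglongrightarrow> 0)"
proof
  assume "bounded (range f) \<and> (\<forall>p\<in>P. (\<lambda>n. p (f n - l)) \<longlonglongrightarrow> 0)"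
  then obtain M where "\<And>n. norm (f n) \<le> M" "\<forall>p\<in>P. (\<lambda>n. p (f n - l)) \<longlonglongrightarrow> 0"
    by (auto simp: bounded_iff)
  then show "limitin \<gamma> f l sequentially" by (intro limitin_\<gamma>I[of _ M]) auto
qed (use limitin_\<gamma>_bounded limitin_\<gamma>_P in blast)

lemma limitin_\<gamma>_unique:
  assumes "limitin \<gamma> f l F" "limitin \<gamma> f l' F" "F \<noteq> bot"
  shows "l = l'"
proof -
  have "p (l - l') \<le> 0" if p: "p \<in> P" for p
  proof -
    have "((\<lambda>i. p (f i - l) + p (f i - l')) \<longlongrightarrow> 0 + 0) F"
      using assms p by (intro tendsto_add limitin_\<gamma>_P)
    moreover have "p (l - l') \<le> p (f i - l) + p (f i - l')" for i
      using seminorm_triangle_diff[OF P_seminorm[OF p], of l l' "f i"]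
        seminorm_diff_commute[OF P_seminorm[OF p], of l "f i"] by simp
    ultimately show ?thesis
      using tendsto_lowerbound[of _ "0 + 0" F "p (l - l')"] assms(3) by auto
  qed
  then have "norm (l - l') \<le> 0" by (simp add: norm_le_iff_P)
  then show ?thesis by simp
qed

lemma norm_convergent_limitin_\<gamma>:
  assumes "f \<longlonglongrightarrow> l"
  shows "limitin \<gamma> f l sequentially"
proof -
  have "coarser \<gamma> euclidean" using mixed(1) by (simp add: mixed_candidate_def)
  then show ?thesis
    using assms by (auto simp: limitin_def coarser_def topological_tendstoD)
qed

section \<open>Functionals that are sequentially continuous for the mixed topology\<close>

text \<open>Both descriptions test \<open>\<phi>\<close> on the same sequences, namely the norm-bounded \<open>\<tau>\<close>-convergent ones.\<close>

lemma circ_dual_iff: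
  "\<phi> \<in> X\<^sub>c \<longleftrightarrow> \<phi> \<in> norm_dual smul \<and>
    (\<forall>f l. limitin \<gamma> f l sequentially \<longrightarrow> (\<lambda>n. blinfun_apply \<phi> (f n)) \<longlonglongrightarrow> blinfun_apply \<phi> l)"
  unfolding circ_dual_def sequentially_continuous_on_def
proof (intro iffI conjI allI impI; (elim CollectE conjE)?; (intro CollectI conjI allI impI)?)
  fix f l assume "\<forall>B. bounded B \<longrightarrow> (\<forall>f l. range f \<subseteq> B \<and> l \<in> B \<and> limitin \<tau> f l sequentially \<longrightarrow>
      (\<lambda>n. blinfun_apply \<phi> (f n)) \<longlonglongrightarrow> blinfun_apply \<phi> l)"
    and lim: "limitin \<gamma> f l sequentially"
  moreover have "bounded (insert l (range f))" using limitin_\<gamma>_bounded[OF lim] by simp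
  moreover have "limitin \<tau> f l sequentially"
    using limitin_\<gamma>_P[OF lim] by (simp add: limitin_seminorm_topology[OF P_nonempty P_seminorms])
  ultimately show "(\<lambda>n. blinfun_apply \<phi> (f n)) \<longlonglongrightarrow> blinfun_apply \<phi> l"
    by blast
next
  fix B f l assume "\<forall>f l. limitin \<gamma> f l sequentially \<longrightarrow> (\<lambda>n. blinfun_apply \<phi> (f n)) \<longlonglongrightarrow> blinfun_apply \<phi> l"
    and B: "bounded B" and f: "range f \<subseteq> B \<and> l \<in> B \<and> limitin \<tau> f l sequentially"
  moreover have "limitin \<gamma> f l sequentially"
    using f bounded_subset[OF B, of "range f"]
    by (simp add: limitin_\<gamma>_seq_iff limitin_seminorm_topology[OF P_nonempty P_seminorms])
  ultimately show "(\<lambda>n. blinfun_apply \<phi> (f n)) \<longlonglongrightarrow> blinfun_apply \<phi> l" by blast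
qed auto

lemma circ_tendsto:
  "\<phi> \<in> X\<^sub>c \<Longrightarrow> limitin \<gamma> f l sequentially \<Longrightarrow> (\<lambda>n. blinfun_apply \<phi> (f n)) \<longlonglongrightarrow> blinfun_apply \<phi> l"
  by (simp add: circ_dual_iff)

lemma circ_smul: "\<phi> \<in> X\<^sub>c \<Longrightarrow> blinfun_apply \<phi> (smul c x) = c * blinfun_apply \<phi> x"
  by (simp add: circ_dual_iff norm_dual_def)

lemma circ_dual_add: "\<phi> \<in> X\<^sub>c \<Longrightarrow> \<psi> \<in> X\<^sub>c \<Longrightarrow> \<phi> + \<psi> \<in> X\<^sub>c"
  unfolding circ_dual_iff norm_dual_def
  by (auto simp: plus_blinfun.rep_eq algebra_simps intro: tendsto_add)

lemma circ_dual_scaleR: "\<phi> \<in> X\<^sub>c \<Longrightarrow> r *\<^sub>R \<phi> \<in> X\<^sub>c"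
  unfolding circ_dual_iff norm_dual_def
  by (auto simp: scaleR_blinfun.rep_eq intro: tendsto_scaleR[OF tendsto_const])

lemma circ_dual_diff: "\<phi> \<in> X\<^sub>c \<Longrightarrow> \<psi> \<in> X\<^sub>c \<Longrightarrow> \<phi> - \<psi> \<in> X\<^sub>c"
  using circ_dual_add[OF _ circ_dual_scaleR[of \<psi> "- 1"], of \<phi>] by simp

text \<open>A functional dominated by a seminorm of the family is \<open>\<tau>\<close>-continuous, so the Hahn-Banach theorem
provides enough elements of \<open>X\<^sub>c\<close>. The three lemmas below are the form in which this is used: estimates
in \<open>X\<close>, for a seminorm or for the norm, and equalities may be checked after applying functionals.\<close>

lemma circ_dual_norming_seminorm:
  assumes p: "p \<in> P"
  obtains \<phi> where "\<phi> \<in> X\<^sub>c" "\<And>x. norm (blinfun_apply \<phi> x) \<le> p x"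
    "norm \<phi> \<le> 1" "norm (blinfun_apply \<phi> y) = p y"
proof -
  obtain g :: "'x \<Rightarrow> 'k" where g: "\<And>x z. g (x + z) = g x + g z" "\<And>c x. g (smul c x) = c * g x"
    "\<And>x. norm (g x) \<le> p x" "norm (g y) = p y"
    using Hahn_Banach_seminorm[OF P_seminorm[OF p], of y] by blast
  have "bounded_linear g"
  proof (rule bounded_linear_intro[of _ 1])
    fix r x show "g (r *\<^sub>R x) = r *\<^sub>R g x"
      using g(2)[of "of_real r" x] by (simp add: scale_of_real scaleR_conv_of_real)
    show "norm (g x) \<le> norm x * 1" using g(3)[of x] P_le_norm[OF p, of x] by simp
  qed (rule g(1))
  then have app: "blinfun_apply (Blinfun g) = g" by (rule bounded_linear_Blinfun_apply)
  have diff: "g a - g b = g (a - b)" for a b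
    using g(1)[of "a - b" b] by simp
  have "Blinfun g \<in> X\<^sub>c"
    unfolding circ_dual_iff app norm_dual_def
  proof (intro conjI CollectI allI impI)
    fix f l assume "limitin \<gamma> f l sequentially"
    from limitin_\<gamma>_P[OF this p] have "(\<lambda>n. g (f n) - g l) \<longlonglongrightarrow> 0"
      by (rule Lim_null_comparison[rotated]) (simp add: diff g(3))
    then show "(\<lambda>n. g (f n)) \<longlonglongrightarrow> g l" by (simp add: LIM_zero_iff)
  qed (simp add: app g(2))
  moreover have "norm (Blinfun g) \<le> 1"
    using g(3) P_le_norm[OF p] by (intro norm_blinfun_bound) (auto simp: app intro: order_trans)
  ultimately show thesis using that[of "Blinfun g"] g by (simp add: app)
qed

lemma seminorm_le_circ:
  assumes "p \<in> P"
    and "\<And>\<phi>. \<phi> \<in> X\<^sub>c \<Longrightarrow> (\<And>x. norm (blinfun_apply \<phi> x) \<le> p x) \<Longrightarrow> norm (blinfun_apply \<phi> y) \<le> c"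
  shows "p y \<le> c"
  using circ_dual_norming_seminorm[OF assms(1), of y] assms(2) by metis

lemma norm_le_circ:
  assumes "\<And>\<phi>. \<phi> \<in> X\<^sub>c \<Longrightarrow> norm \<phi> \<le> 1 \<Longrightarrow> norm (blinfun_apply \<phi> y) \<le> c"
  shows "norm y \<le> c"
  unfolding norm_le_iff_P using circ_dual_norming_seminorm[of _ y] assms by metis

lemma circ_dual_separates:
  assumes "\<And>\<phi>. \<phi> \<in> X\<^sub>c \<Longrightarrow> blinfun_apply \<phi> x = blinfun_apply \<phi> y"
  shows "x = y"
proof -
  have "norm (x - y) \<le> 0" by (rule norm_le_circ) (simp add: assms blinfun.diff_right)
  then show ?thesis by simp
qed

end

section \<open>Integrals of continuous curves\<close>

definition riemann_sum :: "nat \<Rightarrow> real \<Rightarrow> (real \<Rightarrow> 'v::real_vector) \<Rightarrow> 'v" where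
  "riemann_sum n h f = (h / n) *\<^sub>R (\<Sum>k<n. f (real k * h / n))"

text \<open>The bound depends on \<open>g\<close> only through its modulus of continuity. Applied to all functionals dominated
by a fixed seminorm it therefore shows that vector-valued Riemann sums are Cauchy.\<close>

lemma riemann_sum_estimate:
  fixes g :: "real \<Rightarrow> 'v::banach"
  assumes g: "continuous_on {0..h} g" and h: "0 \<le> h" and n: "0 < n"
    and e: "\<And>s t. s \<in> {0..h} \<Longrightarrow> t \<in> {0..h} \<Longrightarrow> \<bar>s - t\<bar> \<le> h / n \<Longrightarrow> norm (g s - g t) \<le> e"
  shows "norm (integral {0..h} g - riemann_sum n h g) \<le> h * e"
proof -
  define a where "a k = k * h / n" for k :: nat
  have a0: "0 \<le> a k" for k using h n by (simp add: a_def)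
  have step: "a (Suc k) - a k = h / n" for k
    by (simp add: a_def field_simps add_divide_distrib[symmetric])
  have mono: "a k \<le> a (Suc k)" for k using step[of k] h n by (smt (verit) divide_nonneg_nonneg of_nat_0_le_iff)
  have top: "a k \<le> h" if "k \<le> n" for k
  proof -
    have "k * h / n \<le> n * h / n" using that h by (intro divide_right_mono mult_right_mono) auto
    then show ?thesis using n by (simp add: a_def)
  qed
  have an: "a n = h" using n by (simp add: a_def)
  have "norm (integral {0..a m} g - (\<Sum>k<m. (h / n) *\<^sub>R g (a k))) \<le> m * (h / n * e)" if "m \<le> n" for m
    using that
  proof (induction m)
    case 0
    have "a 0 = 0" by (simp add: a_def)
    then show ?case by simp
  next
    case (Suc m)
    have sub: "{a m..a (Suc m)} \<subseteq> {0..h}" "{0..a (Suc m)} \<subseteq> {0..h}"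
      using a0[of m] top[OF Suc.prems] by auto
    have cont: "continuous_on {a m..a (Suc m)} g" using g sub(1) continuous_on_subset by blast
    have "continuous_on {0..a (Suc m)} g" using g sub(2) continuous_on_subset by blast
    then have comb: "integral {0..a (Suc m)} g = integral {0..a m} g + integral {a m..a (Suc m)} g"
      using Henstock_Kurzweil_Integration.integral_combine[OF a0[of m] mono[of m], of g] integrable_continuous_real by metis
    have "integral {a m..a (Suc m)} (\<lambda>t. g t - g (a m)) =
        integral {a m..a (Suc m)} g - integral {a m..a (Suc m)} (\<lambda>t. g (a m))"
      by (rule integral_diff[OF integrable_continuous_real[OF cont]]) auto
    also have "integral {a m..a (Suc m)} (\<lambda>t. g (a m)) = (h / n) *\<^sub>R g (a m)"
      using mono[of m] step[of m] by simp
    finally have eq: "integral {a m..a (Suc m)} g - (h / n) *\<^sub>R g (a m) =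
        integral {a m..a (Suc m)} (\<lambda>t. g t - g (a m))" by simp
    have "norm (integral {a m..a (Suc m)} (\<lambda>t. g t - g (a m))) \<le> e * (a (Suc m) - a m)"
    proof (rule integral_bound[OF mono])
      fix t assume t: "t \<in> {a m..a (Suc m)}"
      then have "\<bar>t - a m\<bar> \<le> h / n" using step[of m] by auto
      moreover have "t \<in> {0..h}" "a m \<in> {0..h}" using t sub(1) mono[of m] by auto
      ultimately show "norm (g t - g (a m)) \<le> e" using e by blast
    qed (intro continuous_intros cont)
    then have "norm (integral {a m..a (Suc m)} g - (h / n) *\<^sub>R g (a m)) \<le> h / n * e"
      unfolding eq step by (simp add: mult.commute)
    moreover have "integral {0..a (Suc m)} g - (\<Sum>k<Suc m. (h / n) *\<^sub>R g (a k)) =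
        (integral {0..a m} g - (\<Sum>k<m. (h / n) *\<^sub>R g (a k))) +
        (integral {a m..a (Suc m)} g - (h / n) *\<^sub>R g (a m))"
      by (simp add: comb)
    moreover have "norm (integral {0..a m} g - (\<Sum>k<m. (h / n) *\<^sub>R g (a k))) \<le> m * (h / n * e)"
      using Suc by simp
    ultimately have "norm (integral {0..a (Suc m)} g - (\<Sum>k<Suc m. (h / n) *\<^sub>R g (a k)))
        \<le> m * (h / n * e) + h / n * e"
      by (metis norm_triangle_mono)
    then show ?case by (simp add: algebra_simps add_divide_distrib)
  qed
  from this[of n] show ?thesis
    using n by (simp add: an riemann_sum_def a_def scaleR_right.sum)
qed

context saks_seminorms
begin

lemma limitin_\<gamma>_add:
  assumes "limitin \<gamma> f a sequentially" "limitin \<gamma> g b sequentially"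
  shows "limitin \<gamma> (\<lambda>n. f n + g n) (a + b) sequentially"
  unfolding limitin_\<gamma>_seq_iff
proof (intro conjI ballI)
  show "bounded (range (\<lambda>n. f n + g n))"
    using assms[THEN limitin_\<gamma>_bounded] by (rule bounded_plus_comp)
next
  fix p assume p: "p \<in> P"
  have "(\<lambda>n. p (f n - a) + p (g n - b)) \<longlonglongrightarrow> 0 + 0"
    using assms p by (intro tendsto_add limitin_\<gamma>_P)
  then have "(\<lambda>n. p (f n - a) + p (g n - b)) \<longlonglongrightarrow> 0" by simp
  then show "(\<lambda>n. p (f n + g n - (a + b))) \<longlonglongrightarrow> 0"
  proof (rule Lim_null_comparison[rotated], intro always_eventually allI)
    fix n
    show "norm (p (f n + g n - (a + b))) \<le> p (f n - a) + p (g n - b)"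
      using seminorm_triangle[OF P_seminorm[OF p], of "f n - a" "g n - b"]
        seminorm_nonneg[OF P_seminorm[OF p], of "f n + g n - (a + b)"]
      by (simp add: algebra_simps)
  qed
qed

lemma limitin_\<gamma>_scaleR:
  assumes r: "r \<longlonglongrightarrow> s" and f: "limitin \<gamma> f a sequentially"
  shows "limitin \<gamma> (\<lambda>n. r n *\<^sub>R f n) (s *\<^sub>R a) sequentially"
proof -
  obtain K where K: "\<And>n. \<bar>r n\<bar> \<le> K" using convergent_imp_Bseq[OF convergentI[OF r]]
    by (auto simp: Bseq_def)
  obtain M where M: "\<And>n. norm (f n) \<le> M" using limitin_\<gamma>_bounded[OF f] by (auto simp: bounded_iff)
  show ?thesis
  proof (rule limitin_\<gamma>I)
    have "norm (r n *\<^sub>R f n) \<le> K * M" for n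
      unfolding norm_scaleR using K[of n] M[of n] by (intro mult_mono) auto
    then show "eventually (\<lambda>n. norm (r n *\<^sub>R f n) \<le> K * M) sequentially" by simp
    fix p assume p: "p \<in> P"
    have "(\<lambda>n. \<bar>r n\<bar> * p (f n - a) + \<bar>r n - s\<bar> * p a) \<longlonglongrightarrow> \<bar>s\<bar> * 0 + \<bar>s - s\<bar> * p a"
      by (intro tendsto_intros r limitin_\<gamma>_P[OF f p])
    then have "(\<lambda>n. \<bar>r n\<bar> * p (f n - a) + \<bar>r n - s\<bar> * p a) \<longlonglongrightarrow> 0" by simp
    then show "(\<lambda>n. p (r n *\<^sub>R f n - s *\<^sub>R a)) \<longlonglongrightarrow> 0"
    proof (rule Lim_null_comparison[rotated], intro always_eventually allI)
      fix n
      have "r n *\<^sub>R f n - s *\<^sub>R a = r n *\<^sub>R (f n - a) + (r n - s) *\<^sub>R a"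
        by (simp add: algebra_simps)
      then have "p (r n *\<^sub>R f n - s *\<^sub>R a) \<le> \<bar>r n\<bar> * p (f n - a) + \<bar>r n - s\<bar> * p a"
        using seminorm_triangle[OF P_seminorm[OF p]] seminorm_scaleR[OF P_seminorm[OF p]] by metis
      then show "norm (p (r n *\<^sub>R f n - s *\<^sub>R a)) \<le> \<bar>r n\<bar> * p (f n - a) + \<bar>r n - s\<bar> * p a"
        using seminorm_nonneg[OF P_seminorm[OF p]] by simp
    qed
  qed
qed

lemma limitin_\<gamma>_const: "limitin \<gamma> (\<lambda>n. a) a F"
  by (simp add: limitin_def topspace_\<gamma>)

lemma limitin_\<gamma>_diff:
  assumes "limitin \<gamma> f a sequentially" "limitin \<gamma> g b sequentially"
  shows "limitin \<gamma> (\<lambda>n. f n - g n) (a - b) sequentially"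
  using limitin_\<gamma>_add[OF assms(1) limitin_\<gamma>_scaleR[OF tendsto_const[of "-1"] assms(2)]] by simp

text \<open>The filter of right neighbourhoods of \<open>0\<close> has a countable basis, so limits at \<open>0\<close> may be computed along
sequences, for which \<open>\<gamma>\<close>-convergence is understood.\<close>

lemma limitin_\<gamma>_at_right_iff:
  "limitin \<gamma> f l (at_right (0::real)) \<longleftrightarrow>
     (\<forall>t. (\<forall>n. 0 < t n) \<and> t \<longlonglongrightarrow> 0 \<longrightarrow> limitin \<gamma> (\<lambda>n. f (t n)) l sequentially)"
proof (intro iffI allI impI)
  fix t :: "nat \<Rightarrow> real" assume lim: "limitin \<gamma> f l (at_right 0)" and t: "(\<forall>n. 0 < t n) \<and> t \<longlonglongrightarrow> 0"
  have "filterlim t (at_right 0) sequentially"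
    using t by (auto simp: filterlim_at intro!: always_eventually simp: less_imp_neq[THEN not_sym])
  then show "limitin \<gamma> (\<lambda>n. f (t n)) l sequentially"
    using lim unfolding limitin_def filterlim_iff by blast
next
  assume seq: "\<forall>t. (\<forall>n. 0 < t n) \<and> t \<longlonglongrightarrow> 0 \<longrightarrow> limitin \<gamma> (\<lambda>n. f (t n)) l sequentially"
  show "limitin \<gamma> f l (at_right 0)"
    unfolding limitin_def
  proof (intro conjI allI impI)
    fix U assume U: "openin \<gamma> U \<and> l \<in> U"
    show "eventually (\<lambda>t. f t \<in> U) (at_right 0)"
    proof (rule sequentially_imp_eventually_at_right[of 0 1])
      fix t :: "nat \<Rightarrow> real" assume "\<And>n. 0 < t n" "t \<longlonglongrightarrow> 0"
      then have "limitin \<gamma> (\<lambda>n. f (t n)) l sequentially" using seq by blast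
      then show "eventually (\<lambda>n. f (t n) \<in> U) sequentially" using U by (simp add: limitin_def)
    qed simp
  qed (simp add: topspace_\<gamma>)
qed

definition \<gamma>_continuous_curve :: "real \<Rightarrow> (real \<Rightarrow> 'x) \<Rightarrow> bool" where
  "\<gamma>_continuous_curve h u \<longleftrightarrow>
     (\<forall>t s. (\<forall>n. t n \<in> {0..h}) \<and> s \<in> {0..h} \<and> t \<longlonglongrightarrow> s \<longrightarrow> limitin \<gamma> (\<lambda>n. u (t n)) (u s) sequentially)"

lemma convergent_subsequence_Icc:
  fixes t :: "nat \<Rightarrow> real"
  assumes "\<And>n. t n \<in> {0..h}"
  obtains s r where "s \<in> {0..h}" "strict_mono r" "(\<lambda>n. t (r n)) \<longlonglongrightarrow> s"
  using compact_imp_seq_compact[OF compact_Icc[of 0 h]] assms unfolding seq_compact_def comp_def by metis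

context
  fixes h :: real and u :: "real \<Rightarrow> 'x"
  assumes u: "\<gamma>_continuous_curve h u"
begin

lemma curve_limitin:
  "(\<And>n. t n \<in> {0..h}) \<Longrightarrow> s \<in> {0..h} \<Longrightarrow> t \<longlonglongrightarrow> s \<Longrightarrow> limitin \<gamma> (\<lambda>n. u (t n)) (u s) sequentially"
  using u unfolding \<gamma>_continuous_curve_def by blast

text \<open>By sequential compactness of the interval: along a convergent sequence of parameters the curve is
\<open>\<gamma>\<close>-convergent, hence norm bounded.\<close>

lemma curve_bounded:
  obtains M where "0 \<le> M" "\<And>s. s \<in> {0..h} \<Longrightarrow> norm (u s) \<le> M"
proof -
  have "\<exists>M. \<forall>s\<in>{0..h}. norm (u s) \<le> M"
  proof (rule ccontr)
    assume "\<nexists>M. \<forall>s\<in>{0..h}. norm (u s) \<le> M"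
    then have "\<forall>n::nat. \<exists>s. s \<in> {0..h} \<and> real n < norm (u s)"
      by (meson not_le)
    then obtain t where t: "\<And>n. t n \<in> {0..h}" "\<And>n. real n < norm (u (t n))"
      unfolding choice_iff by blast
    obtain s r where r: "s \<in> {0..h}" "strict_mono r" "(\<lambda>n. t (r n)) \<longlonglongrightarrow> s"
      using convergent_subsequence_Icc[OF t(1)] .
    have "limitin \<gamma> (\<lambda>n. u (t (r n))) (u s) sequentially"
      by (rule curve_limitin[OF _ r(1) r(3)]) (rule t(1))
    from limitin_\<gamma>_bounded[OF this] obtain M where M: "\<And>n. norm (u (t (r n))) \<le> M"
      by (auto simp: bounded_iff)
    obtain n :: nat where n: "M < real n" using reals_Archimedean2 by blast
    have "n \<le> r n" using seq_suble[OF r(2)] .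
    then have "real n \<le> real (r n)" by simp
    then show False using t(2)[of "r n"] M[of n] n by linarith
  qed
  then obtain M where M: "\<And>s. s \<in> {0..h} \<Longrightarrow> norm (u s) \<le> M" by blast
  then have "norm (u s) \<le> max 0 M" if "s \<in> {0..h}" for s
    using that by (auto simp: le_max_iff_disj)
  then show thesis using that[of "max 0 M"] by simp
qed

lemma curve_uniformly_continuous:
  assumes p: "p \<in> P" and e: "e > 0"
  obtains d where "d > 0" "\<And>s t. s \<in> {0..h} \<Longrightarrow> t \<in> {0..h} \<Longrightarrow> \<bar>s - t\<bar> < d \<Longrightarrow> p (u s - u t) < e"
proof (rule ccontr)
  assume no: "\<not> thesis"
  have sn: "seminorm_over smul p" by (rule P_seminorm[OF p])
  have "\<exists>s t. s \<in> {0..h} \<and> t \<in> {0..h} \<and> \<bar>s - t\<bar> < 1 / real (Suc n) \<and> e \<le> p (u s - u t)" for n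
    using no that[of "1 / real (Suc n)"] by (metis not_less of_nat_0_less_iff zero_less_Suc zero_less_divide_1_iff)
  then obtain s t where st: "\<And>n. s n \<in> {0..h}" "\<And>n. t n \<in> {0..h}"
    "\<And>n. \<bar>s n - t n\<bar> < 1 / real (Suc n)" "\<And>n. e \<le> p (u (s n) - u (t n))" by metis
  obtain a r where r: "a \<in> {0..h}" "strict_mono r" "(\<lambda>n. s (r n)) \<longlonglongrightarrow> a"
    using convergent_subsequence_Icc[OF st(1)] .
  have "(\<lambda>n. s n - t n) \<longlonglongrightarrow> 0"
    by (rule Lim_null_comparison[OF _ LIMSEQ_inverse_real_of_nat])
      (use st(3) in \<open>auto intro!: always_eventually less_imp_le simp: inverse_eq_divide\<close>)
  then have "(\<lambda>n. s (r n) - t (r n)) \<longlonglongrightarrow> 0"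
    using LIMSEQ_subseq_LIMSEQ[OF _ r(2)] unfolding comp_def by blast
  from tendsto_diff[OF r(3) this] have tr: "(\<lambda>n. t (r n)) \<longlonglongrightarrow> a" by simp
  have "(\<lambda>n. p (u (s (r n)) - u a) + p (u (t (r n)) - u a)) \<longlonglongrightarrow> 0 + 0"
    using st r tr by (intro tendsto_add limitin_\<gamma>_P[OF _ p] curve_limitin) auto
  moreover have "e \<le> p (u (s (r n)) - u a) + p (u (t (r n)) - u a)" for n
    using st(4)[of "r n"] seminorm_triangle_diff[OF sn, of "u (s (r n))" "u (t (r n))" "u a"]
      seminorm_diff_commute[OF sn, of "u a" "u (t (r n))"] by simp
  ultimately have "e \<le> 0 + 0" by (intro tendsto_lowerbound) auto
  then show False using e by simp
qed

lemma curve_continuous_circ: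
  assumes "\<phi> \<in> X\<^sub>c"
  shows "continuous_on {0..h} (\<lambda>s. blinfun_apply \<phi> (u s))"
  by (rule continuous_on_sequentiallyI) (rule circ_tendsto[OF assms curve_limitin], auto)

lemma blinfun_riemann_sum:
  "blinfun_apply \<phi> (riemann_sum n h u) = riemann_sum n h (\<lambda>s. blinfun_apply \<phi> (u s))"
  by (simp add: riemann_sum_def blinfun.scaleR_right blinfun.sum_right)

lemma riemann_sums_converge:
  assumes h: "0 \<le> h" and d: "d > 0"
    and e: "\<And>s t. s \<in> {0..h} \<Longrightarrow> t \<in> {0..h} \<Longrightarrow> \<bar>s - t\<bar> < d \<Longrightarrow> norm (blinfun_apply \<phi> (u s - u t)) \<le> e"
    and \<phi>: "\<phi> \<in> X\<^sub>c" and n: "h / d < real n"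
  shows "norm (integral {0..h} (\<lambda>s. blinfun_apply \<phi> (u s)) - blinfun_apply \<phi> (riemann_sum n h u)) \<le> h * e"
  unfolding blinfun_riemann_sum
proof (rule riemann_sum_estimate[OF curve_continuous_circ[OF \<phi>] h])
  have "0 \<le> h / d" using h d by simp
  then have n0: "0 < real n" using n by linarith
  then show "0 < n" by simp
  fix s t assume st: "s \<in> {0..h}" "t \<in> {0..h}" "\<bar>s - t\<bar> \<le> h / real n"
  have "h / real n < d" using n n0 d by (simp add: field_simps)
  then show "norm (blinfun_apply \<phi> (u s) - blinfun_apply \<phi> (u t)) \<le> e"
    using e[of s t] st by (simp add: blinfun.diff_right)
qed

text \<open>The Riemann sums are norm bounded and, by the uniform continuity of the curve for each seminorm,
Cauchy for each seminorm. On bounded sets this is the same as being Cauchy for \<open>\<gamma>\<close>.\<close>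

theorem Pettis_integral_exists:
  assumes complete: "sequentially_complete_in \<gamma> UNIV" and h: "0 \<le> h"
  shows "\<exists>J. \<forall>\<phi>\<in>X\<^sub>c. blinfun_apply \<phi> J = integral {0..h} (\<lambda>s. blinfun_apply \<phi> (u s))"
proof -
  define S where "S n = riemann_sum n h u" for n
  obtain M where M: "0 \<le> M" "\<And>s. s \<in> {0..h} \<Longrightarrow> norm (u s) \<le> M"
    using curve_bounded by blast
  have S_bound: "norm (S n) \<le> h * M" for n
  proof (cases "n = 0")
    case True
    then show ?thesis using h M(1) by (simp add: S_def riemann_sum_def)
  next
    case False
    have "norm (u (k * h / n)) \<le> M" if "k < n" for k :: nat
    proof -
      have "k * h / n \<le> n * h / n" using that h by (intro divide_right_mono mult_right_mono) auto
      then show ?thesis using M(2) h False by simp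
    qed
    then have "norm (\<Sum>k<n. u (real k * h / n)) \<le> (\<Sum>k<n. M)"
      by (intro sum_norm_le) auto
    then have "h / n * norm (\<Sum>k<n. u (real k * h / n)) \<le> h / n * (n * M)"
      using h by (intro mult_left_mono) auto
    then show ?thesis using h False by (simp add: S_def riemann_sum_def)
  qed
  have P_Cauchy: "\<exists>N. \<forall>m\<ge>N. \<forall>n\<ge>N. p (S n - S m) < e" if p: "p \<in> P" and e: "e > 0" for p e
  proof -
    \<comment> \<open>The factor 4 leaves room for two Riemann sums and a strict inequality; \<open>h + 1\<close> avoids division by zero.\<close>
    define e' where "e' = e / (4 * (h + 1))"
    have e': "e' > 0" "2 * h * e' < e"
    proof -
      show "e' > 0" using e h by (simp add: e'_def)
      have "2 * h * e' \<le> 2 * (h + 1) * e'" using \<open>e' > 0\<close> by simp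
      also have "\<dots> = e / 2" using h unfolding e'_def by (simp add: divide_simps)
      finally show "2 * h * e' < e" using e by simp
    qed
    obtain d where d: "d > 0"
      "\<And>s t. s \<in> {0..h} \<Longrightarrow> t \<in> {0..h} \<Longrightarrow> \<bar>s - t\<bar> < d \<Longrightarrow> p (u s - u t) < e'"
      using curve_uniformly_continuous[OF p e'(1)] by blast
    obtain N :: nat where N: "h / d < real N" using reals_Archimedean2 by blast
    have "p (S n - S m) \<le> 2 * h * e'" if mn: "m \<ge> N" "n \<ge> N" for m n
    proof (rule seminorm_le_circ[OF p])
      fix \<phi> assume \<phi>: "\<phi> \<in> X\<^sub>c" "\<And>x. norm (blinfun_apply \<phi> x) \<le> p x"
      let ?I = "integral {0..h} (\<lambda>s. blinfun_apply \<phi> (u s))"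
      have est: "norm (?I - blinfun_apply \<phi> (S k)) \<le> h * e'" if "k \<ge> N" for k
        unfolding S_def
      proof (rule riemann_sums_converge[OF h d(1) _ \<phi>(1)])
        show "h / d < real k" using N that by simp
        fix s t assume "s \<in> {0..h}" "t \<in> {0..h}" "\<bar>s - t\<bar> < d"
        then show "norm (blinfun_apply \<phi> (u s - u t)) \<le> e'"
          using \<phi>(2)[of "u s - u t"] d(2)[of s t] by simp
      qed
      have "blinfun_apply \<phi> (S n - S m) = (?I - blinfun_apply \<phi> (S m)) - (?I - blinfun_apply \<phi> (S n))"
        by (simp add: blinfun.diff_right)
      then show "norm (blinfun_apply \<phi> (S n - S m)) \<le> 2 * h * e'"
        using est[OF mn(1)] est[OF mn(2)] norm_triangle_ineq4[of "?I - blinfun_apply \<phi> (S m)" "?I - blinfun_apply \<phi> (S n)"]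
        by simp
    qed
    then show ?thesis using e'(2) le_less_trans by blast
  qed
  have "limitin \<gamma> (\<lambda>(n, m). S n - S m) 0 (sequentially \<times>\<^sub>F sequentially)"
  proof (rule limitin_\<gamma>I)
    have "norm (S n - S m) \<le> 2 * (h * M)" for n m
      using norm_triangle_ineq4[of "S n" "S m"] S_bound[of n] S_bound[of m] by simp
    then show "eventually (\<lambda>i. norm (case i of (n, m) \<Rightarrow> S n - S m) \<le> 2 * (h * M))
        (sequentially \<times>\<^sub>F sequentially)"
      by (intro always_eventually) auto
    fix p assume p: "p \<in> P"
    show "((\<lambda>i. p ((case i of (n, m) \<Rightarrow> S n - S m) - 0)) \<longlongrightarrow> 0) (sequentially \<times>\<^sub>F sequentially)"
    proof (rule tendstoI)
      fix e :: real assume "e > 0"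
      from P_Cauchy[OF p this] seminorm_nonneg[OF P_seminorm[OF p]]
      show "eventually (\<lambda>i. dist (p ((case i of (n, m) \<Rightarrow> S n - S m) - 0)) 0 < e)
          (sequentially \<times>\<^sub>F sequentially)"
        by (simp add: eventually_prod_sequentially)
    qed
  qed
  then have "Cauchy_in \<gamma> S"
    unfolding limitin_def Cauchy_in_def eventually_prod_sequentially by fastforce
  then obtain J where J: "limitin \<gamma> S J sequentially"
    using complete by (auto simp: sequentially_complete_in_def)
  have "blinfun_apply \<phi> J = integral {0..h} (\<lambda>s. blinfun_apply \<phi> (u s))" if \<phi>: "\<phi> \<in> X\<^sub>c" for \<phi>
  proof -
    let ?I = "integral {0..h} (\<lambda>s. blinfun_apply \<phi> (u s))"
    have "(\<lambda>n. blinfun_apply \<phi> (S n)) \<longlonglongrightarrow> ?I"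
    proof (rule LIMSEQ_I)
      fix r :: real assume r: "r > 0"
      define e where "e = r / (2 * (h + 1))"
      have e: "e > 0" using r h by (simp add: e_def)
      have "h * e \<le> (h + 1) * e" using e by simp
      also have "\<dots> = r / 2" using h unfolding e_def by (simp add: divide_simps)
      finally have he: "h * e < r" using r by simp
      obtain d where d: "d > 0"
        "\<And>s t. s \<in> {0..h} \<Longrightarrow> t \<in> {0..h} \<Longrightarrow> dist t s < d \<Longrightarrow>
           dist (blinfun_apply \<phi> (u t)) (blinfun_apply \<phi> (u s)) < e"
        using compact_uniformly_continuous[OF curve_continuous_circ[OF \<phi>] compact_Icc] e
        unfolding uniformly_continuous_on_def by metis
      obtain N :: nat where N: "h / d < real N" using reals_Archimedean2 by blast
      have "norm (blinfun_apply \<phi> (S n) - ?I) < r" if "n \<ge> N" for n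
      proof -
        have "norm (?I - blinfun_apply \<phi> (S n)) \<le> h * e"
          unfolding S_def
        proof (rule riemann_sums_converge[OF h d(1) _ \<phi>])
          show "h / d < real n" using N that by simp
          fix s t assume "s \<in> {0..h}" "t \<in> {0..h}" "\<bar>s - t\<bar> < d"
          then show "norm (blinfun_apply \<phi> (u s - u t)) \<le> e"
            using d(2)[of t s] by (simp add: dist_norm blinfun.diff_right)
        qed
        then show ?thesis using he by (simp add: norm_minus_commute)
      qed
      then show "\<exists>no. \<forall>n\<ge>no. norm (blinfun_apply \<phi> (S n) - ?I) < r" by blast
    qed
    then show ?thesis using circ_tendsto[OF \<phi> J] LIMSEQ_unique by blast
  qed
  then show ?thesis by blast
qed

end

end

section \<open>Bi-continuous semigroups and their generators\<close>

locale bicontinuous = saks_seminorms smul P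
  for smul :: "'k::real_or_complex \<Rightarrow> 'x::banach \<Rightarrow> 'x" and P :: "('x \<Rightarrow> real) set" +
  fixes T :: "real \<Rightarrow> 'x \<Rightarrow>\<^sub>L 'x"
  assumes complete: "sequentially_complete_in \<gamma> UNIV"
    and semigroup: "bicontinuous_semigroup smul \<tau> T"
begin

lemma T_smul: "0 \<le> t \<Longrightarrow> blinfun_apply (T t) (smul c x) = smul c (blinfun_apply (T t) x)"
  using semigroup by (simp add: bicontinuous_semigroup_def bounded_operators_def)

lemma T_0: "blinfun_apply (T 0) x = x"
  using semigroup by (simp add: bicontinuous_semigroup_def)

lemma T_add: "0 \<le> t \<Longrightarrow> 0 \<le> s \<Longrightarrow> blinfun_apply (T (t + s)) x = blinfun_apply (T t) (blinfun_apply (T s) x)"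
  using semigroup by (simp add: bicontinuous_semigroup_def)

lemma T_commute:
  "0 \<le> t \<Longrightarrow> 0 \<le> s \<Longrightarrow> blinfun_apply (T t) (blinfun_apply (T s) x) = blinfun_apply (T s) (blinfun_apply (T t) x)"
  using T_add[of t s x] T_add[of s t x] by (simp add: add.commute)

lemma T_orbit_limitin:
  assumes "\<And>n. 0 \<le> t n" "0 \<le> s" "t \<longlonglongrightarrow> s"
  shows "limitin \<gamma> (\<lambda>n. blinfun_apply (T (t n)) x) (blinfun_apply (T s) x) sequentially"
proof -
  have "continuous_map (top_of_set {0..}) \<gamma> (\<lambda>t. blinfun_apply (T t) x)"
    using semigroup by (simp add: bicontinuous_semigroup_def)
  moreover have "limitin (top_of_set {0..}) t s sequentially"
    using assms by (simp add: limitin_subtopology)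
  ultimately show ?thesis
    using continuous_map_limit[of "top_of_set {0..}" \<gamma> "\<lambda>t. blinfun_apply (T t) x" t s]
    by (simp add: comp_def)
qed

lemma T_locally_uniform:
  assumes f: "limitin \<gamma> f x sequentially" and t: "\<And>n. t n \<in> {0..s}"
  shows "limitin \<gamma> (\<lambda>n. blinfun_apply (T (t n)) (f n - x)) 0 sequentially"
  unfolding limitin_def
proof (intro conjI allI impI)
  fix U assume U: "openin \<gamma> U \<and> 0 \<in> U"
  have "0 \<le> s" using t[of 0] by simp
  then obtain N where "\<And>n r. n \<ge> N \<Longrightarrow> r \<in> {0..s} \<Longrightarrow> blinfun_apply (T r) (f n - x) \<in> U"
    using semigroup f U unfolding bicontinuous_semigroup_def by meson
  then show "eventually (\<lambda>n. blinfun_apply (T (t n)) (f n - x) \<in> U) sequentially"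
    using t by (intro eventually_sequentiallyI[of N]) blast
qed (simp add: topspace_\<gamma>)

lemma T_limitin:
  assumes f: "limitin \<gamma> f x sequentially" and t: "\<And>n. t n \<in> {0..h}" "s \<in> {0..h}" "t \<longlonglongrightarrow> s"
  shows "limitin \<gamma> (\<lambda>n. blinfun_apply (T (t n)) (f n)) (blinfun_apply (T s) x) sequentially"
proof -
  have "limitin \<gamma> (\<lambda>n. blinfun_apply (T (t n)) x) (blinfun_apply (T s) x) sequentially"
    using t by (intro T_orbit_limitin) auto
  from limitin_\<gamma>_add[OF T_locally_uniform[where t = t and s = h, OF f t(1)] this]
  show ?thesis by (simp add: blinfun.diff_right)
qed

text \<open>Local equicontinuity on sequences replaces the uniform boundedness principle. If the norms were
unbounded on the interval, there would be a norm-null sequence \<open>x\<close> and parameters \<open>t\<close> such that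
\<open>T(t\<^sub>n) x\<^sub>n\<close> is unbounded; but it is a \<open>\<gamma>\<close>-null sequence.\<close>

lemma T_bounded:
  obtains M where "0 \<le> M" "\<And>s. s \<in> {0..h} \<Longrightarrow> norm (T s) \<le> M"
proof -
  have "\<exists>M. \<forall>s\<in>{0..h}. norm (T s) \<le> M"
  proof (rule ccontr)
    assume no: "\<nexists>M. \<forall>s\<in>{0..h}. norm (T s) \<le> M"
    have "\<forall>n::nat. \<exists>s y. s \<in> {0..h} \<and> (real (Suc n))\<^sup>2 * norm y < norm (blinfun_apply (T s) y)"
    proof
      fix n :: nat
      obtain s where s: "s \<in> {0..h}" "\<not> norm (T s) \<le> (real (Suc n))\<^sup>2"
        using no by meson
      then have "\<not> (\<forall>y. norm (blinfun_apply (T s) y) \<le> (real (Suc n))\<^sup>2 * norm y)"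
        using norm_blinfun_bound[of "(real (Suc n))\<^sup>2" "T s"] zero_le_power2 by blast
      then show "\<exists>s y. s \<in> {0..h} \<and> (real (Suc n))\<^sup>2 * norm y < norm (blinfun_apply (T s) y)"
        using s(1) by (meson not_le)
    qed
    then obtain t y where t: "\<And>n. t n \<in> {0..h}"
      and y: "\<And>n. (real (Suc n))\<^sup>2 * norm (y n) < norm (blinfun_apply (T (t n)) (y n))"
      unfolding choice_iff by blast
    define x where "x n = (1 / (real (Suc n) * norm (y n))) *\<^sub>R y n" for n
    have y0: "norm (y n) > 0" for n using y[of n] by auto
    have "(\<lambda>n. norm (x n)) \<longlonglongrightarrow> 0"
    proof -
      have "norm (x n) = inverse (real (Suc n))" for n
        using y0[of n] by (simp add: x_def inverse_eq_divide del: of_nat_Suc)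
      then show ?thesis using LIMSEQ_inverse_real_of_nat by simp
    qed
    then have "limitin \<gamma> x 0 sequentially"
      by (intro norm_convergent_limitin_\<gamma>) (simp add: tendsto_norm_zero_iff)
    from T_locally_uniform[OF this t]
    have "bounded (range (\<lambda>n. blinfun_apply (T (t n)) (x n)))"
      using limitin_\<gamma>_bounded by force
    then obtain C where C: "\<And>n. norm (blinfun_apply (T (t n)) (x n)) \<le> C"
      by (auto simp: bounded_iff)
    have "real (Suc n) < norm (blinfun_apply (T (t n)) (x n))" for n
    proof -
      have "real (Suc n) = (real (Suc n))\<^sup>2 * norm (y n) / (real (Suc n) * norm (y n))"
        using y0[of n] by (simp add: power2_eq_square)
      also have "\<dots> < norm (blinfun_apply (T (t n)) (y n)) / (real (Suc n) * norm (y n))"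
        using y[of n] y0[of n] by (intro divide_strict_right_mono mult_pos_pos) auto
      also have "\<dots> = norm (blinfun_apply (T (t n)) (x n))"
        using y0[of n] by (simp add: x_def blinfun.scaleR_right)
      finally show ?thesis .
    qed
    moreover obtain n :: nat where "C < real n" using reals_Archimedean2 by blast
    ultimately show False using C[of n] by (smt (verit) of_nat_Suc)
  qed
  then obtain M where M: "\<And>s. s \<in> {0..h} \<Longrightarrow> norm (T s) \<le> M" by blast
  then have "norm (T s) \<le> max 0 M" if "s \<in> {0..h}" for s
    using that by (auto simp: le_max_iff_disj)
  then show thesis using that[of "max 0 M"] by simp
qed

lemma circ_dual_T:
  assumes "\<phi> \<in> X\<^sub>c" "0 \<le> t"
  shows "\<phi> o\<^sub>L T t \<in> X\<^sub>c"
  unfolding circ_dual_iff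
proof (intro conjI allI impI)
  show "\<phi> o\<^sub>L T t \<in> norm_dual smul"
    using circ_smul[OF assms(1)] T_smul[OF assms(2)] by (simp add: norm_dual_def)
  fix f l assume "limitin \<gamma> f l sequentially"
  from T_limitin[OF this, of "\<lambda>n. t" t t] assms(2)
  have "limitin \<gamma> (\<lambda>n. blinfun_apply (T t) (f n)) (blinfun_apply (T t) l) sequentially" by simp
  then show "(\<lambda>n. blinfun_apply (\<phi> o\<^sub>L T t) (f n)) \<longlonglongrightarrow> blinfun_apply (\<phi> o\<^sub>L T t) l"
    using circ_tendsto[OF assms(1)] by simp
qed

lemma orbit_curve: "\<gamma>_continuous_curve h (\<lambda>s. exp (- l * s) *\<^sub>R blinfun_apply (T s) x)"
  unfolding \<gamma>_continuous_curve_def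
proof (intro allI impI, elim conjE)
  fix t s assume t: "\<forall>n. t n \<in> {0..h}" "s \<in> {0..h}" "t \<longlonglongrightarrow> s"
  show "limitin \<gamma> (\<lambda>n. exp (- l * t n) *\<^sub>R blinfun_apply (T (t n)) x)
      (exp (- l * s) *\<^sub>R blinfun_apply (T s) x) sequentially"
    using t by (intro limitin_\<gamma>_scaleR T_orbit_limitin tendsto_intros) auto
qed

text \<open>The Laplace transform \<open>\<integral>\<^sub>0\<^sup>h e\<^sup>-\<^sup>l\<^sup>s T(s)x ds\<close> truncated at \<open>h\<close>, as a weak integral. For \<open>l = 0\<close> it gives the
means of the orbit of \<open>x\<close>, up to the factor \<open>h\<close>, and for large \<open>l\<close> it approximates the resolvent. The
element is unique because \<open>X\<^sub>c\<close> separates points.\<close>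

definition laplace :: "real \<Rightarrow> real \<Rightarrow> 'x \<Rightarrow> 'x" where
  "laplace l h x = (SOME y. \<forall>\<phi>\<in>X\<^sub>c. blinfun_apply \<phi> y =
     integral {0..h} (\<lambda>s. exp (- l * s) *\<^sub>R blinfun_apply \<phi> (blinfun_apply (T s) x)))"

lemma laplace_apply:
  assumes "0 \<le> h" "\<phi> \<in> X\<^sub>c"
  shows "blinfun_apply \<phi> (laplace l h x) =
     integral {0..h} (\<lambda>s. exp (- l * s) *\<^sub>R blinfun_apply \<phi> (blinfun_apply (T s) x))"
proof -
  have "\<exists>y. \<forall>\<phi>\<in>X\<^sub>c. blinfun_apply \<phi> y =
     integral {0..h} (\<lambda>s. exp (- l * s) *\<^sub>R blinfun_apply \<phi> (blinfun_apply (T s) x))"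
    using Pettis_integral_exists[OF orbit_curve complete assms(1), of l x]
    by (simp add: blinfun.scaleR_right)
  from someI_ex[OF this] show ?thesis using assms(2) unfolding laplace_def by blast
qed

lemma orbit_continuous_circ:
  assumes "\<phi> \<in> X\<^sub>c"
  shows "continuous_on {0..h} (\<lambda>s. blinfun_apply \<phi> (blinfun_apply (T s) x))"
  using curve_continuous_circ[OF orbit_curve[of h 0 x] assms] by simp

lemma laplace_integrable:
  assumes "\<phi> \<in> X\<^sub>c"
  shows "(\<lambda>s. exp (- l * s) *\<^sub>R blinfun_apply \<phi> (blinfun_apply (T s) x)) integrable_on {0..h}"
  by (intro integrable_continuous_real continuous_intros orbit_continuous_circ assms)

lemma laplace_add:
  assumes h: "0 \<le> h"
  shows "laplace l h (x + y) = laplace l h x + laplace l h y"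
proof (rule circ_dual_separates)
  fix \<phi> assume \<phi>: "\<phi> \<in> X\<^sub>c"
  show "blinfun_apply \<phi> (laplace l h (x + y)) = blinfun_apply \<phi> (laplace l h x + laplace l h y)"
    using integral_add[OF laplace_integrable[OF \<phi>, of l x h] laplace_integrable[OF \<phi>, of l y h]]
    by (simp add: laplace_apply[OF h \<phi>] blinfun.add_right scaleR_add_right)
qed

lemma laplace_scaleR:
  assumes h: "0 \<le> h"
  shows "laplace l h (r *\<^sub>R x) = r *\<^sub>R laplace l h x"
proof (rule circ_dual_separates)
  fix \<phi> assume \<phi>: "\<phi> \<in> X\<^sub>c"
  have "integral {0..h} (\<lambda>s. r *\<^sub>R (exp (- l * s) *\<^sub>R blinfun_apply \<phi> (blinfun_apply (T s) x))) =
      r *\<^sub>R integral {0..h} (\<lambda>s. exp (- l * s) *\<^sub>R blinfun_apply \<phi> (blinfun_apply (T s) x))"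
    by (rule integral_cmul)
  then show "blinfun_apply \<phi> (laplace l h (r *\<^sub>R x)) = blinfun_apply \<phi> (r *\<^sub>R laplace l h x)"
    by (simp add: laplace_apply[OF h \<phi>] blinfun.scaleR_right mult.commute)
qed

lemma laplace_smul:
  assumes h: "0 \<le> h"
  shows "laplace l h (smul c x) = smul c (laplace l h x)"
proof (rule circ_dual_separates)
  fix \<phi> assume \<phi>: "\<phi> \<in> X\<^sub>c"
  have "blinfun_apply \<phi> (laplace l h (smul c x)) =
      integral {0..h} (\<lambda>s. exp (- l * s) *\<^sub>R (c * blinfun_apply \<phi> (blinfun_apply (T s) x)))"
    unfolding laplace_apply[OF h \<phi>]
    by (rule integral_cong) (simp add: T_smul circ_smul[OF \<phi>])
  also have "\<dots> = integral {0..h} ((\<lambda>z. c * z) \<circ> (\<lambda>s. exp (- l * s) *\<^sub>R blinfun_apply \<phi> (blinfun_apply (T s) x)))"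
    by (simp add: comp_def)
  also have "\<dots> = c * blinfun_apply \<phi> (laplace l h x)"
    unfolding laplace_apply[OF h \<phi>]
    by (rule integral_linear[OF laplace_integrable[OF \<phi>] bounded_linear_mult_right])
  finally show "blinfun_apply \<phi> (laplace l h (smul c x)) = blinfun_apply \<phi> (smul c (laplace l h x))"
    by (simp add: circ_smul[OF \<phi>])
qed

lemma laplace_norm_circ:
  assumes h: "0 \<le> h" and \<phi>: "\<phi> \<in> X\<^sub>c"
    and c: "\<And>s. s \<in> {0..h} \<Longrightarrow> norm (blinfun_apply \<phi> (exp (- l * s) *\<^sub>R blinfun_apply (T s) x - y)) \<le> c"
  shows "norm (blinfun_apply \<phi> (laplace l h x - h *\<^sub>R y)) \<le> h * c"
proof -
  let ?f = "\<lambda>s. exp (- l * s) *\<^sub>R blinfun_apply \<phi> (blinfun_apply (T s) x)"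
  have "blinfun_apply \<phi> (laplace l h x - h *\<^sub>R y) = integral {0..h} ?f - integral {0..h} (\<lambda>s. blinfun_apply \<phi> y)"
    using h by (simp add: laplace_apply[OF h \<phi>] blinfun.diff_right blinfun.scaleR_right)
  also have "\<dots> = integral {0..h} (\<lambda>s. ?f s - blinfun_apply \<phi> y)"
    by (rule integral_diff[OF laplace_integrable[OF \<phi>], symmetric]) auto
  also have "norm \<dots> \<le> c * (h - 0)"
    by (rule integral_bound[OF h])
      (use c in \<open>auto intro!: continuous_intros orbit_continuous_circ \<phi> simp: blinfun.diff_right blinfun.scaleR_right\<close>)
  finally show ?thesis by (simp add: mult.commute)
qed

lemma laplace_seminorm:
  assumes h: "0 \<le> h" and p: "p \<in> P"
    and c: "\<And>s. s \<in> {0..h} \<Longrightarrow> p (exp (- l * s) *\<^sub>R blinfun_apply (T s) x - y) \<le> c"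
  shows "p (laplace l h x - h *\<^sub>R y) \<le> h * c"
proof (rule seminorm_le_circ[OF p])
  fix \<phi> assume \<phi>: "\<phi> \<in> X\<^sub>c" "\<And>x. norm (blinfun_apply \<phi> x) \<le> p x"
  show "norm (blinfun_apply \<phi> (laplace l h x - h *\<^sub>R y)) \<le> h * c"
    by (rule laplace_norm_circ[OF h \<phi>(1)]) (use \<phi>(2) c order_trans in blast)
qed

lemma laplace_norm:
  assumes h: "0 \<le> h"
    and c: "\<And>s. s \<in> {0..h} \<Longrightarrow> norm (exp (- l * s) *\<^sub>R blinfun_apply (T s) x) \<le> c"
  shows "norm (laplace l h x) \<le> h * c"
  unfolding norm_le_iff_P
proof
  fix p assume p: "p \<in> P"
  have "p (laplace l h x - h *\<^sub>R 0) \<le> h * c"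
    by (rule laplace_seminorm[OF h p]) (simp only: diff_0_right order_trans[OF P_le_norm[OF p] c])
  then show "p (laplace l h x) \<le> h * c" by simp
qed

lemma laplace_bounded:
  assumes h: "0 \<le> h"
  obtains C where "0 \<le> C" "\<And>k x. k \<in> {0..h} \<Longrightarrow> norm (laplace l k x) \<le> k * (C * norm x)"
proof -
  obtain M where M: "0 \<le> M" "\<And>s. s \<in> {0..h} \<Longrightarrow> norm (T s) \<le> M" using T_bounded by blast
  define C where "C = exp (\<bar>l\<bar> * h) * M"
  have "norm (laplace l k x) \<le> k * (C * norm x)" if k: "k \<in> {0..h}" for k x
  proof (rule laplace_norm)
    fix s assume s: "s \<in> {0..k}"
    have "- l * s \<le> \<bar>l\<bar> * s" using s by (simp add: abs_le_iff mult_right_mono[of "- l" "\<bar>l\<bar>" s, simplified])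
    also have "\<dots> \<le> \<bar>l\<bar> * h" using s k by (intro mult_left_mono) auto
    finally have "exp (- l * s) \<le> exp (\<bar>l\<bar> * h)" by simp
    moreover have "norm (blinfun_apply (T s) x) \<le> M * norm x"
      using s k by (intro order_trans[OF norm_blinfun] mult_right_mono M) auto
    ultimately have "exp (- l * s) * norm (blinfun_apply (T s) x) \<le> exp (\<bar>l\<bar> * h) * (M * norm x)"
      by (intro mult_mono) auto
    then show "norm (exp (- l * s) *\<^sub>R blinfun_apply (T s) x) \<le> C * norm x"
      by (simp add: C_def mult.assoc)
  qed (use k in simp)
  moreover have "0 \<le> C" using M(1) by (simp add: C_def)
  ultimately show thesis using that by blast
qed

text \<open>Bi-continuity makes the integrands tend to \<open>0\<close> uniformly on the interval. If they did not, there
would be parameters \<open>s\<close> along a subsequence at which they stay away from \<open>0\<close>.\<close>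

lemma laplace_circ_dual:
  assumes h: "0 \<le> h" and \<phi>: "\<phi> \<in> X\<^sub>c" and f: "limitin \<gamma> f 0 sequentially"
  shows "(\<lambda>n. blinfun_apply \<phi> (laplace l h (f n))) \<longlonglongrightarrow> 0"
proof -
  have unif: "\<forall>e>0. \<exists>N. \<forall>n\<ge>N. \<forall>s\<in>{0..h}. norm (blinfun_apply \<phi> (exp (- l * s) *\<^sub>R blinfun_apply (T s) (f n))) \<le> e"
  proof (rule ccontr)
    assume "\<not> ?thesis"
    then obtain e where e: "e > 0" and "\<forall>N. \<exists>n s. n \<ge> N \<and> s \<in> {0..h} \<and>
        e < norm (blinfun_apply \<phi> (exp (- l * s) *\<^sub>R blinfun_apply (T s) (f n)))"
      by (meson not_le)
    then obtain n s where n: "\<And>N. n N \<ge> N" and s: "\<And>N. s N \<in> {0..h}"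
      and big: "\<And>N. e < norm (blinfun_apply \<phi> (exp (- l * s N) *\<^sub>R blinfun_apply (T (s N)) (f (n N))))"
      unfolding choice_iff by blast
    have "filterlim n at_top sequentially" using n by (intro filterlim_at_top_mono[OF filterlim_ident]) auto
    then have "limitin \<gamma> (\<lambda>N. f (n N)) 0 sequentially"
      using f unfolding limitin_def filterlim_iff by blast
    from T_locally_uniform[OF this s]
    have lim: "(\<lambda>N. blinfun_apply \<phi> (blinfun_apply (T (s N)) (f (n N)))) \<longlonglongrightarrow> 0"
      using circ_tendsto[OF \<phi>] by (force simp: blinfun.zero_right)
    have "norm (exp (- l * s N)) \<le> exp (\<bar>l\<bar> * h)" for N
    proof -
      have "- l * s N \<le> \<bar>- l * s N\<bar>" by (rule abs_ge_self)
      also have "\<dots> \<le> \<bar>l\<bar> * h" unfolding abs_mult using s[of N] by (intro mult_mono) auto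
      finally show ?thesis by simp
    qed
    then have le: "norm (exp (- l * s N) *\<^sub>R blinfun_apply \<phi> (blinfun_apply (T (s N)) (f (n N)))) \<le>
        exp (\<bar>l\<bar> * h) * norm (blinfun_apply \<phi> (blinfun_apply (T (s N)) (f (n N))))" for N
      unfolding norm_scaleR by (intro mult_right_mono) auto
    have "(\<lambda>N. exp (\<bar>l\<bar> * h) * norm (blinfun_apply \<phi> (blinfun_apply (T (s N)) (f (n N))))) \<longlonglongrightarrow> 0"
      using tendsto_mult[OF tendsto_const tendsto_norm_zero[OF lim]] by force
    then have "(\<lambda>N. exp (- l * s N) *\<^sub>R blinfun_apply \<phi> (blinfun_apply (T (s N)) (f (n N)))) \<longlonglongrightarrow> 0"
      by (rule Lim_null_comparison[OF always_eventually[OF allI[OF le]]])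
    then have "(\<lambda>N. norm (blinfun_apply \<phi> (exp (- l * s N) *\<^sub>R blinfun_apply (T (s N)) (f (n N))))) \<longlonglongrightarrow> 0"
      by (simp add: blinfun.scaleR_right tendsto_norm_zero_iff del: norm_scaleR)
    then have "e \<le> 0" using big by (intro tendsto_lowerbound) (auto intro!: always_eventually less_imp_le)
    then show False using e by simp
  qed
  show ?thesis
  proof (rule LIMSEQ_I)
    fix r :: real assume r: "r > 0"
    define e where "e = r / (2 * (h + 1))"
    have e: "e > 0" using r h by (simp add: e_def)
    have "h * e \<le> (h + 1) * e" using e by simp
    also have "\<dots> = r / 2" using h unfolding e_def by (simp add: divide_simps)
    finally have he: "h * e < r" using r by simp
    obtain N where N: "\<And>n s. n \<ge> N \<Longrightarrow> s \<in> {0..h} \<Longrightarrow>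
        norm (blinfun_apply \<phi> (exp (- l * s) *\<^sub>R blinfun_apply (T s) (f n))) \<le> e"
      using unif e by meson
    have "norm (blinfun_apply \<phi> (laplace l h (f n))) < r" if "n \<ge> N" for n
      using laplace_norm_circ[OF h \<phi>, of l "f n" 0 e] N[OF that] he by simp
    then show "\<exists>no. \<forall>n\<ge>no. norm (blinfun_apply \<phi> (laplace l h (f n)) - 0) < r" by auto
  qed
qed

lemma T_laplace:
  assumes h: "0 \<le> h" and t: "0 \<le> t"
  shows "blinfun_apply (T t) (laplace l h x) = laplace l h (blinfun_apply (T t) x)"
proof (rule circ_dual_separates)
  fix \<phi> assume \<phi>: "\<phi> \<in> X\<^sub>c"
  have "blinfun_apply \<phi> (blinfun_apply (T t) (laplace l h x)) = blinfun_apply (\<phi> o\<^sub>L T t) (laplace l h x)" by simp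
  also have "\<dots> = integral {0..h} (\<lambda>s. exp (- l * s) *\<^sub>R blinfun_apply (\<phi> o\<^sub>L T t) (blinfun_apply (T s) x))"
    by (rule laplace_apply[OF h circ_dual_T[OF \<phi> t]])
  also have "\<dots> = blinfun_apply \<phi> (laplace l h (blinfun_apply (T t) x))"
    unfolding laplace_apply[OF h \<phi>] by (rule integral_cong) (simp add: T_commute[OF t])
  finally show "blinfun_apply \<phi> (blinfun_apply (T t) (laplace l h x)) = blinfun_apply \<phi> (laplace l h (blinfun_apply (T t) x))" .
qed

lemma laplace_split:
  assumes h: "0 \<le> h" and k: "0 \<le> k"
  shows "laplace l (h + k) x = laplace l h x + exp (- l * h) *\<^sub>R laplace l k (blinfun_apply (T h) x)"
proof (rule circ_dual_separates)
  fix \<phi> assume \<phi>: "\<phi> \<in> X\<^sub>c"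
  let ?f = "\<lambda>s. exp (- l * s) *\<^sub>R blinfun_apply \<phi> (blinfun_apply (T s) x)"
  have "integral {h..h + k} ?f = integral {0..k} (\<lambda>s. ?f (s + h))"
    using integral_shift_real_ivl[of h h "h + k" ?f] by simp
  also have "\<dots> = integral {0..k} (\<lambda>s. exp (- l * h) *\<^sub>R
      (exp (- l * s) *\<^sub>R blinfun_apply \<phi> (blinfun_apply (T s) (blinfun_apply (T h) x))))"
    by (rule integral_cong) (simp add: T_add h exp_add[symmetric] algebra_simps)
  also have "\<dots> = exp (- l * h) *\<^sub>R blinfun_apply \<phi> (laplace l k (blinfun_apply (T h) x))"
    unfolding laplace_apply[OF k \<phi>] by (rule integral_cmul)
  moreover have "integral {0..h} ?f + integral {h..h + k} ?f = integral {0..h + k} ?f"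
    using h k by (intro Henstock_Kurzweil_Integration.integral_combine laplace_integrable \<phi>) auto
  ultimately show "blinfun_apply \<phi> (laplace l (h + k) x) =
      blinfun_apply \<phi> (laplace l h x + exp (- l * h) *\<^sub>R laplace l k (blinfun_apply (T h) x))"
    using h k by (simp add: laplace_apply[OF _ \<phi>] blinfun.add_right blinfun.scaleR_right)
qed

lemma laplace_small:
  "limitin \<gamma> (\<lambda>k. (1 / k) *\<^sub>R laplace l k x) x (at_right 0)"
proof -
  obtain C where C: "0 \<le> C" "\<And>k x. k \<in> {0..1} \<Longrightarrow> norm (laplace l k x) \<le> k * (C * norm x)"
    using laplace_bounded[of 1 l] by auto
  have small: "eventually (\<lambda>k. 0 < k \<and> k < d) (at_right 0)" if "0 < d" for d :: real
    using that by (auto simp: eventually_at_right_field)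
  show ?thesis
  proof (rule limitin_\<gamma>I)
    from small[of 1, simplified] show "eventually (\<lambda>k. norm ((1 / k) *\<^sub>R laplace l k x) \<le> C * norm x) (at_right 0)"
    proof eventually_elim
      case (elim k)
      then have "norm (laplace l k x) \<le> k * (C * norm x)" using C by simp
      then show ?case using elim by (simp add: field_simps)
    qed
    fix p assume p: "p \<in> P"
    have sn: "seminorm_over smul p" by (rule P_seminorm[OF p])
    show "((\<lambda>k. p ((1 / k) *\<^sub>R laplace l k x - x)) \<longlongrightarrow> 0) (at_right 0)"
    proof (rule tendstoI)
      fix e :: real assume e: "e > 0"
      obtain d where d: "d > 0" "\<And>s t. s \<in> {0..1} \<Longrightarrow> t \<in> {0..1} \<Longrightarrow> \<bar>s - t\<bar> < d \<Longrightarrow>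
          p (exp (- l * s) *\<^sub>R blinfun_apply (T s) x - exp (- l * t) *\<^sub>R blinfun_apply (T t) x) < e / 2"
        using curve_uniformly_continuous[OF orbit_curve p, of "e / 2" 1 l x] e by auto
      have "0 < min d 1" using d by simp
      from small[OF this] show "eventually (\<lambda>k. dist (p ((1 / k) *\<^sub>R laplace l k x - x)) 0 < e) (at_right 0)"
      proof eventually_elim
        case (elim k)
        have "p (laplace l k x - k *\<^sub>R x) \<le> k * (e / 2)"
        proof (rule laplace_seminorm[OF _ p])
          fix s assume "s \<in> {0..k}"
          then show "p (exp (- l * s) *\<^sub>R blinfun_apply (T s) x - x) \<le> e / 2"
            using d(2)[of s 0] elim by (simp add: T_0)
        qed (use elim in simp)
        moreover have "laplace l k x - k *\<^sub>R x = k *\<^sub>R ((1 / k) *\<^sub>R laplace l k x - x)"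
          using elim by (simp add: algebra_simps)
        ultimately have "k * p ((1 / k) *\<^sub>R laplace l k x - x) \<le> k * (e / 2)"
          using elim by (simp add: seminorm_scaleR[OF sn])
        then have "p ((1 / k) *\<^sub>R laplace l k x - x) \<le> e / 2" using elim by simp
        then show ?case using e seminorm_nonneg[OF sn, of "(1 / k) *\<^sub>R laplace l k x - x"] by simp
      qed
    qed
  qed
qed

abbreviation D :: "'x set" where "D \<equiv> generator_dom \<gamma> T"
abbreviation A :: "'x \<Rightarrow> 'x" where "A \<equiv> generator \<gamma> T"

lemma generatorI:
  assumes "limitin \<gamma> (\<lambda>t. (1 / t) *\<^sub>R (blinfun_apply (T t) x - x)) y (at_right 0)"
  shows "x \<in> D" "A x = y"
proof -
  show "x \<in> D" using assms unfolding generator_dom_def by blast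
  show "A x = y" unfolding generator_def
    using assms by (rule the_equality) (rule limitin_\<gamma>_unique[OF _ assms], auto)
qed

lemma generator_limitin:
  assumes "x \<in> D"
  shows "limitin \<gamma> (\<lambda>t. (1 / t) *\<^sub>R (blinfun_apply (T t) x - x)) (A x) (at_right 0)"
  using assms generatorI(2) unfolding generator_dom_def by blast

text \<open>Splitting the integral over \<open>[0, h + k]\<close> at \<open>k\<close> and at \<open>h\<close> gives, for \<open>z\<close> the truncated transform and
\<open>v = e\<^sup>-\<^sup>l\<^sup>h T(h)x - x\<close>, the identity \<open>T(k)z - z = (e\<^sup>l\<^sup>k - 1) z + e\<^sup>l\<^sup>k \<integral>\<^sub>0\<^sup>k e\<^sup>-\<^sup>l\<^sup>s T(s)v ds\<close>. Divide by \<open>k\<close>.\<close>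

lemma laplace_generator:
  assumes h: "0 \<le> h"
  shows "laplace l h x \<in> D" "A (laplace l h x) = l *\<^sub>R laplace l h x - (x - exp (- l * h) *\<^sub>R blinfun_apply (T h) x)"
proof -
  define z where "z = laplace l h x"
  define v where "v = exp (- l * h) *\<^sub>R blinfun_apply (T h) x - x"
  have Tk: "blinfun_apply (T k) z - z = (exp (l * k) - 1) *\<^sub>R z + exp (l * k) *\<^sub>R laplace l k v" if k: "0 < k" for k
  proof -
    have 1: "laplace l k x + exp (- l * k) *\<^sub>R blinfun_apply (T k) z = z + exp (- l * h) *\<^sub>R laplace l k (blinfun_apply (T h) x)"
      using laplace_split[OF h, of k l x] laplace_split[OF less_imp_le[OF k] h, of l x] T_laplace[OF h, of k l x] k
      by (simp add: add.commute z_def)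
    have 2: "laplace l k v = exp (- l * h) *\<^sub>R laplace l k (blinfun_apply (T h) x) - laplace l k x"
      using laplace_add[of k l "exp (- l * h) *\<^sub>R blinfun_apply (T h) x" "(- 1) *\<^sub>R x"] laplace_scaleR[of k l "- 1" x]
        laplace_scaleR[of k l "exp (- l * h)" "blinfun_apply (T h) x"] k
      by (simp add: v_def)
    have "exp (- l * k) *\<^sub>R blinfun_apply (T k) z =
        (laplace l k x + exp (- l * k) *\<^sub>R blinfun_apply (T k) z) - laplace l k x" by simp
    also have "\<dots> = z + laplace l k v" unfolding 1 2 by (rule add_diff_eq[symmetric])
    finally have "exp (- l * k) *\<^sub>R blinfun_apply (T k) z = z + laplace l k v" .
    then have "exp (l * k) *\<^sub>R (exp (- l * k) *\<^sub>R blinfun_apply (T k) z) = exp (l * k) *\<^sub>R (z + laplace l k v)"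
      by simp
    then show ?thesis by (simp add: exp_add[symmetric] algebra_simps)
  qed
  have "limitin \<gamma> (\<lambda>t. (1 / t) *\<^sub>R (blinfun_apply (T t) z - z)) (l *\<^sub>R z + v) (at_right 0)"
    unfolding limitin_\<gamma>_at_right_iff
  proof (intro allI impI, elim conjE)
    fix t :: "nat \<Rightarrow> real" assume t: "\<forall>n. 0 < t n" "t \<longlonglongrightarrow> 0"
    have "((\<lambda>k. (exp (l * k) - 1) / k) \<longlongrightarrow> l) (at 0)"
    proof -
      have "((\<lambda>k. exp (l * k)) has_field_derivative l) (at 0)"
        by (auto intro!: derivative_eq_intros)
      then show ?thesis by (simp add: has_field_derivative_iff)
    qed
    then have 1: "(\<lambda>n. (exp (l * t n) - 1) / t n) \<longlonglongrightarrow> l"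
      using t tendsto_at_iff_sequentially[of "\<lambda>k. (exp (l * k) - 1) / k" l 0 UNIV]
      by (auto simp: comp_def less_imp_neq[THEN not_sym])
    have 2: "(\<lambda>n. exp (l * t n)) \<longlonglongrightarrow> 1"
      using tendsto_exp[OF tendsto_mult[OF tendsto_const[of l] t(2)]] by simp
    have 3: "limitin \<gamma> (\<lambda>n. (1 / t n) *\<^sub>R laplace l (t n) v) v sequentially"
      using laplace_small[of l v] t by (simp add: limitin_\<gamma>_at_right_iff)
    from limitin_\<gamma>_add[OF limitin_\<gamma>_scaleR[OF 1 limitin_\<gamma>_const[of z]] limitin_\<gamma>_scaleR[OF 2 3]]
    show "limitin \<gamma> (\<lambda>n. (1 / t n) *\<^sub>R (blinfun_apply (T (t n)) z - z)) (l *\<^sub>R z + v) sequentially"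
      using Tk t(1) by (simp add: scaleR_add_right)
  qed
  from generatorI[OF this] show "laplace l h x \<in> D"
    "A (laplace l h x) = l *\<^sub>R laplace l h x - (x - exp (- l * h) *\<^sub>R blinfun_apply (T h) x)"
    by (simp_all add: z_def v_def)
qed

text \<open>By the semigroup law both one-sided difference quotients at \<open>s\<close> have the form \<open>T(m)((T(k)z - z)/k)\<close>
with \<open>m\<close> the smaller of the two parameters and \<open>k\<close> their distance; bi-continuity allows \<open>m\<close> to vary.\<close>

lemma orbit_derivative:
  assumes z: "z \<in> D" and \<phi>: "\<phi> \<in> X\<^sub>c" and s: "s \<in> {0..h}"
  shows "((\<lambda>s. blinfun_apply \<phi> (blinfun_apply (T s) z)) has_vector_derivative
     blinfun_apply \<phi> (blinfun_apply (T s) (A z))) (at s within {0..h})"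
proof -
  define g where "g r = blinfun_apply \<phi> (blinfun_apply (T r) z)" for r
  define d where "d = blinfun_apply \<phi> (blinfun_apply (T s) (A z))"
  have "((\<lambda>r. (1 / norm (r - s)) *\<^sub>R (g r - (g s + (r - s) *\<^sub>R d))) \<longlongrightarrow> 0) (at s within {0..h})"
    unfolding tendsto_at_iff_sequentially
  proof (intro allI impI)
    fix r assume r: "\<forall>i. r i \<in> {0..h} - {s}" "r \<longlonglongrightarrow> s"
    define m where "m i = min (r i) s" for i
    define k where "k i = \<bar>r i - s\<bar>" for i
    have k: "0 < k i" for i using r(1) by (auto simp: k_def)
    have m: "m i \<in> {0..h}" for i using r(1) s by (auto simp: m_def min_def)
    have "k \<longlonglongrightarrow> \<bar>s - s\<bar>" unfolding k_def by (intro tendsto_intros r(2))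
    then have k0: "k \<longlonglongrightarrow> 0" by simp
    have "m \<longlonglongrightarrow> min s s" unfolding m_def by (intro tendsto_intros r(2))
    then have m0: "m \<longlonglongrightarrow> s" by simp
    have "limitin \<gamma> (\<lambda>i. (1 / k i) *\<^sub>R (blinfun_apply (T (k i)) z - z)) (A z) sequentially"
      using generator_limitin[OF z] k k0 by (simp add: limitin_\<gamma>_at_right_iff)
    from circ_tendsto[OF \<phi> T_limitin[OF this m s m0]]
    have lim: "(\<lambda>i. blinfun_apply \<phi> (blinfun_apply (T (m i)) ((1 / k i) *\<^sub>R (blinfun_apply (T (k i)) z - z))) - d) \<longlonglongrightarrow> 0"
      by (simp add: d_def LIM_zero)
    show "((\<lambda>r. (1 / norm (r - s)) *\<^sub>R (g r - (g s + (r - s) *\<^sub>R d))) \<circ> r) \<longlonglongrightarrow> 0"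
    proof (rule Lim_null_comparison[OF _ tendsto_norm_zero[OF lim]], intro always_eventually allI)
      fix i
      have "m i \<ge> 0" "k i \<ge> 0" using m[of i] k[of i] by auto
      then have eq: "blinfun_apply \<phi> (blinfun_apply (T (m i)) ((1 / k i) *\<^sub>R (blinfun_apply (T (k i)) z - z))) =
          (1 / k i) *\<^sub>R (g (m i + k i) - g (m i))"
        by (simp add: g_def blinfun.scaleR_right blinfun.diff_right T_add)
      show "norm (((\<lambda>r. (1 / norm (r - s)) *\<^sub>R (g r - (g s + (r - s) *\<^sub>R d))) \<circ> r) i) \<le>
          norm (blinfun_apply \<phi> (blinfun_apply (T (m i)) ((1 / k i) *\<^sub>R (blinfun_apply (T (k i)) z - z))) - d)"
      proof (cases "s < r i")
        case True
        then have "m i = s" "k i = r i - s" by (auto simp: m_def k_def)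
        then have "(1 / norm (r i - s)) *\<^sub>R (g (r i) - (g s + (r i - s) *\<^sub>R d)) =
            (1 / (r i - s)) *\<^sub>R (g (r i) - g s) - ((r i - s) / (r i - s)) *\<^sub>R d"
          using True by (simp add: scaleR_diff_right diff_diff_eq2 scaleR_add_right)
        then have "(1 / norm (r i - s)) *\<^sub>R (g (r i) - (g s + (r i - s) *\<^sub>R d)) =
            (1 / k i) *\<^sub>R (g (m i + k i) - g (m i)) - d"
          using True \<open>m i = s\<close> \<open>k i = r i - s\<close> by simp
        then show ?thesis unfolding eq by simp
      next
        case False
        then have "r i < s" using r(1) by (metis DiffE insertI1 linorder_neqE)
        then have "m i = r i" "k i = s - r i" by (auto simp: m_def k_def)
        then have "(1 / norm (r i - s)) *\<^sub>R (g (r i) - (g s + (r i - s) *\<^sub>R d)) =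
            (1 / (s - r i)) *\<^sub>R (g (r i) - g s) + ((s - r i) / (s - r i)) *\<^sub>R d"
        proof -
          have "g (r i) - (g s + (r i - s) *\<^sub>R d) = (g (r i) - g s) + (s - r i) *\<^sub>R d"
            by (simp add: algebra_simps)
          then show ?thesis using \<open>r i < s\<close> by (simp only: scaleR_add_right) simp
        qed
        then have neg: "(1 / norm (r i - s)) *\<^sub>R (g (r i) - (g s + (r i - s) *\<^sub>R d)) =
            - ((1 / k i) *\<^sub>R (g (m i + k i) - g (m i)) - d)"
          using \<open>r i < s\<close> \<open>m i = r i\<close> \<open>k i = s - r i\<close> by (simp add: scaleR_diff_right)
        show ?thesis unfolding comp_apply neg eq norm_minus_cancel by (rule order_refl)
      qed
    qed
  qed
  then show ?thesis
    unfolding has_vector_derivative_def has_derivative_within g_def[symmetric] d_def[symmetric]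
    by (simp add: bounded_linear_scaleR_left)
qed

text \<open>The integrand is minus the derivative of \<open>s \<mapsto> e\<^sup>-\<^sup>l\<^sup>s T(s)z\<close>.\<close>

lemma laplace_resolvent_identity:
  assumes h: "0 \<le> h" and z: "z \<in> D"
  shows "laplace l h (l *\<^sub>R z - A z) = z - exp (- l * h) *\<^sub>R blinfun_apply (T h) z"
proof (rule circ_dual_separates)
  fix \<phi> assume \<phi>: "\<phi> \<in> X\<^sub>c"
  let ?g = "\<lambda>s. exp (- l * s) *\<^sub>R blinfun_apply \<phi> (blinfun_apply (T s) z)"
  let ?f = "\<lambda>s. exp (- l * s) *\<^sub>R blinfun_apply \<phi> (blinfun_apply (T s) (l *\<^sub>R z - A z))"
  have "((\<lambda>s. - ?f s) has_integral (?g h - ?g 0)) {0..h}"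
  proof (rule fundamental_theorem_of_calculus[OF h])
    fix s assume s: "s \<in> {0..h}"
    have "((\<lambda>s. exp (- l * s)) has_field_derivative (- l * exp (- l * s))) (at s within {0..h})"
      by (auto intro!: derivative_eq_intros)
    from has_vector_derivative_scaleR[OF this orbit_derivative[OF z \<phi> s]]
    show "(?g has_vector_derivative - ?f s) (at s within {0..h})"
      by (simp add: blinfun.diff_right blinfun.scaleR_right algebra_simps)
  qed
  then have "integral {0..h} (\<lambda>s. - ?f s) = ?g h - ?g 0" by (rule integral_unique)
  then have "- integral {0..h} ?f = ?g h - ?g 0" by (simp only: integral_neg)
  from arg_cong[OF this, of uminus] have "integral {0..h} ?f = - (?g h - ?g 0)"
    by (simp only: minus_minus)
  then show "blinfun_apply \<phi> (laplace l h (l *\<^sub>R z - A z)) =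
      blinfun_apply \<phi> (z - exp (- l * h) *\<^sub>R blinfun_apply (T h) z)"
    unfolding laplace_apply[OF h \<phi>] by (simp add: blinfun.diff_right blinfun.scaleR_right T_0)
qed

text \<open>The mean value inequality for the orbit of \<open>z\<close>. The constant \<open>c\<close> is \<open>0\<close> for norm estimates and \<open>\<phi>(Az)\<close> for
the comparison of \<open>A\<close> with difference quotients.\<close>

lemma orbit_increment:
  assumes t: "0 \<le> t" and z: "z \<in> D" and \<phi>: "\<phi> \<in> X\<^sub>c"
    and e: "\<And>s. s \<in> {0..t} \<Longrightarrow> norm (blinfun_apply \<phi> (blinfun_apply (T s) (A z)) - c) \<le> e"
  shows "norm (blinfun_apply \<phi> (blinfun_apply (T t) z - z) - t *\<^sub>R c) \<le> t * e"
proof -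
  let ?f = "\<lambda>s. blinfun_apply \<phi> (blinfun_apply (T s) (A z))"
  have "(?f has_integral (blinfun_apply \<phi> (blinfun_apply (T t) z) - blinfun_apply \<phi> (blinfun_apply (T 0) z))) {0..t}"
    by (rule fundamental_theorem_of_calculus[OF t]) (rule orbit_derivative[OF z \<phi>])
  then have "blinfun_apply \<phi> (blinfun_apply (T t) z - z) - t *\<^sub>R c = integral {0..t} ?f - integral {0..t} (\<lambda>s. c)"
    using t by (simp add: integral_unique T_0 blinfun.diff_right)
  also have "\<dots> = integral {0..t} (\<lambda>s. ?f s - c)"
    by (rule integral_diff[symmetric]) (auto intro!: integrable_continuous_real orbit_continuous_circ \<phi>)
  also have "norm \<dots> \<le> e * (t - 0)"
    by (rule integral_bound[OF t]) (auto intro!: continuous_intros orbit_continuous_circ \<phi> e)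
  finally show ?thesis by (simp add: mult.commute)
qed

end

section \<open>The bi-sun dual and the Favard space\<close>

context bicontinuous
begin

abbreviation X\<^sub>s :: "('x \<Rightarrow>\<^sub>L 'k) set" where "X\<^sub>s \<equiv> bisun_dual smul \<tau> T"

lemma bisun_circ: "\<phi> \<in> X\<^sub>s \<Longrightarrow> \<phi> \<in> X\<^sub>c"
  by (simp add: bisun_dual_def)

lemma bisun_dual_scaleR:
  assumes "\<phi> \<in> X\<^sub>s"
  shows "r *\<^sub>R \<phi> \<in> X\<^sub>s"
proof -
  have "((\<lambda>t. norm (r *\<^sub>R ((\<phi> o\<^sub>L T t) - \<phi>))) \<longlongrightarrow> 0) (at_right 0)"
    using tendsto_mult[OF tendsto_const[of "\<bar>r\<bar>"], of "\<lambda>t. norm ((\<phi> o\<^sub>L T t) - \<phi>)" 0] assms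
    by (simp add: bisun_dual_def)
  moreover have "((r *\<^sub>R \<phi>) o\<^sub>L T t) - r *\<^sub>R \<phi> = r *\<^sub>R ((\<phi> o\<^sub>L T t) - \<phi>)" for t
    by (rule blinfun_eqI) (simp add: blinfun.bilinear_simps scaleR_diff_right)
  ultimately show ?thesis
    using circ_dual_scaleR[OF bisun_circ[OF assms]] unfolding bisun_dual_def by simp
qed

lemma bisun_dual_diff:
  assumes "\<phi> \<in> X\<^sub>s" "\<psi> \<in> X\<^sub>s"
  shows "\<phi> - \<psi> \<in> X\<^sub>s"
proof -
  have "((\<lambda>t. ((\<phi> o\<^sub>L T t) - \<phi>) - ((\<psi> o\<^sub>L T t) - \<psi>)) \<longlongrightarrow> 0 - 0) (at_right 0)"
    using assms by (intro tendsto_diff) (auto simp: bisun_dual_def tendsto_norm_zero_iff)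
  moreover have "((\<phi> - \<psi>) o\<^sub>L T t) - (\<phi> - \<psi>) = ((\<phi> o\<^sub>L T t) - \<phi>) - ((\<psi> o\<^sub>L T t) - \<psi>)" for t
    by (rule blinfun_eqI) (simp add: blinfun.bilinear_simps)
  ultimately show ?thesis
    using circ_dual_diff[OF assms[THEN bisun_circ]] unfolding bisun_dual_def tendsto_norm_zero_iff
    by (simp only: diff_zero mem_Collect_eq)
qed

lemma bisun_dual_small:
  assumes "\<phi> \<in> X\<^sub>s" "e > 0"
  obtains d where "d > 0" "\<And>t. 0 \<le> t \<Longrightarrow> t < d \<Longrightarrow> norm ((\<phi> o\<^sub>L T t) - \<phi>) \<le> e"
proof -
  have "eventually (\<lambda>t. norm ((\<phi> o\<^sub>L T t) - \<phi>) < e) (at_right 0)"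
    using assms order_tendstoD(2)[of "\<lambda>t. norm ((\<phi> o\<^sub>L T t) - \<phi>)" 0 "at_right 0" e]
    by (simp add: bisun_dual_def)
  then obtain d where d: "d > 0" "\<And>t. 0 < t \<Longrightarrow> t < d \<Longrightarrow> norm ((\<phi> o\<^sub>L T t) - \<phi>) < e"
    by (auto simp: eventually_at_right_field)
  have "(\<phi> o\<^sub>L T 0) - \<phi> = 0" by (rule blinfun_eqI) (simp add: blinfun.bilinear_simps T_0)
  then have "norm ((\<phi> o\<^sub>L T t) - \<phi>) \<le> e" if "0 \<le> t" "t < d" for t
    using d(2)[of t] that assms(2) by (cases "t = 0") auto
  then show thesis using that d(1) by blast
qed

text \<open>The error is controlled by \<open>\<parallel>Az\<parallel>\<close> and by the norm continuity of the orbit of \<open>\<phi>\<close>, uniformly in \<open>z\<close>. So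
\<open>\<phi>(Az)\<close> is a limit, uniform on sets where \<open>A\<close> is bounded, of expressions that depend continuously on \<open>z\<close>.
This is the use made of the bi-sun dual.\<close>

lemma bisun_increment:
  assumes \<phi>: "\<phi> \<in> X\<^sub>c" and z: "z \<in> D" and t: "0 \<le> t"
    and e: "\<And>s. s \<in> {0..t} \<Longrightarrow> norm ((\<phi> o\<^sub>L T s) - \<phi>) \<le> e"
  shows "norm (blinfun_apply \<phi> (blinfun_apply (T t) z - z) - t *\<^sub>R blinfun_apply \<phi> (A z)) \<le> t * (e * norm (A z))"
proof (rule orbit_increment[OF t z \<phi>])
  fix s assume s: "s \<in> {0..t}"
  have "norm (blinfun_apply ((\<phi> o\<^sub>L T s) - \<phi>) (A z)) \<le> e * norm (A z)"
    by (intro order_trans[OF norm_blinfun] mult_right_mono e s) simp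
  then show "norm (blinfun_apply \<phi> (blinfun_apply (T s) (A z)) - blinfun_apply \<phi> (A z)) \<le> e * norm (A z)"
    by (simp add: blinfun.bilinear_simps)
qed

lemma orbit_norm_increment:
  assumes z: "z \<in> D" and t: "0 \<le> t" and M: "\<And>s. s \<in> {0..t} \<Longrightarrow> norm (T s) \<le> M"
  shows "norm (blinfun_apply (T t) z - z) \<le> t * (M * norm (A z))"
proof (rule norm_le_circ)
  fix \<phi> assume \<phi>: "\<phi> \<in> X\<^sub>c" "norm \<phi> \<le> 1"
  have "norm (blinfun_apply \<phi> (blinfun_apply (T t) z - z) - t *\<^sub>R 0) \<le> t * (M * norm (A z))"
  proof (rule orbit_increment[OF t z \<phi>(1)])
    fix s assume s: "s \<in> {0..t}"
    have "norm (blinfun_apply \<phi> (blinfun_apply (T s) (A z))) \<le> 1 * norm (blinfun_apply (T s) (A z))"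
      by (intro order_trans[OF norm_blinfun] mult_right_mono \<phi>) simp
    also have "\<dots> \<le> M * norm (A z)"
      unfolding mult_1 by (intro order_trans[OF norm_blinfun] mult_right_mono M s) simp
    finally show "norm (blinfun_apply \<phi> (blinfun_apply (T s) (A z)) - 0) \<le> M * norm (A z)" by simp
  qed
  then show "norm (blinfun_apply \<phi> (blinfun_apply (T t) z - z)) \<le> t * (M * norm (A z))" by simp
qed

lemma bounded_linear_laplace:
  assumes "0 \<le> h"
  shows "bounded_linear (laplace l h)"
proof -
  obtain C where C: "0 \<le> C" "\<And>k x. k \<in> {0..h} \<Longrightarrow> norm (laplace l k x) \<le> k * (C * norm x)"
    using laplace_bounded[OF assms, of l] by auto
  show ?thesis
    by (rule bounded_linear_intro[of _ "h * C"])
      (use laplace_add laplace_scaleR C(2)[of h] assms in \<open>auto simp: mult_ac\<close>)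
qed

lemma blinfun_laplace: "0 \<le> h \<Longrightarrow> blinfun_apply (Blinfun (laplace l h)) = laplace l h"
  by (rule bounded_linear_Blinfun_apply[OF bounded_linear_laplace])

lemma circ_dualI:
  assumes \<phi>: "\<phi> \<in> norm_dual smul"
    and null: "\<And>f. limitin \<gamma> f 0 sequentially \<Longrightarrow> (\<lambda>n. blinfun_apply \<phi> (f n)) \<longlonglongrightarrow> 0"
  shows "\<phi> \<in> X\<^sub>c"
  unfolding circ_dual_iff
proof (intro conjI allI impI)
  fix f l assume "limitin \<gamma> f l sequentially"
  from limitin_\<gamma>_diff[OF this limitin_\<gamma>_const[of l]]
  have "(\<lambda>n. blinfun_apply \<phi> (f n - l)) \<longlonglongrightarrow> 0" by (intro null) simp
  then show "(\<lambda>n. blinfun_apply \<phi> (f n)) \<longlonglongrightarrow> blinfun_apply \<phi> l"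
    by (simp add: blinfun.diff_right LIM_zero_iff)
qed (rule \<phi>)

lemma circ_dual_comp_laplace:
  assumes h: "0 \<le> h" and \<phi>: "\<phi> \<in> X\<^sub>c"
  shows "\<phi> o\<^sub>L Blinfun (laplace l h) \<in> X\<^sub>c"
proof (rule circ_dualI)
  show "\<phi> o\<^sub>L Blinfun (laplace l h) \<in> norm_dual smul"
    by (simp add: norm_dual_def blinfun_laplace[OF h] laplace_smul[OF h] circ_smul[OF \<phi>])
  show "(\<lambda>n. blinfun_apply (\<phi> o\<^sub>L Blinfun (laplace l h)) (f n)) \<longlonglongrightarrow> 0" if "limitin \<gamma> f 0 sequentially" for f
    using laplace_circ_dual[OF h \<phi> that] by (simp add: blinfun_laplace[OF h])
qed

lemma bisun_norm_bdd:
  "bdd_above ((\<lambda>\<phi>. norm (blinfun_apply \<phi> x)) ` {\<phi> \<in> X\<^sub>s. norm \<phi> \<le> 1})"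
proof (rule bdd_aboveI2[of _ _ "norm x"])
  fix \<phi> assume "\<phi> \<in> {\<phi> \<in> X\<^sub>s. norm \<phi> \<le> 1}"
  then have "norm (blinfun_apply \<phi> x) \<le> 1 * norm x"
    by (intro order_trans[OF norm_blinfun] mult_right_mono) auto
  then show "norm (blinfun_apply \<phi> x) \<le> norm x" by simp
qed

lemma bisun_dual_zero: "0 \<in> X\<^sub>s"
proof -
  have "0 \<in> X\<^sub>c" by (rule circ_dualI) (auto simp: norm_dual_def)
  moreover have "(0 o\<^sub>L T t) = 0" for t by (rule blinfun_eqI) simp
  ultimately show ?thesis by (simp add: bisun_dual_def)
qed

lemma bisun_norm_le_iff:
  "bisun_norm smul \<tau> T x \<le> c \<longleftrightarrow> (\<forall>\<phi>\<in>X\<^sub>s. norm \<phi> \<le> 1 \<longrightarrow> norm (blinfun_apply \<phi> x) \<le> c)"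
proof -
  have "0 \<in> {\<phi> \<in> X\<^sub>s. norm \<phi> \<le> 1}" using bisun_dual_zero by simp
  then have "{\<phi> \<in> X\<^sub>s. norm \<phi> \<le> 1} \<noteq> {}" by blast
  from cSUP_le_iff[OF this bisun_norm_bdd[of x], of c] show ?thesis
    unfolding bisun_norm_def by blast
qed

lemma bisun_norm_le_norm: "bisun_norm smul \<tau> T x \<le> norm x"
  unfolding bisun_norm_le_iff
proof (intro ballI impI)
  fix \<phi> :: "'x \<Rightarrow>\<^sub>L 'k" assume "norm \<phi> \<le> 1"
  then have "norm (blinfun_apply \<phi> x) \<le> 1 * norm x"
    by (intro order_trans[OF norm_blinfun] mult_right_mono) auto
  then show "norm (blinfun_apply \<phi> x) \<le> norm x" by simp
qed

text \<open>For \<open>\<phi> \<in> X\<^sub>c\<close> the mean \<open>\<psi>\<close> of \<open>\<phi> \<circ> T(s)\<close> over \<open>[0,h]\<close> belongs to the bi-sun dual, because \<open>\<psi> \<circ> T(t) - \<psi>\<close> is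
\<open>1/h\<close> times a difference of two integrals over intervals of length \<open>t\<close>. The norms of these means are
bounded for \<open>h \<le> 1\<close>, and their values at \<open>x\<close> converge to \<open>\<phi>(x)\<close> as \<open>h \<rightarrow> 0\<close>.\<close>

lemma norm_le_bisun_norm:
  obtains C where "0 \<le> C" "\<And>x c. bisun_norm smul \<tau> T x \<le> c \<Longrightarrow> norm x \<le> C * c"
proof -
  obtain C where C: "0 \<le> C" "\<And>k x. k \<in> {0..1} \<Longrightarrow> norm (laplace 0 k x) \<le> k * (C * norm x)"
    using laplace_bounded[of 1 0] by auto
  have "norm x \<le> (C + 1) * c" if c: "bisun_norm smul \<tau> T x \<le> c" for x c
  proof (rule norm_le_circ)
    fix \<phi> assume \<phi>: "\<phi> \<in> X\<^sub>c" "norm \<phi> \<le> 1"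
    have one: "norm (blinfun_apply \<phi> y) \<le> norm y" for y
      using order_trans[OF norm_blinfun mult_right_mono[OF \<phi>(2) norm_ge_zero[of y]]] by simp
    have mean: "norm (blinfun_apply \<phi> ((1 / h) *\<^sub>R laplace 0 h x)) \<le> (C + 1) * c" if h: "0 < h" "h \<le> 1" for h
    proof -
      define \<psi> where "\<psi> = (1 / h) *\<^sub>R (\<phi> o\<^sub>L Blinfun (laplace 0 h))"
      have app: "blinfun_apply \<psi> y = (1 / h) *\<^sub>R blinfun_apply \<phi> (laplace 0 h y)" for y
        using h by (simp add: \<psi>_def blinfun.bilinear_simps blinfun_laplace)
      have "\<psi> \<in> X\<^sub>c" unfolding \<psi>_def using h \<phi> by (intro circ_dual_scaleR circ_dual_comp_laplace) auto
      moreover have "((\<lambda>t. norm ((\<psi> o\<^sub>L T t) - \<psi>)) \<longlongrightarrow> 0) (at_right 0)"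
      proof (rule Lim_null_comparison)
        define K where "K = (1 / h) * (C * (norm (T h) + 1))"
        have "((\<lambda>t. t * K) \<longlongrightarrow> 0 * K) (at_right 0)" by (intro tendsto_intros)
        then show "((\<lambda>t. t * K) \<longlongrightarrow> 0) (at_right 0)" by simp
        have "eventually (\<lambda>t. 0 < t \<and> t < (1::real)) (at_right 0)"
          by (auto simp: eventually_at_right_field intro!: exI[of _ 1])
        then show "eventually (\<lambda>t. norm (norm ((\<psi> o\<^sub>L T t) - \<psi>)) \<le> t * K) (at_right 0)"
        proof eventually_elim
          case (elim t)
          have "norm ((\<psi> o\<^sub>L T t) - \<psi>) \<le> t * K"
          proof (rule norm_blinfun_bound)
            show "0 \<le> t * K" using elim h C(1) by (simp add: K_def)
            fix y
            have "laplace 0 t y + laplace 0 h (blinfun_apply (T t) y) = laplace 0 h y + laplace 0 t (blinfun_apply (T h) y)"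
              using laplace_split[of t h 0 y] laplace_split[of h t 0 y] elim h by (simp add: add.commute)
            then have "laplace 0 h (blinfun_apply (T t) y) - laplace 0 h y = laplace 0 t (blinfun_apply (T h) y) - laplace 0 t y"
              by (simp add: algebra_simps)
            moreover have "laplace 0 t (blinfun_apply (T h) y - y) = laplace 0 t (blinfun_apply (T h) y) - laplace 0 t y"
              using bounded_linear.linear[OF bounded_linear_laplace[of t 0]] elim by (simp add: linear_diff)
            \<comment> \<open>The integral over \<open>[0, t + h]\<close> has been split at \<open>t\<close> and at \<open>h\<close>.\<close>
            ultimately have eq: "laplace 0 h (blinfun_apply (T t) y) - laplace 0 h y = laplace 0 t (blinfun_apply (T h) y - y)"
              by simp
            have "norm (blinfun_apply (T h) y - y) \<le> (norm (T h) + 1) * norm y"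
              using norm_triangle_ineq4[of "blinfun_apply (T h) y" y] norm_blinfun[of "T h" y]
              by (simp add: algebra_simps)
            then have "norm (laplace 0 t (blinfun_apply (T h) y - y)) \<le> t * (C * ((norm (T h) + 1) * norm y))"
              using elim C(1) by (intro order_trans[OF C(2)] mult_left_mono) auto
            then have "norm (blinfun_apply \<phi> (laplace 0 h (blinfun_apply (T t) y) - laplace 0 h y)) \<le> t * (C * ((norm (T h) + 1) * norm y))"
              unfolding eq using one order_trans by blast
            then have "(1 / h) * norm (blinfun_apply \<phi> (laplace 0 h (blinfun_apply (T t) y) - laplace 0 h y))
                \<le> (1 / h) * (t * (C * ((norm (T h) + 1) * norm y)))"
              using h by (intro mult_left_mono) auto
            moreover have "blinfun_apply ((\<psi> o\<^sub>L T t) - \<psi>) y =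
                (1 / h) *\<^sub>R blinfun_apply \<phi> (laplace 0 h (blinfun_apply (T t) y) - laplace 0 h y)"
              by (simp add: blinfun.bilinear_simps app scaleR_diff_right)
            ultimately show "norm (blinfun_apply ((\<psi> o\<^sub>L T t) - \<psi>) y) \<le> t * K * norm y"
              using h by (simp add: K_def mult_ac)
          qed
          then show ?case by simp
        qed
      qed
      ultimately have \<psi>: "\<psi> \<in> X\<^sub>s" by (simp add: bisun_dual_def)
      have "norm \<psi> \<le> C"
      proof (rule norm_blinfun_bound[OF C(1)])
        fix y
        have "norm (blinfun_apply \<phi> (laplace 0 h y)) \<le> h * (C * norm y)"
          using order_trans[OF one C(2)[of h y]] h by simp
        then show "norm (blinfun_apply \<psi> y) \<le> C * norm y"
          using h by (simp add: app field_simps)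
      qed
      then have "norm ((1 / (C + 1)) *\<^sub>R \<psi>) \<le> 1" using C(1) by (simp add: field_simps)
      then have "norm (blinfun_apply ((1 / (C + 1)) *\<^sub>R \<psi>) x) \<le> c"
        using c bisun_dual_scaleR[OF \<psi>] unfolding bisun_norm_le_iff by blast
      then have "norm (blinfun_apply \<psi> x) \<le> (C + 1) * c"
        using C(1) by (simp add: blinfun.bilinear_simps field_simps)
      then show ?thesis by (simp add: app blinfun.scaleR_right)
    qed
    have "limitin \<gamma> (\<lambda>n. (1 / inverse (real (Suc n))) *\<^sub>R laplace 0 (inverse (real (Suc n))) x) x sequentially"
      using laplace_small[of 0 x] LIMSEQ_inverse_real_of_nat unfolding limitin_\<gamma>_at_right_iff
      by (metis inverse_positive_iff_positive of_nat_0_less_iff zero_less_Suc)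
    from tendsto_norm[OF circ_tendsto[OF \<phi>(1) this]]
    show "norm (blinfun_apply \<phi> x) \<le> (C + 1) * c"
      by (rule tendsto_upperbound) (auto intro!: always_eventually mean simp: inverse_le_1_iff simp del: of_nat_Suc)
  qed
  then show thesis using that[of "C + 1"] C(1) by simp
qed

lemma favard_iff:
  "x \<in> favard_space T \<longleftrightarrow> (\<exists>C d. 0 < d \<and> (\<forall>t. 0 < t \<and> t < d \<longrightarrow> norm (blinfun_apply (T t) x - x) \<le> t * C))"
proof
  assume "x \<in> favard_space T"
  then have "Limsup (at_right 0) (\<lambda>t. ereal ((1 / t) * norm (blinfun_apply (T t) x - x))) \<noteq> \<infinity>"
    by (simp add: favard_space_def)
  then obtain n :: nat where "Limsup (at_right 0) (\<lambda>t. ereal ((1 / t) * norm (blinfun_apply (T t) x - x))) < ereal (real n)"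
    using less_PInf_Ex_of_nat by blast
  from Limsup_lessD[OF this] obtain d where d: "d > 0"
    "\<And>t. 0 < t \<Longrightarrow> t < d \<Longrightarrow> (1 / t) * norm (blinfun_apply (T t) x - x) < real n"
    by (auto simp: eventually_at_right_field)
  have "norm (blinfun_apply (T t) x - x) \<le> t * real n" if "0 < t" "t < d" for t
    using d(2)[OF that] that by (simp add: field_simps)
  then show "\<exists>C d. 0 < d \<and> (\<forall>t. 0 < t \<and> t < d \<longrightarrow> norm (blinfun_apply (T t) x - x) \<le> t * C)"
    using d(1) by blast
next
  assume "\<exists>C d. 0 < d \<and> (\<forall>t. 0 < t \<and> t < d \<longrightarrow> norm (blinfun_apply (T t) x - x) \<le> t * C)"
  then obtain C d where d: "0 < (d::real)" "\<And>t. 0 < t \<Longrightarrow> t < d \<Longrightarrow> norm (blinfun_apply (T t) x - x) \<le> t * C" by blast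
  have "eventually (\<lambda>t. ereal ((1 / t) * norm (blinfun_apply (T t) x - x)) \<le> ereal C) (at_right 0)"
    unfolding eventually_at_right_field
  proof (intro exI[of _ d] conjI allI impI)
    fix t assume "0 < t" "t < d"
    then show "ereal ((1 / t) * norm (blinfun_apply (T t) x - x)) \<le> ereal C"
      using d(2)[of t] by (simp add: field_simps)
  qed (rule d(1))
  from Limsup_bounded[OF this]
  have "Limsup (at_right 0) (\<lambda>t. ereal ((1 / t) * norm (blinfun_apply (T t) x - x))) \<le> ereal C" .
  then show "x \<in> favard_space T" by (auto simp: favard_space_def)
qed

lemma generator_dom_subset_favard: "D \<subseteq> favard_space T"
proof
  fix z assume z: "z \<in> D"
  obtain M where M: "0 \<le> M" "\<And>s. s \<in> {0..1} \<Longrightarrow> norm (T s) \<le> M" using T_bounded by blast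
  have "norm (blinfun_apply (T t) z - z) \<le> t * (M * norm (A z))" if "0 < t" "t < 1" for t
    using that by (intro orbit_norm_increment z M) auto
  then show "z \<in> favard_space T" unfolding favard_iff using zero_less_one by blast
qed

context
  fixes \<mu> :: 'k and R :: "'x \<Rightarrow>\<^sub>L 'x"
  assumes \<mu>: "\<mu> \<in> resolvent_set smul D A" and R: "R = resolvent smul D A \<mu>"
begin

lemma resolvent_eq: "blinfun_apply R = inv_into D (\<lambda>x. smul \<mu> x - A x)"
proof -
  obtain S where S: "inv_into D (\<lambda>x. smul \<mu> x - A x) = blinfun_apply S"
    using \<mu> unfolding resolvent_set_def by blast
  show ?thesis unfolding R resolvent_def S by (simp add: blinfun_apply_inverse)
qed

lemma resolvent_in_dom: "blinfun_apply R y \<in> D"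
  and resolvent_right: "smul \<mu> (blinfun_apply R y) - A (blinfun_apply R y) = y"
  using \<mu> inv_into_into[of y "\<lambda>x. smul \<mu> x - A x" D] f_inv_into_f[of y "\<lambda>x. smul \<mu> x - A x" D]
  unfolding resolvent_eq resolvent_set_def bij_betw_def by auto

lemma resolvent_left: "z \<in> D \<Longrightarrow> blinfun_apply R (smul \<mu> z - A z) = z"
  using \<mu> inv_into_f_f[of "\<lambda>x. smul \<mu> x - A x" D z]
  unfolding resolvent_eq resolvent_set_def bij_betw_def by auto

text \<open>The means \<open>z\<^sub>n\<close> of the orbit of \<open>x\<close> over \<open>[0, t\<^sub>n]\<close> satisfy \<open>A z\<^sub>n = (T(t\<^sub>n)x - x)/t\<^sub>n\<close>, which is bounded for \<open>x\<close>
in the Favard space. After division by a constant \<open>r\<close> they lie in the image of the unit ball, and they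
converge to \<open>x\<close>.\<close>

lemma favard_subset_of_sequentially_closed:
  assumes closed: "sequentially_closedin \<gamma> (blinfun_apply R ` {x. bisun_norm smul \<tau> T x \<le> 1})"
  shows "favard_space T \<subseteq> D"
proof
  fix x assume "x \<in> favard_space T"
  then obtain C d where d: "0 < d" "\<And>t. 0 < t \<Longrightarrow> t < d \<Longrightarrow> norm (blinfun_apply (T t) x - x) \<le> t * C"
    unfolding favard_iff by blast
  \<comment> \<open>The shift by two in the denominator keeps \<open>t n\<close> strictly below \<open>d\<close>.\<close>
  define t where "t n = d * inverse (real (Suc (Suc n)))" for n
  have inv1: "inverse (real (Suc (Suc n))) < 1" for n by (simp add: inverse_less_1_iff)
  have t: "0 < t n" "t n < d" for n
    using d(1) mult_strict_left_mono[OF inv1[of n] d(1)] by (auto simp: t_def simp del: of_nat_Suc)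
  have "t \<longlonglongrightarrow> d * 0"
    unfolding t_def by (intro tendsto_mult tendsto_const LIMSEQ_Suc[OF LIMSEQ_inverse_real_of_nat])
  then have t0: "t \<longlonglongrightarrow> 0" by simp
  define z where "z n = laplace 0 (t n) ((1 / t n) *\<^sub>R x)" for n
  have zJ: "z n = (1 / t n) *\<^sub>R laplace 0 (t n) x" for n
    unfolding z_def using t by (intro laplace_scaleR less_imp_le)
  have zD: "z n \<in> D" and zA: "norm (A (z n)) \<le> C" for n
  proof -
    note gen = laplace_generator[OF less_imp_le[OF t(1)], of 0 n "(1 / t n) *\<^sub>R x", folded z_def]
    show "z n \<in> D" by (rule gen)
    have "A (z n) = (1 / t n) *\<^sub>R (blinfun_apply (T (t n)) x - x)"
      using gen(2) by (simp add: blinfun.scaleR_right scaleR_diff_right)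
    moreover have "norm ((1 / t n) *\<^sub>R (blinfun_apply (T (t n)) x - x)) \<le> C"
      using d(2)[OF t(1)[of n] t(2)[of n]] t(1)[of n] by (simp add: divide_simps mult.commute)
    ultimately show "norm (A (z n)) \<le> C" by simp
  qed
  have zlim: "limitin \<gamma> z x sequentially"
    using laplace_small[of 0 x] t t0 unfolding limitin_\<gamma>_at_right_iff zJ[abs_def] by blast
  obtain K where K: "\<And>n. norm (z n) \<le> K" using limitin_\<gamma>_bounded[OF zlim] by (auto simp: bounded_iff)
  define y where "y n = smul \<mu> (z n) - A (z n)" for n
  define r where "r = norm \<mu> * K + C + 1"
  have "0 \<le> K" "0 \<le> C" using K[of 0] zA[of 0] norm_ge_zero order_trans by blast+
  then have r: "0 < r" by (simp add: r_def add_nonneg_pos)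
  have y: "norm (y n) \<le> r" for n
  proof -
    have "norm (y n) \<le> norm \<mu> * norm (z n) + norm (A (z n))"
      unfolding y_def using norm_triangle_ineq4[of "smul \<mu> (z n)" "A (z n)"] by (simp add: norm_scale)
    also have "\<dots> \<le> norm \<mu> * K + C" by (intro add_mono mult_left_mono K zA) auto
    finally show ?thesis by (simp add: r_def)
  qed
  have mem: "(1 / r) *\<^sub>R z n \<in> blinfun_apply R ` {x. bisun_norm smul \<tau> T x \<le> 1}" for n
  proof (rule image_eqI)
    show "(1 / r) *\<^sub>R z n = blinfun_apply R ((1 / r) *\<^sub>R y n)"
      using resolvent_left[OF zD] by (simp add: y_def blinfun.scaleR_right)
    have "norm ((1 / r) *\<^sub>R y n) \<le> 1" using y[of n] r by (simp add: field_simps)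
    then show "(1 / r) *\<^sub>R y n \<in> {x. bisun_norm smul \<tau> T x \<le> 1}"
      using bisun_norm_le_norm order_trans by blast
  qed
  have "limitin \<gamma> (\<lambda>n. (1 / r) *\<^sub>R z n) ((1 / r) *\<^sub>R x) sequentially"
    by (rule limitin_\<gamma>_scaleR[OF tendsto_const zlim])
  with closed[unfolded sequentially_closedin_def] image_subsetI[of UNIV "\<lambda>n. (1 / r) *\<^sub>R z n", OF mem]
  have "(1 / r) *\<^sub>R x \<in> blinfun_apply R ` {x. bisun_norm smul \<tau> T x \<le> 1}"
    by simp
  then obtain v where "(1 / r) *\<^sub>R x = blinfun_apply R v" by blast
  then have "r *\<^sub>R ((1 / r) *\<^sub>R x) = blinfun_apply R (r *\<^sub>R v)" by (simp add: blinfun.scaleR_right)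
  then have "x = blinfun_apply R (r *\<^sub>R v)" using r by simp
  then show "x \<in> D" using resolvent_in_dom by metis
qed

text \<open>Points of the closure are approximated by points of the image \<open>K\<close> with respect to two functionals at a
time: \<open>\<phi>\<close> and \<open>\<phi> \<circ> T(t)\<close> for the Favard estimate, \<open>\<phi>\<close> and the difference quotient
\<open>(\<phi> \<circ> T(t) - \<phi>)/t\<close> for the bound of the bi-sun norm. That \<open>A\<close> is bounded on \<open>K\<close> makes both estimates uniform.\<close>

lemma closed_of_favard_subset:
  assumes mazur: "\<And>\<phi>. \<phi> \<in> X\<^sub>c \<Longrightarrow> continuous_map \<gamma> euclidean (blinfun_apply \<phi>)"
    and fav: "favard_space T \<subseteq> D"
  shows "closedin \<gamma> (blinfun_apply R ` {x. bisun_norm smul \<tau> T x \<le> 1})"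
proof -
  define K where "K = blinfun_apply R ` {x. bisun_norm smul \<tau> T x \<le> 1}"
  obtain C where C: "0 \<le> C" "\<And>x c. bisun_norm smul \<tau> T x \<le> c \<Longrightarrow> norm x \<le> C * c"
    using norm_le_bisun_norm by blast
  define L where "L = norm \<mu> * (norm R * C) + C"
  have KA: "norm (A z) \<le> L" and KD: "z \<in> D" if zK: "z \<in> K" for z
  proof -
    obtain y where y: "z = blinfun_apply R y" "bisun_norm smul \<tau> T y \<le> 1" using zK by (auto simp: K_def)
    show "z \<in> D" unfolding y by (rule resolvent_in_dom)
    have ny: "norm y \<le> C" using C(2)[OF y(2)] by simp
    have "norm z \<le> norm R * C"
      unfolding y using ny by (intro order_trans[OF norm_blinfun] mult_left_mono) auto
    then have "norm (smul \<mu> z) \<le> norm \<mu> * (norm R * C)"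
      unfolding norm_scale by (intro mult_left_mono) auto
    moreover have "A z = smul \<mu> z - y" using resolvent_right[of y] y by (simp add: algebra_simps)
    ultimately show "norm (A z) \<le> L"
      using norm_triangle_ineq4[of "smul \<mu> z" y] ny by (simp add: L_def)
  qed
  have L: "0 \<le> L" using C(1) by (simp add: L_def)
  obtain M where M: "0 \<le> M" "\<And>s. s \<in> {0..1} \<Longrightarrow> norm (T s) \<le> M" using T_bounded by blast
  have "x \<in> K" if x: "x \<in> \<gamma> closure_of K" for x
  proof -
    have approx: "\<exists>z\<in>K. norm (blinfun_apply \<phi> z - blinfun_apply \<phi> x) < e \<and>
        norm (blinfun_apply \<psi> z - blinfun_apply \<psi> x) < e"
      if \<phi>: "\<phi> \<in> X\<^sub>c" and \<psi>: "\<psi> \<in> X\<^sub>c" and e: "e > 0" for \<phi> \<psi> e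
    proof -
      have nbhd: "openin \<gamma> {z. norm (blinfun_apply \<theta> z - blinfun_apply \<theta> x) < e}" if "\<theta> \<in> X\<^sub>c" for \<theta>
      proof -
        have "openin \<gamma> {z \<in> topspace \<gamma>. blinfun_apply \<theta> z \<in> ball (blinfun_apply \<theta> x) e}"
          by (rule openin_continuous_map_preimage[OF mazur[OF that]]) simp
        then show ?thesis by (simp add: topspace_\<gamma> dist_norm norm_minus_commute)
      qed
      define U where "U = {z. norm (blinfun_apply \<phi> z - blinfun_apply \<phi> x) < e} \<inter>
          {z. norm (blinfun_apply \<psi> z - blinfun_apply \<psi> x) < e}"
      have "openin \<gamma> U" unfolding U_def by (intro openin_Int nbhd \<phi> \<psi>)
      moreover have "x \<in> U" using e by (simp add: U_def)
      ultimately obtain z where "z \<in> K" "z \<in> U" using x unfolding in_closure_of by blast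
      then show ?thesis by (auto simp: U_def)
    qed
    have "norm (blinfun_apply (T t) x - x) \<le> t * (M * L)" if t: "0 < t" "t < 1" for t
    proof (rule norm_le_circ, rule field_le_epsilon)
      fix \<phi> and e :: real assume \<phi>: "\<phi> \<in> X\<^sub>c" "norm \<phi> \<le> 1" and e: "e > 0"
      have \<phi>T: "\<phi> o\<^sub>L T t \<in> X\<^sub>c" using t by (intro circ_dual_T \<phi>) simp
      have "e / 2 > 0" using e by simp
      from approx[OF \<phi>T \<phi>(1) this] obtain z where z: "z \<in> K"
        "norm (blinfun_apply (\<phi> o\<^sub>L T t) z - blinfun_apply (\<phi> o\<^sub>L T t) x) < e / 2"
        "norm (blinfun_apply \<phi> z - blinfun_apply \<phi> x) < e / 2" by blast
      have "norm (blinfun_apply (T t) z - z) \<le> t * (M * norm (A z))"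
        using t by (intro orbit_norm_increment KD z M) auto
      also have "\<dots> \<le> t * (M * L)" using t M(1) KA[OF z(1)] by (intro mult_left_mono) auto
      finally have "norm (blinfun_apply \<phi> (blinfun_apply (T t) z - z)) \<le> t * (M * L)"
        using order_trans[OF norm_blinfun mult_right_mono[OF \<phi>(2) norm_ge_zero[of "blinfun_apply (T t) z - z"]]]
        by simp
      moreover have "blinfun_apply \<phi> (blinfun_apply (T t) x - x) = blinfun_apply \<phi> (blinfun_apply (T t) z - z)
          - (blinfun_apply (\<phi> o\<^sub>L T t) z - blinfun_apply (\<phi> o\<^sub>L T t) x) + (blinfun_apply \<phi> z - blinfun_apply \<phi> x)"
        by (simp add: blinfun.diff_right)
      ultimately show "norm (blinfun_apply \<phi> (blinfun_apply (T t) x - x)) \<le> t * (M * L) + e"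
        using z(2,3) norm_triangle_ineq[of "blinfun_apply \<phi> (blinfun_apply (T t) z - z)
          - (blinfun_apply (\<phi> o\<^sub>L T t) z - blinfun_apply (\<phi> o\<^sub>L T t) x)" "blinfun_apply \<phi> z - blinfun_apply \<phi> x"]
          norm_triangle_ineq4[of "blinfun_apply \<phi> (blinfun_apply (T t) z - z)"
            "blinfun_apply (\<phi> o\<^sub>L T t) z - blinfun_apply (\<phi> o\<^sub>L T t) x"]
        by simp
    qed
    then have "x \<in> favard_space T" unfolding favard_iff using zero_less_one by blast
    then have xD: "x \<in> D" using fav by blast
    define y where "y = smul \<mu> x - A x"
    have "bisun_norm smul \<tau> T y \<le> 1"
      unfolding bisun_norm_le_iff
    proof (intro ballI impI, rule field_le_epsilon)
      fix \<phi> and e :: real assume \<phi>: "\<phi> \<in> X\<^sub>s" "norm \<phi> \<le> 1" and e: "e > 0"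
      have \<phi>c: "\<phi> \<in> X\<^sub>c" by (rule bisun_circ[OF \<phi>(1)])
      define N where "N = max L (norm (A x))"
      have N: "0 \<le> N" "L \<le> N" "norm (A x) \<le> N" using L by (auto simp: N_def)
      define e1 where "e1 = e / (4 * (N + 1))"
      have e1: "e1 > 0" using e N by (simp add: e1_def)
      have "e1 * N \<le> e1 * (N + 1)" using e1 by simp
      also have "\<dots> = e / 4" using N by (simp add: e1_def divide_simps)
      finally have e1N: "e1 * N \<le> e / 4" .
      obtain d where d: "d > 0" "\<And>t. 0 \<le> t \<Longrightarrow> t < d \<Longrightarrow> norm ((\<phi> o\<^sub>L T t) - \<phi>) \<le> e1"
        using bisun_dual_small[OF \<phi>(1) e1] by blast
      define t where "t = d / 2"
      have t: "0 < t" "t < d" using d(1) by (auto simp: t_def)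
      \<comment> \<open>It applies to \<open>x\<close> as well as to all points of \<open>K\<close>; \<open>N\<close> was chosen for this.\<close>
      have quot: "norm ((1 / t) *\<^sub>R blinfun_apply \<phi> (blinfun_apply (T t) z - z) - blinfun_apply \<phi> (A z)) \<le> e / 4"
        if z: "z \<in> D" "norm (A z) \<le> N" for z
      proof -
        have "norm (blinfun_apply \<phi> (blinfun_apply (T t) z - z) - t *\<^sub>R blinfun_apply \<phi> (A z)) \<le> t * (e1 * norm (A z))"
          using t by (intro bisun_increment \<phi>c z d) auto
        also have "\<dots> \<le> t * (e1 * N)" using t e1 z by (intro mult_left_mono) auto
        also have "\<dots> \<le> t * (e / 4)" using t e1N by (intro mult_left_mono) auto
        finally have "(1 / t) * norm (blinfun_apply \<phi> (blinfun_apply (T t) z - z) - t *\<^sub>R blinfun_apply \<phi> (A z)) \<le> (1 / t) * (t * (e / 4))"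
          using t by (intro mult_left_mono) auto
        then have "norm ((1 / t) *\<^sub>R (blinfun_apply \<phi> (blinfun_apply (T t) z - z) - t *\<^sub>R blinfun_apply \<phi> (A z))) \<le> e / 4"
          using t by simp
        then show ?thesis using t by (simp add: scaleR_diff_right)
      qed
      define \<psi> where "\<psi> = (1 / t) *\<^sub>R ((\<phi> o\<^sub>L T t) - \<phi>)"
      have \<psi>c: "\<psi> \<in> X\<^sub>c" unfolding \<psi>_def using t by (intro circ_dual_scaleR circ_dual_diff circ_dual_T \<phi>c) auto
      have \<psi>: "blinfun_apply \<psi> z = (1 / t) *\<^sub>R blinfun_apply \<phi> (blinfun_apply (T t) z - z)" for z
        by (simp add: \<psi>_def blinfun.bilinear_simps)
      define e2 where "e2 = e / (4 * (norm \<mu> + 1))"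
      have mu1: "0 < norm \<mu> + 1" by (simp add: add_nonneg_pos)
      have e2: "0 < e2" using e mu1 by (simp add: e2_def)
      have "norm \<mu> * e2 + e2 = (norm \<mu> + 1) * e2" by (simp add: algebra_simps)
      also have "\<dots> = e / 4" using mu1 unfolding e2_def by (metis nonzero_mult_div_cancel_left less_irrefl mult.left_commute divide_divide_eq_left' times_divide_eq_right)
      finally have mue: "norm \<mu> * e2 + e2 = e / 4" .
      obtain z where z: "z \<in> K" "norm (blinfun_apply \<phi> z - blinfun_apply \<phi> x) < e2"
        "norm (blinfun_apply \<psi> z - blinfun_apply \<psi> x) < e2"
        using approx[OF \<phi>c \<psi>c e2] by blast
      obtain w where w: "z = blinfun_apply R w" "bisun_norm smul \<tau> T w \<le> 1" using z(1) by (auto simp: K_def)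
      have w1: "norm (blinfun_apply \<phi> w) \<le> 1" using w(2) \<phi> by (simp add: bisun_norm_le_iff)
      have weq: "w = smul \<mu> z - A z" using resolvent_right[of w] w by simp
      \<comment> \<open>Replace \<open>A\<close> by the difference quotient at \<open>x\<close>, pass from \<open>x\<close> to \<open>z\<close>, and replace it back at \<open>z\<close>.\<close>
      have "blinfun_apply \<phi> y - blinfun_apply \<phi> w = \<mu> * (blinfun_apply \<phi> x - blinfun_apply \<phi> z)
          - ((blinfun_apply \<phi> (A x) - blinfun_apply \<psi> x) + (blinfun_apply \<psi> x - blinfun_apply \<psi> z)
             + (blinfun_apply \<psi> z - blinfun_apply \<phi> (A z)))"
        by (simp add: y_def weq blinfun.diff_right circ_smul[OF \<phi>c] algebra_simps)
      also have "norm \<dots> \<le> norm \<mu> * e2 + (e / 4 + e2 + e / 4)"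
      proof (rule order_trans[OF norm_triangle_ineq4], rule add_mono[OF _ order_trans[OF norm_triangle_ineq add_mono[OF order_trans[OF norm_triangle_ineq add_mono]]]])
        show "norm (\<mu> * (blinfun_apply \<phi> x - blinfun_apply \<phi> z)) \<le> norm \<mu> * e2"
          unfolding norm_mult using z(2) by (intro mult_left_mono) (auto simp: norm_minus_commute)
        show "norm (blinfun_apply \<phi> (A x) - blinfun_apply \<psi> x) \<le> e / 4"
          using quot[OF xD N(3)] by (simp add: \<psi> norm_minus_commute)
        show "norm (blinfun_apply \<psi> x - blinfun_apply \<psi> z) \<le> e2"
          using z(3) by (simp add: norm_minus_commute)
        show "norm (blinfun_apply \<psi> z - blinfun_apply \<phi> (A z)) \<le> e / 4"
          using quot[OF KD[OF z(1)] order_trans[OF KA[OF z(1)] N(2)]] by (simp add: \<psi>)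
      qed
      also have "\<dots> \<le> e" using mue e by simp
      finally show "norm (blinfun_apply \<phi> y) \<le> 1 + e"
        using norm_triangle_sub[of "blinfun_apply \<phi> y" "blinfun_apply \<phi> w"] w1 by simp
    qed
    moreover have "x = blinfun_apply R y" unfolding y_def by (rule resolvent_left[OF xD, symmetric])
    ultimately show "x \<in> K" unfolding K_def by blast
  qed
  then have "\<gamma> closure_of K \<subseteq> K" by blast
  then show ?thesis
    unfolding K_def[symmetric] by (simp add: closure_of_subset_eq[symmetric] topspace_\<gamma>)
qed

end

end

section \<open>A resolvent that maps the bi-sun dual into the domain of its generator\<close>

context bicontinuous
begin

context
  fixes l :: real and S :: "'x \<Rightarrow>\<^sub>L 'x"
  assumes S: "S = exp (- l) *\<^sub>R T 1" and S_half: "norm S \<le> 1 / 2"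
begin

lemma S_contraction: "norm (blinfun_apply S x) \<le> norm x / 2"
  using order_trans[OF norm_blinfun mult_right_mono[OF S_half norm_ge_zero[of x]]] by simp

lemma fixed_point_unique:
  assumes "w = x + blinfun_apply S w" "v = x + blinfun_apply S v"
  shows "w = v"
proof -
  have "w - v = blinfun_apply S (w - v)"
    using assms by (metis add_diff_cancel_left blinfun.diff_right)
  then have "norm (w - v) \<le> norm (w - v) / 2" using S_contraction[of "w - v"] by simp
  then show ?thesis by simp
qed

text \<open>The inverse of \<open>1 - S\<close>, obtained as a fixed point of a contraction.\<close>

definition neumann :: "'x \<Rightarrow> 'x" where "neumann x = (SOME w. w = x + blinfun_apply S w)"

lemma neumann_eq: "neumann x = x + blinfun_apply S (neumann x)"
proof -
  have "\<forall>v w. dist (x + blinfun_apply S v) (x + blinfun_apply S w) \<le> 1 / 2 * dist v w"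
    using S_contraction by (simp add: dist_norm blinfun.diff_right[symmetric])
  from banach_fix_type[OF _ _ this] obtain w where "x + blinfun_apply S w = w" by auto
  then have "\<exists>w. w = x + blinfun_apply S w" by metis
  from someI_ex[OF this] show ?thesis unfolding neumann_def .
qed

lemma neumann_eqI: "w = x + blinfun_apply S w \<Longrightarrow> neumann x = w"
  using fixed_point_unique[OF neumann_eq] by blast

lemma neumann_norm: "norm (neumann x) \<le> 2 * norm x"
proof -
  have "norm (neumann x) \<le> norm x + norm (blinfun_apply S (neumann x))"
    using norm_triangle_ineq[of x "blinfun_apply S (neumann x)"] neumann_eq[of x] by simp
  then show ?thesis using S_contraction[of "neumann x"] by simp
qed

lemma neumann_add: "neumann (x + y) = neumann x + neumann y"
proof (rule neumann_eqI)
  have "neumann x + neumann y = (x + blinfun_apply S (neumann x)) + (y + blinfun_apply S (neumann y))"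
    using neumann_eq[of x] neumann_eq[of y] by simp
  also have "\<dots> = x + y + blinfun_apply S (neumann x + neumann y)"
    by (simp add: blinfun.add_right)
  finally show "neumann x + neumann y = x + y + blinfun_apply S (neumann x + neumann y)" .
qed

lemma neumann_smul: "neumann (smul c x) = smul c (neumann x)"
proof (rule neumann_eqI)
  have "blinfun_apply S (smul c (neumann x)) = smul c (blinfun_apply S (neumann x))"
    using T_smul[of 1 c "neumann x"] unfolding S
    by (simp add: scaleR_blinfun.rep_eq scale_of_real[symmetric] mult.commute)
  moreover have "smul c (neumann x) = smul c (x + blinfun_apply S (neumann x))" using neumann_eq[of x] by simp
  ultimately show "smul c (neumann x) = smul c x + blinfun_apply S (smul c (neumann x))"
    by (simp add: scale_right_distrib)
qed

lemma neumann_T: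
  assumes t: "0 \<le> t"
  shows "neumann (blinfun_apply (T t) x) = blinfun_apply (T t) (neumann x)"
proof (rule neumann_eqI)
  have "blinfun_apply S (blinfun_apply (T t) (neumann x)) = blinfun_apply (T t) (blinfun_apply S (neumann x))"
    using T_commute[of 1 t "neumann x"] t unfolding S by (simp add: scaleR_blinfun.rep_eq blinfun.scaleR_right)
  moreover have "blinfun_apply (T t) (neumann x) = blinfun_apply (T t) (x + blinfun_apply S (neumann x))"
    using neumann_eq[of x] by simp
  ultimately show "blinfun_apply (T t) (neumann x) = blinfun_apply (T t) x + blinfun_apply S (blinfun_apply (T t) (neumann x))"
    by (simp add: blinfun.add_right)
qed

lemma neumann_scaleR: "neumann (r *\<^sub>R x) = r *\<^sub>R neumann x"
  using neumann_smul[of "of_real r" x] by (simp add: scale_of_real)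

lemma laplace_neumann_dom: "laplace l 1 (neumann y) \<in> D"
  by (rule laplace_generator) simp

text \<open>The truncated transform inverts \<open>l - A\<close> up to the error \<open>S\<close>, and the inverse of \<open>1 - S\<close> corrects it.\<close>

lemma laplace_neumann_right: "l *\<^sub>R laplace l 1 (neumann y) - A (laplace l 1 (neumann y)) = y"
proof -
  have "A (laplace l 1 (neumann y)) = l *\<^sub>R laplace l 1 (neumann y) - (neumann y - blinfun_apply S (neumann y))"
    using laplace_generator(2)[of 1 l "neumann y"] by (simp add: S scaleR_blinfun.rep_eq)
  moreover have "neumann y - blinfun_apply S (neumann y) = y" using neumann_eq[of y] by (metis add_diff_cancel_right')
  ultimately show ?thesis by simp
qed

lemma dom_injective:
  assumes z: "z \<in> D" "v \<in> D" and eq: "l *\<^sub>R z - A z = l *\<^sub>R v - A v"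
  shows "z = v"
proof -
  have J1: "laplace l 1 (l *\<^sub>R u - A u) = u - blinfun_apply S u" if "u \<in> D" for u
    using laplace_resolvent_identity[of 1 u l] that by (simp add: S scaleR_blinfun.rep_eq)
  have "z - blinfun_apply S z = v - blinfun_apply S v"
    using J1[OF z(1)] J1[OF z(2)] eq by simp
  then have "v = (z - blinfun_apply S z) + blinfun_apply S v" by simp
  moreover have "z = (z - blinfun_apply S z) + blinfun_apply S z" by simp
  ultimately show ?thesis by (metis fixed_point_unique)
qed

definition res :: "'x \<Rightarrow>\<^sub>L 'x" where "res = Blinfun (\<lambda>y. laplace l 1 (neumann y))"

lemma res_apply: "blinfun_apply res y = laplace l 1 (neumann y)"
proof -
  obtain C where C: "0 \<le> C" "\<And>k x. k \<in> {0..1} \<Longrightarrow> norm (laplace l k x) \<le> k * (C * norm x)"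
    using laplace_bounded[of 1 l] by auto
  have "bounded_linear (\<lambda>y. laplace l 1 (neumann y))"
  proof (rule bounded_linear_intro[of _ "2 * C"])
    fix x :: 'x
    have "norm (laplace l 1 (neumann x)) \<le> C * norm (neumann x)" using C(2)[of 1 "neumann x"] by simp
    also have "\<dots> \<le> C * (2 * norm x)" by (intro mult_left_mono neumann_norm C)
    finally show "norm (laplace l 1 (neumann x)) \<le> norm x * (2 * C)" by (simp add: mult_ac)
  qed (simp_all add: neumann_add neumann_scaleR laplace_add laplace_scaleR)
  then show ?thesis unfolding res_def by (simp add: bounded_linear_Blinfun_apply)
qed

lemma inv_into_eq_res:
  "bij_betw (\<lambda>x. smul (of_real l) x - A x) D UNIV"
  "inv_into D (\<lambda>x. smul (of_real l) x - A x) = blinfun_apply res"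
proof -
  have inj: "inj_on (\<lambda>x. smul (of_real l) x - A x) D"
    by (rule inj_onI) (simp add: scale_of_real dom_injective)
  have "y \<in> (\<lambda>x. smul (of_real l) x - A x) ` D" for y
    using laplace_neumann_right[of y, symmetric] laplace_neumann_dom[of y] by (auto simp: scale_of_real)
  then show "bij_betw (\<lambda>x. smul (of_real l) x - A x) D UNIV"
    using inj by (auto simp: bij_betw_def)
  show "inv_into D (\<lambda>x. smul (of_real l) x - A x) = blinfun_apply res"
  proof
    fix y show "inv_into D (\<lambda>x. smul (of_real l) x - A x) y = blinfun_apply res y"
      unfolding res_apply by (rule inv_into_f_eq[OF inj laplace_neumann_dom]) (simp add: scale_of_real laplace_neumann_right)
  qed
qed

lemma res_resolvent:
  "of_real l \<in> resolvent_set smul D A" "resolvent smul D A (of_real l) = res"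
proof -
  have "res \<in> bounded_operators smul"
    by (simp add: bounded_operators_def res_apply neumann_smul laplace_smul)
  then show "of_real l \<in> resolvent_set smul D A"
    using inv_into_eq_res by (auto simp: resolvent_set_def)
  show "resolvent smul D A (of_real l) = res"
    unfolding resolvent_def inv_into_eq_res(2) by (rule blinfun_apply_inverse)
qed

text \<open>Since \<open>\<phi>((1 - S)\<^sup>-\<^sup>1 f\<^sub>n) = \<phi>(f\<^sub>n) + (\<phi> \<circ> S)((1 - S)\<^sup>-\<^sup>1 f\<^sub>n)\<close> and \<open>\<phi> \<circ> S\<close> has at most half the norm of \<open>\<phi>\<close>, iterating
\<open>m\<close> times leaves \<open>m\<close> null sequences and a remainder of size \<open>2\<^sup>-\<^sup>m\<close>.\<close>

lemma neumann_null:
  assumes f: "limitin \<gamma> f 0 sequentially" and \<phi>: "\<phi> \<in> X\<^sub>c"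
  shows "(\<lambda>n. blinfun_apply \<phi> (neumann (f n))) \<longlonglongrightarrow> 0"
proof -
  obtain K where K: "\<And>n. norm (f n) \<le> K" using limitin_\<gamma>_bounded[OF f] by (auto simp: bounded_iff)
  have NK: "norm (neumann (f n)) \<le> 2 * K" for n using neumann_norm[of "f n"] K[of n] by simp
  have K0: "0 \<le> K" using K[of 0] norm_ge_zero order_trans by blast
  have small: "eventually (\<lambda>n. norm (blinfun_apply \<theta> (neumann (f n))) \<le> (1 / 2) ^ m * (norm \<theta> * (2 * K)) + e) sequentially"
    if "\<theta> \<in> X\<^sub>c" "e > 0" for \<theta> e m
    using that
  proof (induction m arbitrary: \<theta> e)
    case 0
    have "norm (blinfun_apply \<theta> (neumann (f n))) \<le> norm \<theta> * (2 * K)" for n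
      by (intro order_trans[OF norm_blinfun] mult_left_mono NK) simp
    then show ?case using 0 by (intro always_eventually allI) (simp add: add_increasing2)
  next
    case (Suc m)
    have "\<theta> o\<^sub>L S = exp (- l) *\<^sub>R (\<theta> o\<^sub>L T 1)"
      by (rule blinfun_eqI) (simp add: S scaleR_blinfun.rep_eq blinfun.scaleR_right)
    then have S\<theta>: "\<theta> o\<^sub>L S \<in> X\<^sub>c"
      using Suc.prems(1) by (simp add: circ_dual_scaleR circ_dual_T)
    have "norm (\<theta> o\<^sub>L S) \<le> norm \<theta> * (1 / 2)"
      by (intro order_trans[OF norm_blinfun_compose] mult_left_mono S_half) simp
    then have "(1 / 2) ^ m * (norm (\<theta> o\<^sub>L S) * (2 * K)) \<le> (1 / 2) ^ m * (norm \<theta> * (1 / 2) * (2 * K))"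
      using K0 by (intro mult_left_mono mult_right_mono) auto
    then have le: "(1 / 2) ^ m * (norm (\<theta> o\<^sub>L S) * (2 * K)) \<le> (1 / 2) ^ Suc m * (norm \<theta> * (2 * K))"
      by simp
    have e2: "e / 2 > 0" using Suc.prems by simp
    have "(\<lambda>n. norm (blinfun_apply \<theta> (f n))) \<longlonglongrightarrow> 0"
      using tendsto_norm[OF circ_tendsto[OF Suc.prems(1) f]] by simp
    then have "eventually (\<lambda>n. norm (blinfun_apply \<theta> (f n)) < e / 2) sequentially"
      using e2 by (rule order_tendstoD)
    with Suc.IH[OF S\<theta> e2] show ?case
    proof eventually_elim
      case (elim n)
      have "blinfun_apply \<theta> (neumann (f n)) = blinfun_apply \<theta> (f n) + blinfun_apply (\<theta> o\<^sub>L S) (neumann (f n))"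
        using neumann_eq[of "f n"] by (metis blinfun.add_right blinfun_apply_blinfun_compose)
      then have "norm (blinfun_apply \<theta> (neumann (f n))) \<le>
          norm (blinfun_apply \<theta> (f n)) + norm (blinfun_apply (\<theta> o\<^sub>L S) (neumann (f n)))"
        by (metis norm_triangle_ineq)
      then show ?case using elim le by linarith
    qed
  qed
  show ?thesis
  proof (rule tendstoI)
    fix e :: real assume e: "e > 0"
    have "(\<lambda>m. (1 / 2) ^ m * (norm \<phi> * (2 * K))) \<longlonglongrightarrow> 0 * (norm \<phi> * (2 * K))"
      by (intro tendsto_mult tendsto_const LIMSEQ_realpow_zero) auto
    then have "eventually (\<lambda>m. (1 / 2) ^ m * (norm \<phi> * (2 * K)) < e / 2) sequentially"
      using e by (intro order_tendstoD(2)[of _ 0]) auto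
    then obtain m where m: "(1 / 2) ^ m * (norm \<phi> * (2 * K)) < e / 2"
      by (auto simp: eventually_sequentially)
    have "e / 4 > 0" using e by simp
    from small[OF \<phi> this, of m] show "eventually (\<lambda>n. dist (blinfun_apply \<phi> (neumann (f n))) 0 < e) sequentially"
    proof eventually_elim
      case (elim n)
      then show ?case using m e unfolding dist_norm diff_zero by linarith
    qed
  qed
qed

lemma circ_dual_comp_res:
  assumes \<phi>: "\<phi> \<in> X\<^sub>c"
  shows "\<phi> o\<^sub>L res \<in> X\<^sub>c"
proof (rule circ_dualI)
  show "\<phi> o\<^sub>L res \<in> norm_dual smul"
    by (simp add: norm_dual_def res_apply neumann_smul laplace_smul circ_smul[OF \<phi>])
  fix f assume f: "limitin \<gamma> f 0 sequentially"
  have "\<phi> o\<^sub>L Blinfun (laplace l 1) \<in> X\<^sub>c" by (intro circ_dual_comp_laplace \<phi>) simp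
  from neumann_null[OF f this] show "(\<lambda>n. blinfun_apply (\<phi> o\<^sub>L res) (f n)) \<longlonglongrightarrow> 0"
    by (simp add: blinfun_laplace res_apply)
qed

text \<open>Since \<open>A\<close> composed with the resolvent is bounded, the comparison of \<open>\<phi>(Az)\<close> with difference quotients
at \<open>z = R x\<close> is uniform for \<open>x\<close> in the unit ball. So the difference quotients of \<open>\<phi> \<circ> R\<close> converge in norm,
with limit \<open>\<psi> = l (\<phi> \<circ> R) - \<phi>\<close>.\<close>

lemma bisun_dual_comp_res:
  assumes \<phi>: "\<phi> \<in> X\<^sub>s"
  shows "\<phi> o\<^sub>L res \<in> bisun_generator_dom smul \<tau> T"
proof -
  have \<phi>c: "\<phi> \<in> X\<^sub>c" by (rule bisun_circ[OF \<phi>])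
  define \<psi> where "\<psi> = l *\<^sub>R (\<phi> o\<^sub>L res) - \<phi>"
  define C where "C = \<bar>l\<bar> * norm res + 1"
  have C: "0 < C" by (simp add: C_def add_nonneg_pos)
  have AQ: "A (blinfun_apply res x) = l *\<^sub>R blinfun_apply res x - x" for x
    using laplace_neumann_right[of x] unfolding res_apply by (simp add: diff_eq_eq eq_diff_eq add.commute)
  have AQ_norm: "norm (A (blinfun_apply res x)) \<le> C * norm x" for x
  proof -
    have "norm (A (blinfun_apply res x)) \<le> \<bar>l\<bar> * norm (blinfun_apply res x) + norm x"
      unfolding AQ using norm_triangle_ineq4[of "l *\<^sub>R blinfun_apply res x" x] by simp
    also have "\<dots> \<le> \<bar>l\<bar> * (norm res * norm x) + norm x"
      by (intro add_right_mono mult_left_mono norm_blinfun) simp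
    finally show ?thesis by (simp add: C_def algebra_simps)
  qed
  have lim: "((\<lambda>t. (1 / t) *\<^sub>R (((\<phi> o\<^sub>L res) o\<^sub>L T t) - (\<phi> o\<^sub>L res))) \<longlongrightarrow> \<psi>) (at_right 0)"
  proof (rule tendstoI)
    fix e :: real assume e: "e > 0"
    define e1 where "e1 = e / (2 * C)"
    have e1: "e1 > 0" "e1 * C = e / 2" using e C by (simp_all add: e1_def)
    obtain d where d: "d > 0" "\<And>t. 0 \<le> t \<Longrightarrow> t < d \<Longrightarrow> norm ((\<phi> o\<^sub>L T t) - \<phi>) \<le> e1"
      using bisun_dual_small[OF \<phi> e1(1)] by blast
    have half: "norm ((1 / t) *\<^sub>R (((\<phi> o\<^sub>L res) o\<^sub>L T t) - (\<phi> o\<^sub>L res)) - \<psi>) \<le> e / 2" if t: "0 < t" "t < d" for t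
    proof (rule norm_blinfun_bound)
      show "0 \<le> e / 2" using e by simp
      fix x
      let ?z = "blinfun_apply res x"
      have zD: "?z \<in> D" unfolding res_apply by (rule laplace_neumann_dom)
      have Tz: "blinfun_apply res (blinfun_apply (T t) x) = blinfun_apply (T t) ?z"
        unfolding res_apply using t by (simp add: neumann_T T_laplace)
      have "norm (blinfun_apply \<phi> (blinfun_apply (T t) ?z - ?z) - t *\<^sub>R blinfun_apply \<phi> (A ?z)) \<le> t * (e1 * norm (A ?z))"
        using t by (intro bisun_increment \<phi>c zD d) auto
      also have "\<dots> \<le> t * (e1 * (C * norm x))"
        using t e1 AQ_norm by (intro mult_left_mono) auto
      finally have "(1 / t) * norm (blinfun_apply \<phi> (blinfun_apply (T t) ?z - ?z) - t *\<^sub>R blinfun_apply \<phi> (A ?z))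
          \<le> (1 / t) * (t * (e1 * (C * norm x)))"
        using t by (intro mult_left_mono) auto
      then have "norm ((1 / t) *\<^sub>R (blinfun_apply \<phi> (blinfun_apply (T t) ?z - ?z) - t *\<^sub>R blinfun_apply \<phi> (A ?z)))
          \<le> e1 * C * norm x"
        using t by (simp add: mult.assoc)
      moreover have "blinfun_apply ((1 / t) *\<^sub>R (((\<phi> o\<^sub>L res) o\<^sub>L T t) - (\<phi> o\<^sub>L res)) - \<psi>) x =
          (1 / t) *\<^sub>R (blinfun_apply \<phi> (blinfun_apply (T t) ?z - ?z) - t *\<^sub>R blinfun_apply \<phi> (A ?z))"
        using t by (simp add: \<psi>_def blinfun.bilinear_simps Tz AQ scaleR_diff_right)
      ultimately show "norm (blinfun_apply ((1 / t) *\<^sub>R (((\<phi> o\<^sub>L res) o\<^sub>L T t) - (\<phi> o\<^sub>L res)) - \<psi>) x) \<le> e / 2 * norm x"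
        unfolding e1(2) by simp
    qed
    have "dist ((1 / t) *\<^sub>R (((\<phi> o\<^sub>L res) o\<^sub>L T t) - (\<phi> o\<^sub>L res))) \<psi> < e" if "0 < t" "t < d" for t
      using half[OF that] e unfolding dist_norm by linarith
    then show "eventually (\<lambda>t. dist ((1 / t) *\<^sub>R (((\<phi> o\<^sub>L res) o\<^sub>L T t) - (\<phi> o\<^sub>L res))) \<psi> < e) (at_right 0)"
      unfolding eventually_at_right_field using d(1) by blast
  qed
  have "((\<lambda>t. t *\<^sub>R ((1 / t) *\<^sub>R (((\<phi> o\<^sub>L res) o\<^sub>L T t) - (\<phi> o\<^sub>L res)))) \<longlongrightarrow> 0 *\<^sub>R \<psi>) (at_right 0)"
    by (intro tendsto_scaleR lim tendsto_ident_at)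
  moreover have "eventually (\<lambda>t. t *\<^sub>R ((1 / t) *\<^sub>R (((\<phi> o\<^sub>L res) o\<^sub>L T t) - (\<phi> o\<^sub>L res))) =
      ((\<phi> o\<^sub>L res) o\<^sub>L T t) - (\<phi> o\<^sub>L res)) (at_right (0::real))"
    by (auto simp: eventually_at_filter)
  ultimately have "((\<lambda>t. ((\<phi> o\<^sub>L res) o\<^sub>L T t) - (\<phi> o\<^sub>L res)) \<longlongrightarrow> 0) (at_right 0)"
    using tendsto_cong by force
  then have Qs: "\<phi> o\<^sub>L res \<in> X\<^sub>s"
    using circ_dual_comp_res[OF \<phi>c] by (simp add: bisun_dual_def tendsto_norm_zero_iff)
  moreover have "\<psi> \<in> X\<^sub>s" unfolding \<psi>_def by (intro bisun_dual_diff bisun_dual_scaleR Qs \<phi>)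
  ultimately show ?thesis using lim unfolding bisun_generator_dom_def by blast
qed

lemma of_real_bisun_resolvent: "of_real l \<in> bisun_resolvent_set smul \<tau> T D A"
  unfolding bisun_resolvent_set_def using res_resolvent bisun_dual_comp_res by auto

end

lemma bisun_resolvent_set_nonempty: "bisun_resolvent_set smul \<tau> T D A \<noteq> {}"
proof -
  \<comment> \<open>The number for which \<open>e\<^sup>-\<^sup>l (\<parallel>T 1\<parallel> + 1) = 1/2\<close>.\<close>
  define l where "l = ln (2 * (norm (T 1) + 1))"
  have pos: "0 < norm (T 1) + 1" by (simp add: add_nonneg_pos)
  then have "exp (- l) = 1 / (2 * (norm (T 1) + 1))"
    by (simp add: l_def exp_minus inverse_eq_divide)
  then have half: "exp (- l) * (norm (T 1) + 1) = 1 / 2" using pos by simp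
  have "norm (exp (- l) *\<^sub>R T 1) \<le> exp (- l) * (norm (T 1) + 1)" by simp
  then have "norm (exp (- l) *\<^sub>R T 1) \<le> 1 / 2" unfolding half .
  from of_real_bisun_resolvent[OF refl this] show ?thesis by blast
qed

lemma favard_iff_resolvent_closed:
  fixes \<Lambda> :: "'k set" and B :: "'x set"
  assumes mazur: "\<And>\<phi>. \<phi> \<in> X\<^sub>c \<Longrightarrow> continuous_map \<gamma> euclidean (blinfun_apply \<phi>)"
    and \<Lambda>: "\<Lambda> = bisun_resolvent_set smul \<tau> T D A"
    and B: "B = {x. bisun_norm smul \<tau> T x \<le> 1}"
  shows
    "(favard_space T = D \<longleftrightarrow>
        (\<exists>\<mu>\<in>\<Lambda>. closedin \<gamma> (blinfun_apply (resolvent smul D A \<mu>) ` B))) \<and>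
     (favard_space T = D \<longleftrightarrow>
        (\<forall>\<mu>\<in>\<Lambda>. closedin \<gamma> (blinfun_apply (resolvent smul D A \<mu>) ` B))) \<and>
     (favard_space T = D \<longleftrightarrow>
        (\<exists>\<mu>\<in>\<Lambda>. sequentially_closedin \<gamma> (blinfun_apply (resolvent smul D A \<mu>) ` B))) \<and>
     (favard_space T = D \<longleftrightarrow>
        (\<forall>\<mu>\<in>\<Lambda>. sequentially_closedin \<gamma> (blinfun_apply (resolvent smul D A \<mu>) ` B)))"
proof -
  have \<rho>: "\<mu> \<in> resolvent_set smul D A" if "\<mu> \<in> \<Lambda>" for \<mu>
    using that by (simp add: \<Lambda> bisun_resolvent_set_def)
  have closed: "closedin \<gamma> (blinfun_apply (resolvent smul D A \<mu>) ` B)"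
    if "favard_space T = D" "\<mu> \<in> \<Lambda>" for \<mu>
    unfolding B by (rule closed_of_favard_subset[OF \<rho> refl mazur]) (use that in auto)
  have seq: "sequentially_closedin \<gamma> K" if "closedin \<gamma> K" for K
    unfolding sequentially_closedin_def
  proof (intro conjI allI impI)
    fix f l assume "range f \<subseteq> K \<and> limitin \<gamma> f l sequentially"
    then show "l \<in> K"
      using limitin_closedin[OF _ that, of f l sequentially] by (auto intro: always_eventually)
  qed (simp add: topspace_\<gamma>)
  have fav: "favard_space T = D"
    if "\<mu> \<in> \<Lambda>" "sequentially_closedin \<gamma> (blinfun_apply (resolvent smul D A \<mu>) ` B)" for \<mu>
    using favard_subset_of_sequentially_closed[OF \<rho>[OF that(1)] refl] that(2) generator_dom_subset_favard
    unfolding B by blast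
  obtain \<mu> where "\<mu> \<in> \<Lambda>" using bisun_resolvent_set_nonempty \<Lambda> by blast
  then show ?thesis using closed seq fav by blast
qed

end

theorem theorem6p10:
  fixes smul :: "'k::real_or_complex \<Rightarrow> 'x::banach \<Rightarrow> 'x"
    and \<tau> \<gamma> :: "'x topology"
    and T :: "real \<Rightarrow> 'x \<Rightarrow>\<^sub>L 'x"
    and D :: "'x set" and A :: "'x \<Rightarrow> 'x"
    and \<Lambda> :: "'k set" and B :: "'x set"
  assumes "sequentially_complete_saks_space smul \<tau>"
    and "d_consistent smul \<tau>"
    and "mazur_saks_space smul \<tau>"
    and "\<gamma> = mixed_topology smul \<tau>"
    and "bicontinuous_semigroup smul \<tau> T"
    and "D = generator_dom \<gamma> T"
    and "A = generator \<gamma> T"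
    and "\<Lambda> = bisun_resolvent_set smul \<tau> T D A"
    and "B = {x. bisun_norm smul \<tau> T x \<le> 1}"
  shows
    "(favard_space T = D \<longleftrightarrow>
        (\<exists>\<mu>\<in>\<Lambda>. closedin \<gamma> (blinfun_apply (resolvent smul D A \<mu>) ` B))) \<and>
     (favard_space T = D \<longleftrightarrow>
        (\<forall>\<mu>\<in>\<Lambda>. closedin \<gamma> (blinfun_apply (resolvent smul D A \<mu>) ` B))) \<and>
     (favard_space T = D \<longleftrightarrow>
        (\<exists>\<mu>\<in>\<Lambda>. sequentially_closedin \<gamma> (blinfun_apply (resolvent smul D A \<mu>) ` B))) \<and>
     (favard_space T = D \<longleftrightarrow>
        (\<forall>\<mu>\<in>\<Lambda>. sequentially_closedin \<gamma> (blinfun_apply (resolvent smul D A \<mu>) ` B)))"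
proof -
  have saks: "saks_space smul \<tau>" using assms(3) by (simp add: mazur_saks_space_def)
  then obtain P where P: "P \<noteq> {}" "\<forall>p\<in>P. seminorm_over smul p" "\<tau> = seminorm_topology P"
    "\<forall>x. bdd_above ((\<lambda>p. p x) ` P) \<and> norm x = (SUP p\<in>P. p x)"
    unfolding saks_space_def by blast
  interpret banach_space_over smul using saks by (simp add: saks_space_def)
  interpret bicontinuous smul P T
    by unfold_locales
      (use P assms(1,5) in \<open>simp_all add: sequentially_complete_saks_space_def\<close>)
  have mazur: "continuous_map (mixed_topology smul \<tau>) euclidean (blinfun_apply \<phi>)"
    if \<phi>: "\<phi> \<in> circ_dual smul \<tau>" for \<phi>
  proof -
    have "Vector_Spaces.linear smul (*) (blinfun_apply \<phi>)"
      using circ_smul[of \<phi>] \<phi> P(3)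
      by unfold_locales (simp_all add: blinfun.add_right algebra_simps)
    moreover have "sequentially_continuous_on (mixed_topology smul \<tau>) UNIV (blinfun_apply \<phi>)"
      using circ_tendsto[of \<phi>] \<phi> P(3) by (simp add: sequentially_continuous_on_def)
    ultimately show ?thesis using assms(3) unfolding mazur_saks_space_def by blast
  qed
  show ?thesis
    unfolding assms(4,6,7)
    by (rule favard_iff_resolvent_closed[folded P(3), OF mazur assms(8)[unfolded assms(4,6,7)] assms(9)])
qed

end
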